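(* Let $\varphi:M^2\to N^n$ be a biconservative surface in a Riemannian manifold. Denote by $\lambda_1$ and $\lambda_2$ the principal curvatures of $M$ corresponding to $\varphi$. Assume that $\lambda_1$ and $\lambda_2$ are constants and $\lambda_1=\lambda_2$. If the Gaussian curvature $K$ of $M$ satisfies $K=0$, then: a) locally, there exists $\psi:M^2\to N^3(c)$ an umbilical surface such that $A^\varphi_{H^\varphi}$ is the shape operator of $\psi$ in the direction of the unit normal vector field, where $$c=-\left|H^\varphi\right|^4;$$ moreover $\left|H^\psi\right|=\left|H^\varphi\right|^2$; b) locally, there exists $\psi:M^2\to N^3(c)$ an umbilical surface such that $S_2^\varphi$ is the shape operator of $\psi$ in the direction of the unit normal vector field, where $$c=-4\left|H^\varphi\right|^4;$$ moreover $\left|H^\psi\right|=2\left|H^\varphi\right|^2$.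
   Context: All manifolds, metrics and maps are smooth; all manifolds are connected and oriented. A surface $\varphi:M^2\to N^n$ is a Riemannian (isometric) immersion of a 2-dimensional Riemannian manifold $(M^2,g)$ into a Riemannian manifold. $B$ is the second fundamental form, $H=H^\varphi=\frac12\operatorname{trace}B$ the mean curvature vector field, and $A_H=A^\varphi_{H^\varphi}$ the shape operator in the direction of $H$, with $\langle A_H(X),Y\rangle=\langle B(X,Y),H\rangle$. The stress-bienergy tensor of a surface is $S_2=S_2^\varphi=-2|H|^2I+4A_H$ ($I$ the identity), and the surface is biconservative if $\operatorname{div}S_2=0$, where $\operatorname{div}T=\sum_i(\nabla_{X_i}T)(X_i)$ for a local orthonormal frame $\{X_i\}$. The principal curvatures corresponding to $\varphi$ are the eigenvalue functions of $A^\varphi_{H^\varphi}$. $N^3(c)$ denotes a 3-dimensional space form of constant sectional curvature $c$. "Locally" means: every point of $M$ has an open neighbourhood (with the metric $g$) on which such an isometric immersion $\psi$ into $N^3(c)$ exists; $H^\psi$ is the mean curvature vector field of $\psi$ (half the trace of its second fundamental form). Umbilical means that the shape operator of $\psi$ with respect to the unit normal is at each point a multiple of the identity. *)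

theory Defs
  imports "HOL-Analysis.Analysis"
begin

section \<open>Smooth maps between Euclidean spaces\<close>

text \<open>Only used for open \<open>S\<close>, where \<open>differentiable_on\<close> agrees with differentiability at
  every point of \<open>S\<close>.\<close>

primrec Ck_on :: "nat \<Rightarrow> ('a::euclidean_space \<Rightarrow> 'b::real_normed_vector) \<Rightarrow> 'a set \<Rightarrow> bool" where
  "Ck_on 0 f S \<longleftrightarrow> continuous_on S f"
| "Ck_on (Suc k) f S \<longleftrightarrow>
     f differentiable_on S \<and> (\<forall>v. Ck_on k (\<lambda>x. frechet_derivative f (at x) v) S)"

definition smooth_on :: "('a::euclidean_space \<Rightarrow> 'b::real_normed_vector) \<Rightarrow> 'a set \<Rightarrow> bool" where
  "smooth_on f S \<longleftrightarrow> (\<forall>k. Ck_on k f S)"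


section \<open>Riemannian geometry in local coordinates\<close>

text \<open>Throughout this section \<open>G\<close> is the Gram matrix field of a metric on an open subset of
  \<open>\<real>\<^sup>k\<close>; tangent vectors are given by their components in the coordinate frame. \<open>F\<close> is the coordinate
  expression of a map into a manifold whose metric has Gram matrix field \<open>Gt\<close>.\<close>

definition ip :: "real^'k^'k \<Rightarrow> real^'k \<Rightarrow> real^'k \<Rightarrow> real" where
  "ip g X Y = X \<bullet> (g *v Y)"

text \<open>\<open>g\<^sup>i\<^sup>j b(\<partial>\<^sub>i, \<partial>\<^sub>j)\<close>, which is the sum of \<open>b(e\<^sub>i, e\<^sub>i)\<close> over a \<open>g\<close>-orthonormal basis.\<close>

definition metric_trace ::
    "real^'k^'k \<Rightarrow> (real^'k \<Rightarrow> real^'k \<Rightarrow> 'b::real_vector) \<Rightarrow> 'b" where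
  "metric_trace g b = (\<Sum>i\<in>UNIV. \<Sum>j\<in>UNIV. (matrix_inv g $ i $ j) *\<^sub>R b (axis i 1) (axis j 1))"

text \<open>The vector with components \<open>\<Gamma>\<^sup>m\<^sub>i\<^sub>j X\<^sup>i Y\<^sup>j\<close> for the Levi-Civita connection, i.e. the Koszul formula
  for constant-coefficient vector fields, with the index raised by the inverse metric.\<close>

definition christoffel ::
    "(real^'k \<Rightarrow> real^'k^'k) \<Rightarrow> real^'k \<Rightarrow> real^'k \<Rightarrow> real^'k \<Rightarrow> real^'k" where
  "christoffel G u X Y = matrix_inv (G u) *v (\<chi> l. (1/2) *
     (frechet_derivative (\<lambda>w. ip (G w) Y (axis l 1)) (at u) X
    + frechet_derivative (\<lambda>w. ip (G w) X (axis l 1)) (at u) Y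
    - frechet_derivative (\<lambda>w. ip (G w) X Y) (at u) (axis l 1)))"

text \<open>\<open>\<nabla>\<^sub>X Y\<close> at \<open>u\<close>, for a vector field \<open>Y\<close> and a vector \<open>X\<close> at \<open>u\<close>.\<close>

definition cov_deriv ::
    "(real^'k \<Rightarrow> real^'k^'k) \<Rightarrow> (real^'k \<Rightarrow> real^'k) \<Rightarrow> real^'k \<Rightarrow> real^'k \<Rightarrow> real^'k" where
  "cov_deriv G Y u X = frechet_derivative Y (at u) X + christoffel G u X (Y u)"

text \<open>\<open>(\<nabla>\<^sub>X T)(Y) = \<nabla>\<^sub>X (T Y) - T (\<nabla>\<^sub>X Y)\<close> for a field \<open>T\<close> of endomorphisms; \<open>Y\<close> is extended with
  constant coefficients.\<close>

definition cov_deriv_endo ::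
    "(real^'k \<Rightarrow> real^'k^'k) \<Rightarrow> (real^'k \<Rightarrow> real^'k \<Rightarrow> real^'k)
      \<Rightarrow> real^'k \<Rightarrow> real^'k \<Rightarrow> real^'k \<Rightarrow> real^'k" where
  "cov_deriv_endo G T u X Y =
     cov_deriv G (\<lambda>w. T w Y) u X - T u (cov_deriv G (\<lambda>_. Y) u X)"

definition divergence ::
    "(real^'k \<Rightarrow> real^'k^'k) \<Rightarrow> (real^'k \<Rightarrow> real^'k \<Rightarrow> real^'k) \<Rightarrow> real^'k \<Rightarrow> real^'k" where
  "divergence G T u = metric_trace (G u) (cov_deriv_endo G T u)"

text \<open>\<open>R(X,Y)Z = \<nabla>\<^sub>X \<nabla>\<^sub>Y Z - \<nabla>\<^sub>Y \<nabla>\<^sub>X Z\<close>; the bracket vanishes because \<open>X\<close>, \<open>Y\<close>, \<open>Z\<close> are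
  extended with constant coefficients.\<close>

definition curvature ::
    "(real^'k \<Rightarrow> real^'k^'k) \<Rightarrow> real^'k \<Rightarrow> real^'k \<Rightarrow> real^'k \<Rightarrow> real^'k \<Rightarrow> real^'k" where
  "curvature G u X Y Z =
     cov_deriv G (\<lambda>w. cov_deriv G (\<lambda>_. Z) w Y) u X
   - cov_deriv G (\<lambda>w. cov_deriv G (\<lambda>_. Z) w X) u Y"

definition sectional_curvature ::
    "(real^'k \<Rightarrow> real^'k^'k) \<Rightarrow> real^'k \<Rightarrow> real^'k \<Rightarrow> real^'k \<Rightarrow> real" where
  "sectional_curvature G u X Y =
     ip (G u) (curvature G u X Y Y) X
       / (ip (G u) X X * ip (G u) Y Y - (ip (G u) X Y)\<^sup>2)"

text \<open>Gauss formula \<open>B(X,Y) = \<nabla>\<^sup>N\<^sub>X dF(Y) - dF(\<nabla>\<^sub>X Y)\<close>, with \<open>Y\<close> extended with constant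
  coefficients.\<close>

definition second_ff ::
    "(real^'k \<Rightarrow> real^'k^'k) \<Rightarrow> (real^'d \<Rightarrow> real^'d^'d) \<Rightarrow> (real^'k \<Rightarrow> real^'d)
      \<Rightarrow> real^'k \<Rightarrow> real^'k \<Rightarrow> real^'k \<Rightarrow> real^'d" where
  "second_ff G Gt F u X Y =
     frechet_derivative (\<lambda>w. frechet_derivative F (at w) Y) (at u) X
   + christoffel Gt (F u) (frechet_derivative F (at u) X) (frechet_derivative F (at u) Y)
   - frechet_derivative F (at u) (christoffel G u X Y)"

definition mean_curvature ::
    "(real^2 \<Rightarrow> real^2^2) \<Rightarrow> (real^'d \<Rightarrow> real^'d^'d) \<Rightarrow> (real^2 \<Rightarrow> real^'d)
      \<Rightarrow> real^2 \<Rightarrow> real^'d" where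
  "mean_curvature G Gt F u = (1/2) *\<^sub>R metric_trace (G u) (second_ff G Gt F u)"

definition mean_curvature_norm ::
    "(real^2 \<Rightarrow> real^2^2) \<Rightarrow> (real^'d \<Rightarrow> real^'d^'d) \<Rightarrow> (real^2 \<Rightarrow> real^'d)
      \<Rightarrow> real^2 \<Rightarrow> real" where
  "mean_curvature_norm G Gt F u =
     sqrt (ip (Gt (F u)) (mean_curvature G Gt F u) (mean_curvature G Gt F u))"

text \<open>\<open>A\<^sub>\<xi> X\<close>, obtained by raising the index in \<open>\<langle>A\<^sub>\<xi> X, Y\<rangle> = \<langle>B(X,Y), \<xi>\<rangle>\<close>.\<close>

definition shape_operator ::
    "(real^'k \<Rightarrow> real^'k^'k) \<Rightarrow> (real^'d \<Rightarrow> real^'d^'d) \<Rightarrow> (real^'k \<Rightarrow> real^'d)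
      \<Rightarrow> real^'k \<Rightarrow> real^'d \<Rightarrow> real^'k \<Rightarrow> real^'k" where
  "shape_operator G Gt F u \<xi> X =
     matrix_inv (G u) *v (\<chi> j. ip (Gt (F u)) (second_ff G Gt F u X (axis j 1)) \<xi>)"

definition shape_H ::
    "(real^2 \<Rightarrow> real^2^2) \<Rightarrow> (real^'d \<Rightarrow> real^'d^'d) \<Rightarrow> (real^2 \<Rightarrow> real^'d)
      \<Rightarrow> real^2 \<Rightarrow> real^2 \<Rightarrow> real^2" where
  "shape_H G Gt F u = shape_operator G Gt F u (mean_curvature G Gt F u)"

definition stress_bienergy ::
    "(real^2 \<Rightarrow> real^2^2) \<Rightarrow> (real^'d \<Rightarrow> real^'d^'d) \<Rightarrow> (real^2 \<Rightarrow> real^'d)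
      \<Rightarrow> real^2 \<Rightarrow> real^2 \<Rightarrow> real^2" where
  "stress_bienergy G Gt F u X =
     (- 2 * (mean_curvature_norm G Gt F u)\<^sup>2) *\<^sub>R X + 4 *\<^sub>R shape_H G Gt F u X"

text \<open>The unit normal of a surface in an oriented 3-manifold. In positively oriented coordinates
  the orientations of both manifolds single out one of the two unit normals.\<close>

definition unit_normal ::
    "(real^3 \<Rightarrow> real^3^3) \<Rightarrow> (real^2 \<Rightarrow> real^3) \<Rightarrow> real^2 \<Rightarrow> real^3" where
  "unit_normal Gt F u = (THE \<nu>.
     ip (Gt (F u)) \<nu> \<nu> = 1
   \<and> (\<forall>X. ip (Gt (F u)) (frechet_derivative F (at u) X) \<nu> = 0)
   \<and> 0 < det (vector [frechet_derivative F (at u) (axis 1 1),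
                      frechet_derivative F (at u) (axis 2 1), \<nu>] :: real^3^3))"

definition shape_normal ::
    "(real^2 \<Rightarrow> real^2^2) \<Rightarrow> (real^3 \<Rightarrow> real^3^3) \<Rightarrow> (real^2 \<Rightarrow> real^3)
      \<Rightarrow> real^2 \<Rightarrow> real^2 \<Rightarrow> real^2" where
  "shape_normal G Gt F u = shape_operator G Gt F u (unit_normal Gt F u)"


section \<open>Oriented Riemannian manifolds\<close>

text \<open>A chart is an open set of the manifold together with a coordinate map, whose values outside
  that set are irrelevant.\<close>

type_synonym ('a, 'k) chart = "'a set \<times> ('a \<Rightarrow> real^'k)"

text \<open>\<open>metric M x p\<close> is the Gram matrix at \<open>p\<close> of the coordinate frame of a chart with coordinate
  map \<open>x\<close>. The manifold carries the subspace topology of \<open>points M\<close>.\<close>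

record ('a, 'k::finite) riemannian =
  points :: "'a set"
  atlas :: "('a, 'k) chart set"
  metric :: "('a \<Rightarrow> real^'k) \<Rightarrow> 'a \<Rightarrow> real^'k^'k"

definition charts_at :: "('a, 'k::finite) riemannian \<Rightarrow> 'a \<Rightarrow> ('a, 'k) chart set" where
  "charts_at M p = {a \<in> atlas M. p \<in> fst a}"

abbreviation coord_inv :: "('a, 'k::finite) chart \<Rightarrow> real^'k \<Rightarrow> 'a" where
  "coord_inv a \<equiv> inv_into (fst a) (snd a)"

definition gram :: "('a, 'k::finite) riemannian \<Rightarrow> ('a, 'k) chart \<Rightarrow> real^'k \<Rightarrow> real^'k^'k" where
  "gram M a = (\<lambda>u. metric M (snd a) (coord_inv a u))"

definition coord_map ::
    "('a, 'k::finite) chart \<Rightarrow> ('b, 'd::finite) chart \<Rightarrow> ('a \<Rightarrow> 'b) \<Rightarrow> real^'k \<Rightarrow> real^'d" where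
  "coord_map a b f = (\<lambda>u. snd b (f (coord_inv a u)))"

definition oriented_atlas :: "('a::topological_space, 'k::finite) riemannian \<Rightarrow> bool" where
  "oriented_atlas M \<longleftrightarrow>
     \<Union>(fst ` atlas M) = points M
   \<and> (\<forall>a\<in>atlas M.
        openin (top_of_set (points M)) (fst a)
      \<and> open (snd a ` fst a)
      \<and> homeomorphism (fst a) (snd a ` fst a) (snd a) (coord_inv a))
   \<and> (\<forall>a\<in>atlas M. \<forall>b\<in>atlas M.
        smooth_on (coord_map a b id) (snd a ` (fst a \<inter> fst b))
      \<and> (\<forall>u\<in>snd a ` (fst a \<inter> fst b).
           0 < det (matrix (frechet_derivative (coord_map a b id) (at u)))))"

definition riemannian_metric :: "('a, 'k::finite) riemannian \<Rightarrow> bool" where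
  "riemannian_metric M \<longleftrightarrow>
     (\<forall>a\<in>atlas M.
        smooth_on (gram M a) (snd a ` fst a)
      \<and> (\<forall>p\<in>fst a.
           transpose (metric M (snd a) p) = metric M (snd a) p
         \<and> (\<forall>X. X \<noteq> 0 \<longrightarrow> 0 < ip (metric M (snd a) p) X X)))
   \<and> (\<forall>a\<in>atlas M. \<forall>b\<in>atlas M. \<forall>p\<in>fst a \<inter> fst b. \<forall>X Y.
        ip (metric M (snd a) p) X Y
      = ip (metric M (snd b) p)
          (frechet_derivative (coord_map a b id) (at (snd a p)) X)
          (frechet_derivative (coord_map a b id) (at (snd a p)) Y))"

text \<open>The sort constraint supplies the Hausdorff and second countability axioms.\<close>

definition riemannian_manifold ::
    "('a::{t2_space,second_countable_topology}, 'k::finite) riemannian \<Rightarrow> bool" where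
  "riemannian_manifold M \<longleftrightarrow>
     points M \<noteq> {} \<and> connected (points M) \<and> oriented_atlas M \<and> riemannian_metric M"

definition restrict_chart :: "'a set \<Rightarrow> ('a, 'k::finite) chart \<Rightarrow> ('a, 'k) chart" where
  "restrict_chart U a = (fst a \<inter> U, snd a)"

definition restrict_manifold ::
    "('a, 'k::finite) riemannian \<Rightarrow> 'a set \<Rightarrow> ('a, 'k) riemannian" where
  "restrict_manifold M U =
     M\<lparr>points := points M \<inter> U, atlas := restrict_chart U ` atlas M\<rparr>"

definition smooth_map ::
    "('a::topological_space, 'k::finite) riemannian
      \<Rightarrow> ('b::topological_space, 'd::finite) riemannian \<Rightarrow> ('a \<Rightarrow> 'b) \<Rightarrow> bool" where
  "smooth_map M N f \<longleftrightarrow>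
     f ` points M \<subseteq> points N
   \<and> continuous_on (points M) f
   \<and> (\<forall>a\<in>atlas M. \<forall>b\<in>atlas N. smooth_on (coord_map a b f) (snd a ` (fst a \<inter> f -` fst b)))"

text \<open>An isometric map is an immersion since the metric of \<open>M\<close> is positive definite.\<close>

definition isometric_immersion ::
    "('a::topological_space, 'k::finite) riemannian
      \<Rightarrow> ('b::topological_space, 'd::finite) riemannian \<Rightarrow> ('a \<Rightarrow> 'b) \<Rightarrow> bool" where
  "isometric_immersion M N f \<longleftrightarrow>
     smooth_map M N f
   \<and> (\<forall>p\<in>points M. \<forall>a\<in>charts_at M p. \<forall>b\<in>charts_at N (f p). \<forall>X Y.
        ip (metric N (snd b) (f p))
          (frechet_derivative (coord_map a b f) (at (snd a p)) X)
          (frechet_derivative (coord_map a b f) (at (snd a p)) Y)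
      = ip (metric M (snd a) p) X Y)"

definition surface ::
    "('a::{t2_space,second_countable_topology}, 2) riemannian
      \<Rightarrow> ('b::{t2_space,second_countable_topology}, 'd::finite) riemannian
      \<Rightarrow> ('a \<Rightarrow> 'b) \<Rightarrow> bool" where
  "surface M N f \<longleftrightarrow>
     riemannian_manifold M \<and> riemannian_manifold N \<and> isometric_immersion M N f"


section \<open>Surfaces: geometric conditions\<close>

text \<open>Tensorial quantities at a point are required to satisfy their equations in all charts of
  the given atlases around the point.\<close>

definition biconservative_surface ::
    "('a::{t2_space,second_countable_topology}, 2) riemannian
      \<Rightarrow> ('b::{t2_space,second_countable_topology}, 'd::finite) riemannian
      \<Rightarrow> ('a \<Rightarrow> 'b) \<Rightarrow> bool" where
  "biconservative_surface M N f \<longleftrightarrow>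
     surface M N f
   \<and> (\<forall>p\<in>points M. \<forall>a\<in>charts_at M p. \<forall>b\<in>charts_at N (f p).
        divergence (gram M a)
          (stress_bienergy (gram M a) (gram N b) (coord_map a b f)) (snd a p) = 0)"

text \<open>On a surface the set of eigenvalues determines the multiplicities: it is a singleton exactly
  when the symmetric operator has a double eigenvalue.\<close>

definition principal_curvatures ::
    "('a, 2) riemannian \<Rightarrow> ('b, 'd::finite) riemannian
      \<Rightarrow> ('a \<Rightarrow> 'b) \<Rightarrow> ('a \<Rightarrow> real) \<Rightarrow> ('a \<Rightarrow> real) \<Rightarrow> bool" where
  "principal_curvatures M N f l1 l2 \<longleftrightarrow>
     (\<forall>p\<in>points M. \<forall>a\<in>charts_at M p. \<forall>b\<in>charts_at N (f p).
        {t. \<exists>X. X \<noteq> 0 \<and>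
            shape_H (gram M a) (gram N b) (coord_map a b f) (snd a p) X = t *\<^sub>R X}
      = {l1 p, l2 p})"

definition has_gaussian_curvature :: "('a, 2) riemannian \<Rightarrow> ('a \<Rightarrow> real) \<Rightarrow> bool" where
  "has_gaussian_curvature M K \<longleftrightarrow>
     (\<forall>p\<in>points M. \<forall>a\<in>charts_at M p.
        sectional_curvature (gram M a) (snd a p) (axis 1 1) (axis 2 1) = K p)"

text \<open>\<open>\<bar>H\<bar>\<close> at a point, as the common value in all charts.\<close>

definition H_norm ::
    "('a, 2) riemannian \<Rightarrow> ('b, 'd::finite) riemannian \<Rightarrow> ('a \<Rightarrow> 'b) \<Rightarrow> 'a \<Rightarrow> real" where
  "H_norm M N f p = (THE h. \<forall>a\<in>charts_at M p. \<forall>b\<in>charts_at N (f p).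
     mean_curvature_norm (gram M a) (gram N b) (coord_map a b f) (snd a p) = h)"

definition umbilical ::
    "('a, 2) riemannian \<Rightarrow> ('b, 3) riemannian \<Rightarrow> ('a \<Rightarrow> 'b) \<Rightarrow> bool" where
  "umbilical M N f \<longleftrightarrow>
     (\<forall>p\<in>points M. \<forall>a\<in>charts_at M p. \<forall>b\<in>charts_at N (f p). \<exists>\<mu>. \<forall>X.
        shape_normal (gram M a) (gram N b) (coord_map a b f) (snd a p) X = \<mu> *\<^sub>R X)"


section \<open>Space forms\<close>

definition geodesic :: "('a::topological_space, 'k::finite) riemannian \<Rightarrow> (real \<Rightarrow> 'a) \<Rightarrow> bool" where
  "geodesic M \<gamma> \<longleftrightarrow>
     range \<gamma> \<subseteq> points M
   \<and> continuous_on UNIV \<gamma>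
   \<and> (\<forall>a\<in>atlas M. smooth_on (snd a \<circ> \<gamma>) (\<gamma> -` fst a)
      \<and> (\<forall>t\<in>\<gamma> -` fst a.
           vector_derivative (\<lambda>s. vector_derivative (snd a \<circ> \<gamma>) (at s)) (at t)
         + christoffel (gram M a) (snd a (\<gamma> t))
             (vector_derivative (snd a \<circ> \<gamma>) (at t)) (vector_derivative (snd a \<circ> \<gamma>) (at t))
         = 0))"

definition geodesically_complete :: "('a::topological_space, 'k::finite) riemannian \<Rightarrow> bool" where
  "geodesically_complete M \<longleftrightarrow>
     (\<forall>p\<in>points M. \<forall>a\<in>charts_at M p. \<forall>X. \<exists>\<gamma>.
        geodesic M \<gamma> \<and> \<gamma> 0 = p \<and> vector_derivative (snd a \<circ> \<gamma>) (at 0) = X)"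

definition constant_sectional_curvature :: "('a, 'k::finite) riemannian \<Rightarrow> real \<Rightarrow> bool" where
  "constant_sectional_curvature M c \<longleftrightarrow>
     (\<forall>p\<in>points M. \<forall>a\<in>charts_at M p. \<forall>X Y. X \<noteq> Y \<and> independent {X, Y} \<longrightarrow>
        sectional_curvature (gram M a) (snd a p) X Y = c)"

text \<open>With simple connectedness and completeness a space form is determined by its dimension and
  curvature up to isometry.\<close>

definition space_form ::
    "real \<Rightarrow> ('a::{t2_space,second_countable_topology}, 'k::finite) riemannian \<Rightarrow> bool" where
  "space_form c N \<longleftrightarrow>
     riemannian_manifold N \<and> simply_connected (points N) \<and> geodesically_complete N
   \<and> constant_sectional_curvature N c"

end

theory Submission
  imports Defs
begin

text \<open>
  Let \<open>\<lambda>\<close> be the common value of the principal curvatures. The operator \<open>A\<^sub>H\<close> is self-adjoint with the only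
  eigenvalue \<open>\<lambda>\<close>, so \<open>A\<^sub>H = \<lambda> I\<close>; comparing traces, \<open>2 \<bar>H\<bar>\<^sup>2 = 2 \<lambda>\<close>. Hence \<open>\<bar>H\<bar>\<^sup>2 = \<lambda>\<close> is constant and
  \<open>S\<^sub>2 = -2 \<lambda> I + 4 \<lambda> I = 2 \<lambda> I\<close> (lemma \<open>double_principal_curvature\<close>). Both parts thus ask for the same thing:
  given a flat surface and \<open>k \<ge> 0\<close>, immerse it locally and isometrically into the space form of curvature \<open>-k\<^sup>2\<close>
  with shape operator \<open>k I\<close> and \<open>\<bar>H\<bar> = k\<close>; the constants are \<open>k = \<lambda>\<close> and \<open>k = 2 \<lambda>\<close>.

  The solution is a horosphere, or a plane if \<open>k = 0\<close>. In the coordinates of \<open>horo_metric\<close> the ambient metric is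
  \<open>exp(-2kz) (dx\<^sup>2 + dy\<^sup>2) + dz\<^sup>2\<close>. It has constant curvature \<open>-k\<^sup>2\<close>, its geodesics are elementary functions defined for
  all times (\<open>space_form_horo_space\<close>), and the slice \<open>z = 0\<close> is a Euclidean plane whose second fundamental form
  is \<open>k\<close> times its metric (\<open>second_ff_horosphere\<close>).

  The remaining ingredient is that a surface of vanishing curvature is locally isometric to the Euclidean plane
  (\<open>flat_metric_coordinates\<close>). The connection form \<open>\<omega>\<close> of an orthonormal coframe satisfies \<open>d\<omega> = 0\<close> exactly
  when the curvature vanishes; rotating the coframe by a potential of \<open>\<omega>\<close> makes both of its members closed, and their
  potentials are Euclidean coordinates. So the only existence theorem needed is the Poincare lemma, applied once to
  \<open>\<omega>\<close> and once to each member of the rotated coframe.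
\<close>

section \<open>Calculus of \<open>C\<^sup>k\<close> maps\<close>

lemma frechet_derivative_eqI:
  "(f has_derivative D) (at x) \<Longrightarrow> frechet_derivative f (at x) = D"
  using frechet_derivative_at by metis

text \<open>The constant \<^const>\<open>frechet_derivative\<close> chooses among all functions that satisfy
  \<^const>\<open>has_derivative\<close>; maps that agree near \<open>x\<close> have the same candidates, hence the same choice, whether
  or not they are differentiable.\<close>

lemma frechet_derivative_cong_open:
  assumes "open S" "x \<in> S" "\<And>y. y \<in> S \<Longrightarrow> f y = g y"
  shows "frechet_derivative f (at x) = frechet_derivative g (at x)"
proof -
  have "(f has_derivative D) (at x) \<longleftrightarrow> (g has_derivative D) (at x)" for D
    using has_derivative_transform_within_open[of f D x UNIV S g]
      has_derivative_transform_within_open[of g D x UNIV S f] assms by auto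
  then show ?thesis unfolding frechet_derivative_def by simp
qed

lemma differentiable_on_openD:
  "f differentiable_on S \<Longrightarrow> open S \<Longrightarrow> x \<in> S
    \<Longrightarrow> (f has_derivative frechet_derivative f (at x)) (at x)"
  by (metis differentiable_on_eq_differentiable_at frechet_derivative_works)

lemma differentiable_on_openI:
  "(\<And>x. x \<in> S \<Longrightarrow> (f has_derivative f' x) (at x)) \<Longrightarrow> f differentiable_on S"
  by (meson differentiableI differentiable_at_imp_differentiable_on)

lemma Ck_on_cong:
  assumes "open S" "\<And>x. x \<in> S \<Longrightarrow> f x = g x" "Ck_on k f S"
  shows "Ck_on k g S"
  using assms(2,3)
proof (induction k arbitrary: f g)
  case 0
  then show ?case by (metis Ck_on.simps(1) continuous_on_cong)
next
  case (Suc k)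
  have eq: "frechet_derivative f (at x) = frechet_derivative g (at x)" if "x \<in> S" for x
    using frechet_derivative_cong_open[OF assms(1) that] Suc.prems(1) by blast
  have "g differentiable_on S"
    using Suc.prems assms(1) differentiable_on_openD[of f S] 
    by (intro differentiable_on_openI[of S g "\<lambda>x. frechet_derivative f (at x)"])
      (metis Ck_on.simps(2) has_derivative_transform_within_open)
  moreover have "Ck_on k (\<lambda>x. frechet_derivative g (at x) v) S" for v
    using Suc.IH[of "\<lambda>x. frechet_derivative f (at x) v"] eq Suc.prems(2) by auto
  ultimately show ?case by simp
qed

lemma Ck_on_Suc_derivative:
  assumes "open S" "\<And>x. x \<in> S \<Longrightarrow> (f has_derivative f' x) (at x)"
  shows "Ck_on (Suc k) f S \<longleftrightarrow> (\<forall>v. Ck_on k (\<lambda>x. f' x v) S)"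
proof -
  have "frechet_derivative f (at x) = f' x" if "x \<in> S" for x
    by (rule frechet_derivative_eqI) (use assms that in auto)
  then have "Ck_on k (\<lambda>x. f' x v) S \<longleftrightarrow> Ck_on k (\<lambda>x. frechet_derivative f (at x) v) S" for v
    using Ck_on_cong[OF assms(1)] by (metis (no_types, lifting))
  then show ?thesis using differentiable_on_openI[OF assms(2)] by simp
qed

lemma Ck_on_SucI:
  assumes "open S" "\<And>x. x \<in> S \<Longrightarrow> (f has_derivative f' x) (at x)"
    "\<And>v. Ck_on k (\<lambda>x. f' x v) S"
  shows "Ck_on (Suc k) f S"
  using Ck_on_Suc_derivative[OF assms(1,2)] assms(3) by blast

lemma Ck_on_SucD: "Ck_on (Suc k) f S \<Longrightarrow> Ck_on k f S"
  by (induction k arbitrary: f) (auto intro: differentiable_imp_continuous_on)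

lemma Ck_on_subset: "Ck_on k f S \<Longrightarrow> T \<subseteq> S \<Longrightarrow> Ck_on k f T"
  by (induction k arbitrary: f) (auto intro: continuous_on_subset differentiable_on_subset)

lemma Ck_on_const [simp]: "Ck_on k (\<lambda>_. c) S"
  by (induction k arbitrary: c) auto

lemma Ck_on_bounded_linear:
  assumes "bounded_linear L" "open S" "Ck_on k f S"
  shows "Ck_on k (\<lambda>x. L (f x)) S"
  using assms(3)
proof (induction k arbitrary: f)
  case 0
  then show ?case using linear_continuous_on_compose by (metis Ck_on.simps(1) assms(1) bounded_linear.continuous_on)
next
  case (Suc k)
  have "((\<lambda>x. L (f x)) has_derivative (\<lambda>v. L (frechet_derivative f (at x) v))) (at x)" if "x \<in> S" for x
    using bounded_linear.has_derivative[OF assms(1) differentiable_on_openD[of f S x]] Suc.prems assms(2) that by auto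
  then show ?case
    by (rule Ck_on_SucI[OF assms(2)]) (assumption, rule Suc.IH, use Suc.prems in simp)
qed

lemma Ck_on_minus:
  "open S \<Longrightarrow> Ck_on k f S \<Longrightarrow> Ck_on k (\<lambda>x. - f x) S"
  by (rule Ck_on_bounded_linear[OF bounded_linear_minus[OF bounded_linear_ident]])

lemma Ck_on_add:
  assumes "open S" "Ck_on k f S" "Ck_on k g S"
  shows "Ck_on k (\<lambda>x. f x + g x) S"
  using assms(2,3)
proof (induction k arbitrary: f g)
  case 0
  then show ?case by (auto intro: continuous_on_add)
next
  case (Suc k)
  have "((\<lambda>x. f x + g x) has_derivative (\<lambda>v. frechet_derivative f (at x) v + frechet_derivative g (at x) v)) (at x)"
    if "x \<in> S" for x
    using has_derivative_add[OF differentiable_on_openD[of f S x] differentiable_on_openD[of g S x]]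
      Suc.prems assms(1) that by auto
  then show ?case
    by (rule Ck_on_SucI[OF assms(1)]) (assumption, rule Suc.IH, use Suc.prems in simp_all)
qed

text \<open>One product rule serves scalar multiples, inner products and multiplication.\<close>

lemma Ck_on_bilinear:
  assumes "bounded_bilinear mul" "open S" "Ck_on k f S" "Ck_on k g S"
  shows "Ck_on k (\<lambda>x. mul (f x) (g x)) S"
  using assms(3,4)
proof (induction k arbitrary: f g)
  case 0
  then show ?case using bounded_bilinear.continuous_on[OF assms(1)] by auto
next
  case (Suc k)
  have "((\<lambda>x. mul (f x) (g x)) has_derivative
      (\<lambda>v. mul (f x) (frechet_derivative g (at x) v) + mul (frechet_derivative f (at x) v) (g x))) (at x)"
    if "x \<in> S" for x
    using bounded_bilinear.FDERIV[OF assms(1) differentiable_on_openD[of f S x] differentiable_on_openD[of g S x]]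
      Suc.prems assms(2) that by auto
  moreover have "Ck_on k (\<lambda>x. mul (f x) (frechet_derivative g (at x) v) + mul (frechet_derivative f (at x) v) (g x)) S" for v
    by (intro Ck_on_add assms(2) Suc.IH) (use Suc.prems in \<open>auto intro!: Ck_on_SucD[of k f S] Ck_on_SucD[of k g S]\<close>)
  ultimately show ?case
    by (rule Ck_on_SucI[OF assms(2)])
qed

lemma Ck_on_sum:
  assumes "open S" "finite I" "\<And>i. i \<in> I \<Longrightarrow> Ck_on k (f i) S"
  shows "Ck_on k (\<lambda>x. \<Sum>i\<in>I. f i x) S"
  using assms(2,3) by (induction I rule: finite_induct) (auto intro: Ck_on_add[OF assms(1)])

text \<open>The chain rule is expanded in an orthonormal basis. The derivative of the composition then becomes
  a sum of products whose factors are directional derivatives of \<open>g\<close> and compositions of \<open>g\<close> with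
  partial derivatives of \<open>f\<close>, and the induction hypothesis applies to the latter.\<close>

lemma Ck_on_compose:
  fixes g :: "'a::euclidean_space \<Rightarrow> 'b::euclidean_space"
  assumes "open S" "open T" "g ` S \<subseteq> T" "Ck_on k f T" "Ck_on k g S"
  shows "Ck_on k (\<lambda>x. f (g x)) S"
  using assms(4,5)
proof (induction k arbitrary: f)
  case 0
  then show ?case using continuous_on_compose2 assms(3) by (metis Ck_on.simps(1))
next
  case (Suc k)
  let ?Df = "\<lambda>y. frechet_derivative f (at y)" and ?Dg = "\<lambda>x. frechet_derivative g (at x)"
  have Df: "(f has_derivative ?Df y) (at y)" if "y \<in> T" for y
    using differentiable_on_openD Suc.prems(1) assms(2) that by auto
  have Dg: "(g has_derivative ?Dg x) (at x)" if "x \<in> S" for x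
    using differentiable_on_openD Suc.prems(2) assms(1) that by auto
  have eq: "?Df (g x) v = (\<Sum>b\<in>Basis. (v \<bullet> b) *\<^sub>R ?Df (g x) b)" if "x \<in> S" for x v
  proof -
    have "linear (?Df (g x))" using Df assms(3) that has_derivative_linear by blast
    then show ?thesis
      by (subst euclidean_representation[of v, symmetric]) (simp only: linear_sum linear_cmul)
  qed
  have "((\<lambda>x. f (g x)) has_derivative (\<lambda>v. \<Sum>b\<in>Basis. (?Dg x v \<bullet> b) *\<^sub>R ?Df (g x) b)) (at x)" if "x \<in> S" for x
  proof -
    have "((\<lambda>x. f (g x)) has_derivative (\<lambda>v. ?Df (g x) (?Dg x v))) (at x)"
      using diff_chain_at[OF Dg[OF that] Df] assms(3) that by (auto simp: o_def)
    moreover have "(\<lambda>v. ?Df (g x) (?Dg x v)) = (\<lambda>v. \<Sum>b\<in>Basis. (?Dg x v \<bullet> b) *\<^sub>R ?Df (g x) b)"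
      by (rule ext) (rule eq[OF that])
    ultimately show ?thesis by metis
  qed
  moreover have "Ck_on k (\<lambda>x. \<Sum>b\<in>Basis. (?Dg x v \<bullet> b) *\<^sub>R ?Df (g x) b) S" for v
  proof (intro Ck_on_sum[OF assms(1)] Ck_on_bilinear[OF bounded_bilinear_scaleR assms(1)])
    fix b :: 'b
    show "Ck_on k (\<lambda>x. ?Df (g x) b) S"
      using Suc.IH[of "\<lambda>y. ?Df y b"] Suc.prems Ck_on_SucD[of k g S] by auto
    show "Ck_on k (\<lambda>x. ?Dg x v \<bullet> b) S"
      using Ck_on_bounded_linear[OF bounded_linear_inner_left assms(1), of k "\<lambda>x. ?Dg x v" b]
        Suc.prems by simp
  qed auto
  ultimately show ?case
    by (rule Ck_on_SucI[OF assms(1)])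
qed

lemma Ck_on_real_derivative:
  fixes f :: "real \<Rightarrow> real"
  assumes "open S" "\<And>x. x \<in> S \<Longrightarrow> (f has_real_derivative f' x) (at x)" "Ck_on k f' S"
  shows "Ck_on (Suc k) f S"
proof -
  have "(f has_derivative (\<lambda>v. v * f' x)) (at x)" if "x \<in> S" for x
    using assms(2)[OF that] by (simp add: has_field_derivative_def mult.commute[of _ "f' x"])
  then show ?thesis
    by (rule Ck_on_SucI[OF assms(1)])
      (assumption, rule Ck_on_bilinear[OF bounded_bilinear_mult assms(1) Ck_on_const assms(3)])
qed

section \<open>Smooth maps\<close>

lemma smooth_on_cong:
  "open S \<Longrightarrow> (\<And>x. x \<in> S \<Longrightarrow> f x = g x) \<Longrightarrow> smooth_on f S \<Longrightarrow> smooth_on g S"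
  unfolding smooth_on_def using Ck_on_cong by blast

lemma smooth_on_subset: "smooth_on f S \<Longrightarrow> T \<subseteq> S \<Longrightarrow> smooth_on f T"
  unfolding smooth_on_def using Ck_on_subset by blast

lemma smooth_on_derivativeI:
  assumes "open S" "\<And>x. x \<in> S \<Longrightarrow> (f has_derivative f' x) (at x)"
    "\<And>v. smooth_on (\<lambda>x. f' x v) S"
  shows "smooth_on f S"
  unfolding smooth_on_def
proof
  fix k show "Ck_on k f S"
    using Ck_on_SucD Ck_on_Suc_derivative[OF assms(1,2)] assms(3) unfolding smooth_on_def by blast
qed

lemma smooth_on_has_derivative:
  "smooth_on f S \<Longrightarrow> open S \<Longrightarrow> x \<in> S
    \<Longrightarrow> (f has_derivative frechet_derivative f (at x)) (at x)"
  using differentiable_on_openD[of f S x] unfolding smooth_on_def by (metis Ck_on.simps(2))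

lemma smooth_on_derivative:
  "smooth_on f S \<Longrightarrow> smooth_on (\<lambda>x. frechet_derivative f (at x) v) S"
  unfolding smooth_on_def by (metis Ck_on.simps(2))

lemma smooth_on_continuous: "smooth_on f S \<Longrightarrow> continuous_on S f"
  unfolding smooth_on_def by (metis Ck_on.simps(1))

lemma smooth_on_const: "smooth_on (\<lambda>_. c) S"
  unfolding smooth_on_def by simp

lemma smooth_on_bounded_linear:
  "bounded_linear L \<Longrightarrow> open S \<Longrightarrow> smooth_on f S \<Longrightarrow> smooth_on (\<lambda>x. L (f x)) S"
  unfolding smooth_on_def using Ck_on_bounded_linear by blast

lemma smooth_on_linear:
  assumes "bounded_linear L" "open S"
  shows "smooth_on L S"
  by (rule smooth_on_derivativeI[where f' = "\<lambda>_. L"])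
    (use assms in \<open>auto intro: bounded_linear_imp_has_derivative smooth_on_const\<close>)

lemma smooth_on_add:
  "open S \<Longrightarrow> smooth_on f S \<Longrightarrow> smooth_on g S \<Longrightarrow> smooth_on (\<lambda>x. f x + g x) S"
  unfolding smooth_on_def using Ck_on_add by blast

lemma smooth_on_sum:
  "open S \<Longrightarrow> finite I \<Longrightarrow> (\<And>i. i \<in> I \<Longrightarrow> smooth_on (f i) S) \<Longrightarrow> smooth_on (\<lambda>x. \<Sum>i\<in>I. f i x) S"
  unfolding smooth_on_def using Ck_on_sum by blast

lemma smooth_on_minus: "open S \<Longrightarrow> smooth_on f S \<Longrightarrow> smooth_on (\<lambda>x. - f x) S"
  using smooth_on_bounded_linear[OF bounded_linear_minus[OF bounded_linear_ident]] .

lemma smooth_on_diff: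
  "open S \<Longrightarrow> smooth_on f S \<Longrightarrow> smooth_on g S \<Longrightarrow> smooth_on (\<lambda>x. f x - g x) S"
  using smooth_on_add[of S f "\<lambda>x. - g x"] smooth_on_minus[of S g] by simp

lemma smooth_on_scaleR:
  "open S \<Longrightarrow> smooth_on f S \<Longrightarrow> smooth_on g S \<Longrightarrow> smooth_on (\<lambda>x. f x *\<^sub>R g x) S"
  unfolding smooth_on_def using Ck_on_bilinear[OF bounded_bilinear_scaleR] by blast

lemma smooth_on_mult:
  fixes f g :: "_ \<Rightarrow> real"
  shows "open S \<Longrightarrow> smooth_on f S \<Longrightarrow> smooth_on g S \<Longrightarrow> smooth_on (\<lambda>x. f x * g x) S"
  using smooth_on_scaleR[of S f g] by simp

lemma smooth_on_compose:
  fixes g :: "'a::euclidean_space \<Rightarrow> 'b::euclidean_space"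
  shows "open S \<Longrightarrow> open T \<Longrightarrow> g ` S \<subseteq> T \<Longrightarrow> smooth_on f T \<Longrightarrow> smooth_on g S
    \<Longrightarrow> smooth_on (\<lambda>x. f (g x)) S"
  unfolding smooth_on_def using Ck_on_compose by blast

lemma smooth_on_vec_nth: "open S \<Longrightarrow> smooth_on f S \<Longrightarrow> smooth_on (\<lambda>x. f x $ i) S"
  by (rule smooth_on_bounded_linear[OF bounded_linear_vec_nth])

lemma smooth_on_vec_lambda:
  fixes f :: "'a::euclidean_space \<Rightarrow> 'b::euclidean_space ^ 'n"
  assumes "open S" "\<And>i. smooth_on (\<lambda>x. f x $ i) S"
  shows "smooth_on f S"
proof -
  have L: "bounded_linear (axis i :: 'b \<Rightarrow> 'b ^ 'n)" for i
    by (intro linear_conv_bounded_linear[THEN iffD1] linearI) (auto simp: axis_def vec_eq_iff)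
  have "f x = (\<Sum>i\<in>UNIV. axis i (f x $ i))" for x
    by (simp add: vec_eq_iff axis_def if_distrib cong: if_cong)
  then show ?thesis
    using smooth_on_sum[OF assms(1) finite, of UNIV "\<lambda>i x. axis i (f x $ i)"]
      smooth_on_bounded_linear[OF L assms(1,2)] by simp
qed

lemma has_derivative_vec_nth: "((\<lambda>x. x $ i) has_derivative (\<lambda>v. v $ i)) F"
  by (rule bounded_linear_imp_has_derivative[OF bounded_linear_vec_nth])

lemma has_derivative_vec_nthI:
  fixes f :: "'a::real_normed_vector \<Rightarrow> real^'n"
  assumes "\<And>i. ((\<lambda>x. f x $ i) has_derivative (\<lambda>v. f' v $ i)) (at x)"
  shows "(f has_derivative f') (at x)"
  unfolding has_derivative_componentwise_within[of f f' x UNIV]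
  using assms by (auto simp: Basis_vec_def inner_axis)

lemma derivative_vanishing_component:
  fixes F :: "'a::euclidean_space \<Rightarrow> real^'n"
  assumes "open S" "smooth_on F S" "\<And>w. w \<in> S \<Longrightarrow> F w $ i = 0" "w \<in> S"
  shows "frechet_derivative F (at w) X $ i = 0"
proof -
  have "frechet_derivative (\<lambda>w. F w $ i) (at w) = (\<lambda>X. frechet_derivative F (at w) X $ i)"
    by (rule frechet_derivative_eqI[OF bounded_linear.has_derivative[OF bounded_linear_vec_nth
            smooth_on_has_derivative[OF assms(2,1,4)]]])
  moreover have "frechet_derivative (\<lambda>w. F w $ i) (at w) = frechet_derivative (\<lambda>w. 0) (at w)"
    by (rule frechet_derivative_cong_open[OF assms(1,4,3)])
  ultimately show ?thesis by (simp add: fun_eq_iff)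
qed

lemma smooth_on_exp_UNIV: "smooth_on (exp :: real \<Rightarrow> real) UNIV"
  unfolding smooth_on_def
proof
  fix k show "Ck_on k (exp :: real \<Rightarrow> real) UNIV"
    by (induction k) (auto intro!: continuous_intros Ck_on_real_derivative derivative_eq_intros simp del: Ck_on.simps(2))
qed

lemma smooth_on_sin_cos_UNIV:
  "smooth_on (sin :: real \<Rightarrow> real) UNIV" "smooth_on (cos :: real \<Rightarrow> real) UNIV"
proof -
  have "Ck_on k (sin :: real \<Rightarrow> real) UNIV \<and> Ck_on k (cos :: real \<Rightarrow> real) UNIV" for k
  proof (induction k)
    case (Suc k)
    have "Ck_on k (\<lambda>x :: real. - sin x) UNIV"
      using Suc by (intro Ck_on_minus) auto
    then show ?case using Suc
      by (auto intro!: Ck_on_real_derivative[of UNIV sin cos] Ck_on_real_derivative[of UNIV cos "\<lambda>x. - sin x"]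
          derivative_eq_intros simp del: Ck_on.simps(2))
  qed (auto intro!: continuous_intros)
  then show "smooth_on (sin :: real \<Rightarrow> real) UNIV" "smooth_on (cos :: real \<Rightarrow> real) UNIV"
    unfolding smooth_on_def by auto
qed

lemma smooth_on_inverse_pos: "smooth_on (inverse :: real \<Rightarrow> real) {0<..}"
  unfolding smooth_on_def
proof
  fix k show "Ck_on k (inverse :: real \<Rightarrow> real) {0<..}"
  proof (induction k)
    case (Suc k)
    have "Ck_on k (\<lambda>x::real. - (inverse x * inverse x)) {0<..}"
      by (intro Ck_on_minus Ck_on_bilinear[OF bounded_bilinear_mult] Suc) auto
    then show ?case
      by (intro Ck_on_real_derivative[where f' = "\<lambda>x. - (inverse x * inverse x)"])
        (auto intro!: derivative_eq_intros)
  qed (auto intro!: continuous_intros)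
qed

lemma smooth_on_real_derivativeI:
  fixes f :: "real \<Rightarrow> real"
  assumes "open S" "\<And>x. x \<in> S \<Longrightarrow> (f has_real_derivative f' x) (at x)" "smooth_on f' S"
  shows "smooth_on f S"
  using Ck_on_real_derivative[OF assms(1,2)] Ck_on_SucD assms(3) unfolding smooth_on_def by blast

lemma smooth_on_ln_pos: "smooth_on (ln :: real \<Rightarrow> real) {0<..}"
  by (rule smooth_on_real_derivativeI[OF _ _ smooth_on_inverse_pos])
    (auto intro!: derivative_eq_intros simp: divide_inverse)

lemma smooth_on_exp: "open S \<Longrightarrow> smooth_on f S \<Longrightarrow> smooth_on (\<lambda>x. exp (f x :: real)) S"
  using smooth_on_compose[OF _ open_UNIV subset_UNIV smooth_on_exp_UNIV] .

lemma smooth_on_sin: "open S \<Longrightarrow> smooth_on f S \<Longrightarrow> smooth_on (\<lambda>x. sin (f x :: real)) S"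
  using smooth_on_compose[OF _ open_UNIV subset_UNIV smooth_on_sin_cos_UNIV(1)] .

lemma smooth_on_cos: "open S \<Longrightarrow> smooth_on f S \<Longrightarrow> smooth_on (\<lambda>x. cos (f x :: real)) S"
  using smooth_on_compose[OF _ open_UNIV subset_UNIV smooth_on_sin_cos_UNIV(2)] .

lemma smooth_on_ln:
  "open S \<Longrightarrow> smooth_on f S \<Longrightarrow> (\<And>x. x \<in> S \<Longrightarrow> 0 < f x) \<Longrightarrow> smooth_on (\<lambda>x. ln (f x :: real)) S"
  using smooth_on_compose[OF _ _ _ smooth_on_ln_pos, of S f] by auto

lemma smooth_on_divide:
  assumes "open S" "smooth_on f S" "smooth_on g S" "\<And>x. x \<in> S \<Longrightarrow> 0 < (g x :: real)"
  shows "smooth_on (\<lambda>x. f x / g x) S"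
  using smooth_on_mult[OF assms(1,2) smooth_on_compose[OF assms(1) _ _ smooth_on_inverse_pos assms(3)]] assms(4)
  by (auto simp: divide_inverse)

lemma smooth_on_sqrt:
  assumes "open S" "smooth_on f S" "\<And>x. x \<in> S \<Longrightarrow> 0 < f x"
  shows "smooth_on (\<lambda>x. sqrt (f x)) S"
proof (rule smooth_on_cong[OF assms(1)])
  show "smooth_on (\<lambda>x. exp (ln (f x) * (1/2))) S"
    by (intro smooth_on_exp smooth_on_mult smooth_on_ln smooth_on_const assms)
  show "exp (ln (f x) * (1/2)) = sqrt (f x)" if "x \<in> S" for x
  proof -
    have "ln (f x) * (1/2) = ln (sqrt (f x))" using assms(3)[OF that] by (simp add: ln_sqrt)
    then show ?thesis using assms(3)[OF that] by (simp only: exp_ln real_sqrt_gt_0_iff)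
  qed
qed

lemmas smooth_intros = smooth_on_const smooth_on_add smooth_on_minus smooth_on_diff smooth_on_mult smooth_on_scaleR
  smooth_on_divide smooth_on_sqrt smooth_on_exp smooth_on_sin smooth_on_cos smooth_on_ln
  smooth_on_vec_nth smooth_on_derivative


section \<open>Symmetry of second derivatives\<close>

text \<open>Two applications of the mean value theorem express the second difference of \<open>f\<close> over a parallelogram
  by one mixed derivative. The second difference does not change when \<open>v\<close> and \<open>w\<close> are exchanged, which
  is what makes mixed derivatives symmetric.\<close>

lemma second_difference_mean_value:
  fixes f :: "'a::euclidean_space \<Rightarrow> real"
  assumes "open S" "smooth_on f S" "0 < s"
    and box: "\<And>r t. 0 \<le> r \<Longrightarrow> r \<le> s \<Longrightarrow> 0 \<le> t \<Longrightarrow> t \<le> s \<Longrightarrow> x + r *\<^sub>R v + t *\<^sub>R w \<in> S"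
  obtains r t where "0 < r" "r < s" "0 < t" "t < s"
    "f (x + s *\<^sub>R v + s *\<^sub>R w) - f (x + s *\<^sub>R v) - f (x + s *\<^sub>R w) + f x
     = s\<^sup>2 * frechet_derivative (\<lambda>y. frechet_derivative f (at y) v) (at (x + r *\<^sub>R v + t *\<^sub>R w)) w"
proof -
  let ?D = "\<lambda>y. frechet_derivative f (at y) v"
  have lin: "((\<lambda>r. g (x + r *\<^sub>R v + t *\<^sub>R w)) has_real_derivative
      frechet_derivative g (at (x + r *\<^sub>R v + t *\<^sub>R w)) v) (at r)"
    "((\<lambda>t. g (x + r *\<^sub>R v + t *\<^sub>R w)) has_real_derivative
      frechet_derivative g (at (x + r *\<^sub>R v + t *\<^sub>R w)) w) (at t)"
    if "smooth_on g S" "x + r *\<^sub>R v + t *\<^sub>R w \<in> S" for g :: "'a \<Rightarrow> real" and r t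
  proof -
    note Dg = smooth_on_has_derivative[OF that(1) assms(1) that(2)]
    have l: "linear (frechet_derivative g (at (x + r *\<^sub>R v + t *\<^sub>R w)))"
      using Dg has_derivative_linear by blast
    have 1: "((\<lambda>r. x + r *\<^sub>R v + t *\<^sub>R w) has_derivative (\<lambda>h. h *\<^sub>R v)) (at r)"
      "((\<lambda>t. x + r *\<^sub>R v + t *\<^sub>R w) has_derivative (\<lambda>h. h *\<^sub>R w)) (at t)"
      by (auto intro!: derivative_eq_intros)
    show "((\<lambda>r. g (x + r *\<^sub>R v + t *\<^sub>R w)) has_real_derivative
      frechet_derivative g (at (x + r *\<^sub>R v + t *\<^sub>R w)) v) (at r)"
      using diff_chain_at[OF 1(1) Dg] l
      by (simp add: has_field_derivative_def o_def linear_cmul mult.commute[of _ "frechet_derivative g _ _"])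
    show "((\<lambda>t. g (x + r *\<^sub>R v + t *\<^sub>R w)) has_real_derivative
      frechet_derivative g (at (x + r *\<^sub>R v + t *\<^sub>R w)) w) (at t)"
      using diff_chain_at[OF 1(2) Dg] l
      by (simp add: has_field_derivative_def o_def linear_cmul mult.commute[of _ "frechet_derivative g _ _"])
  qed
  let ?h = "\<lambda>r. f (x + r *\<^sub>R v + s *\<^sub>R w) - f (x + r *\<^sub>R v + 0 *\<^sub>R w)"
  have "\<exists>r. 0 < r \<and> r < s \<and> ?h s - ?h 0 = (s - 0) *
      (?D (x + r *\<^sub>R v + s *\<^sub>R w) - ?D (x + r *\<^sub>R v + 0 *\<^sub>R w))"
    by (rule MVT2[OF assms(3)]) (intro DERIV_diff lin(1) assms(2) box; use assms(3) in simp)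
  then obtain r where r: "0 < r" "r < s" "?h s - ?h 0 =
      s * (?D (x + r *\<^sub>R v + s *\<^sub>R w) - ?D (x + r *\<^sub>R v + 0 *\<^sub>R w))" by auto
  have "\<exists>t. 0 < t \<and> t < s \<and> ?D (x + r *\<^sub>R v + s *\<^sub>R w) - ?D (x + r *\<^sub>R v + 0 *\<^sub>R w) = (s - 0) *
      frechet_derivative ?D (at (x + r *\<^sub>R v + t *\<^sub>R w)) w"
    by (rule MVT2[OF assms(3)]) (intro lin(2) smooth_on_derivative assms(2) box; use r(1,2) in simp)
  then obtain t where t: "0 < t" "t < s" "?D (x + r *\<^sub>R v + s *\<^sub>R w) - ?D (x + r *\<^sub>R v + 0 *\<^sub>R w) =
      s * frechet_derivative ?D (at (x + r *\<^sub>R v + t *\<^sub>R w)) w" by auto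
  show thesis
    by (rule that[OF r(1,2) t(1,2)]) (use r(3) t(3) in \<open>simp add: power2_eq_square\<close>)
qed

lemma second_derivative_symmetric_real:
  fixes f :: "'a::euclidean_space \<Rightarrow> real"
  assumes "open S" "smooth_on f S" "x \<in> S"
  shows "frechet_derivative (\<lambda>y. frechet_derivative f (at y) v) (at x) w
       = frechet_derivative (\<lambda>y. frechet_derivative f (at y) w) (at x) v" (is "?A x = ?B x")
proof (rule ccontr)
  assume ne: "?A x \<noteq> ?B x"
  define e where "e = \<bar>?A x - ?B x\<bar> / 2"
  have "e > 0" using ne by (simp add: e_def)
  have "continuous_on S ?A" "continuous_on S ?B"
    by (intro smooth_on_continuous smooth_on_derivative assms)+
  then have "isCont ?A x" "isCont ?B x"
    using assms continuous_on_eq_continuous_at by blast+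
  note C = this[unfolded continuous_at_eps_delta, rule_format, OF \<open>e > 0\<close>]
  obtain d1 where d1: "d1 > 0" "\<And>y. dist y x < d1 \<Longrightarrow> dist (?A y) (?A x) < e"
    using C(1) by (auto simp del: dist_norm)
  obtain d2 where d2: "d2 > 0" "\<And>y. dist y x < d2 \<Longrightarrow> dist (?B y) (?B x) < e"
    using C(2) by (auto simp del: dist_norm)
  obtain d3 where d3: "d3 > 0" "ball x d3 \<subseteq> S" using assms open_contains_ball by blast
  define d where "d = min d1 (min d2 d3)"
  define s where "s = d / (norm v + norm w + 1)"
  have p: "norm v + norm w + 1 > 0" by (simp add: add_nonneg_pos)
  have "d > 0" using d1 d2 d3 by (simp add: d_def)
  then have s: "s > 0" using p by (simp add: s_def)
  have near: "dist (x + r *\<^sub>R v + t *\<^sub>R w) x < d" "dist (x + r *\<^sub>R w + t *\<^sub>R v) x < d"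
    if "0 \<le> r" "r \<le> s" "0 \<le> t" "t \<le> s" for r t
  proof -
    have *: "norm (r *\<^sub>R a + t *\<^sub>R b) < d" if "norm a + norm b + 1 = norm v + norm w + 1" for a b :: 'a
    proof -
      have "norm (r *\<^sub>R a + t *\<^sub>R b) \<le> r * norm a + t * norm b"
        using norm_triangle_ineq[of "r *\<^sub>R a" "t *\<^sub>R b"] \<open>0 \<le> r\<close> \<open>0 \<le> t\<close> by simp
      also have "\<dots> \<le> s * norm a + s * norm b"
        by (intro add_mono mult_right_mono) (use \<open>r \<le> s\<close> \<open>t \<le> s\<close> in auto)
      also have "\<dots> < s * (norm a + norm b + 1)" using s by (simp add: algebra_simps)
      also have "\<dots> = d" using that p by (simp add: s_def)
      finally show ?thesis .
    qed
    show "dist (x + r *\<^sub>R v + t *\<^sub>R w) x < d" "dist (x + r *\<^sub>R w + t *\<^sub>R v) x < d"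
      using *[of v w] *[of w v] by (auto simp: dist_norm add.assoc)
  qed
  have inS: "x + r *\<^sub>R v + t *\<^sub>R w \<in> S" "x + r *\<^sub>R w + t *\<^sub>R v \<in> S"
    if "0 \<le> r" "r \<le> s" "0 \<le> t" "t \<le> s" for r t
    using near[OF that] d3(2) by (auto simp: d_def dist_commute subset_eq)
  \<comment> \<open>Over the parallelogram with sides \<open>s v\<close> and \<open>s w\<close> the same second difference is a value of either
    mixed derivative, and both values are \<open>e\<close>-close to those at \<open>x\<close>.\<close>
  obtain r t where 1: "0 < r" "r < s" "0 < t" "t < s"
    "f (x + s *\<^sub>R v + s *\<^sub>R w) - f (x + s *\<^sub>R v) - f (x + s *\<^sub>R w) + f x
     = s\<^sup>2 * ?A (x + r *\<^sub>R v + t *\<^sub>R w)"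
    by (rule second_difference_mean_value[OF assms(1,2) s inS(1)])
  obtain r' t' where 2: "0 < r'" "r' < s" "0 < t'" "t' < s"
    "f (x + s *\<^sub>R w + s *\<^sub>R v) - f (x + s *\<^sub>R w) - f (x + s *\<^sub>R v) + f x
     = s\<^sup>2 * ?B (x + r' *\<^sub>R w + t' *\<^sub>R v)"
    by (rule second_difference_mean_value[OF assms(1,2) s inS(2)])
  have "s\<^sup>2 * ?A (x + r *\<^sub>R v + t *\<^sub>R w) = s\<^sup>2 * ?B (x + r' *\<^sub>R w + t' *\<^sub>R v)"
    using 1(5) 2(5) by (simp add: algebra_simps)
  then have "?A (x + r *\<^sub>R v + t *\<^sub>R w) = ?B (x + r' *\<^sub>R w + t' *\<^sub>R v)" using s by simp
  moreover have "dist (?A (x + r *\<^sub>R v + t *\<^sub>R w)) (?A x) < e"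
    using d1(2) near(1)[of r t] 1 by (simp add: d_def)
  moreover have "dist (?B (x + r' *\<^sub>R w + t' *\<^sub>R v)) (?B x) < e"
    using d2(2) near(2)[of r' t'] 2 by (simp add: d_def)
  ultimately show False
    unfolding e_def dist_real_def by (auto simp: abs_if split: if_splits)
qed

lemma second_derivative_symmetric:
  fixes f :: "'a::euclidean_space \<Rightarrow> 'b::euclidean_space"
  assumes "open S" "smooth_on f S" "x \<in> S"
  shows "frechet_derivative (\<lambda>y. frechet_derivative f (at y) v) (at x) w
       = frechet_derivative (\<lambda>y. frechet_derivative f (at y) w) (at x) v"
proof (rule euclidean_eqI)
  fix b :: 'b
  have D: "frechet_derivative (\<lambda>y. g y \<bullet> b) (at y) = (\<lambda>u. frechet_derivative g (at y) u \<bullet> b)"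
    if "smooth_on g S" "y \<in> S" for g y
    by (intro frechet_derivative_eqI bounded_linear.has_derivative[OF bounded_linear_inner_left]
        smooth_on_has_derivative[OF that(1) assms(1) that(2)])
  have DD: "frechet_derivative (\<lambda>y. frechet_derivative f (at y) v) (at x) w \<bullet> b
      = frechet_derivative (\<lambda>y. frechet_derivative (\<lambda>y. f y \<bullet> b) (at y) v) (at x) w" for v w
  proof -
    have "frechet_derivative (\<lambda>y. frechet_derivative (\<lambda>y. f y \<bullet> b) (at y) v) (at x)
      = frechet_derivative (\<lambda>y. frechet_derivative f (at y) v \<bullet> b) (at x)"
      by (rule frechet_derivative_cong_open[OF assms(1,3)]) (simp add: D assms(2))
    then show ?thesis using D[OF smooth_on_derivative[OF assms(2)] assms(3)] by simp
  qed
  show "frechet_derivative (\<lambda>y. frechet_derivative f (at y) v) (at x) w \<bullet> b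
       = frechet_derivative (\<lambda>y. frechet_derivative f (at y) w) (at x) v \<bullet> b"
    unfolding DD
    by (rule second_derivative_symmetric_real[OF assms(1) _ assms(3)])
      (intro smooth_on_bounded_linear[OF bounded_linear_inner_left] assms)
qed


section \<open>Inner products and the Levi-Civita connection in coordinates\<close>

abbreviation inner_product :: "real^'k^'k \<Rightarrow> bool" where
  "inner_product g \<equiv> transpose g = g \<and> (\<forall>X. X \<noteq> 0 \<longrightarrow> 0 < ip g X X)"

lemma ip_linear: "linear (\<lambda>X. ip g X Y)" "linear (\<lambda>Y. ip g X Y)" "linear (\<lambda>g. ip g X Y)"
  by (auto intro!: linearI simp: ip_def inner_simps matrix_vector_right_distrib matrix_vector_mult_scaleR
      matrix_vector_mult_add_rdistrib scaleR_matrix_vector_assoc[symmetric])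

lemmas ip_simps =
  linear_add[OF ip_linear(1)] linear_add[OF ip_linear(2)] linear_cmul[OF ip_linear(1)] linear_cmul[OF ip_linear(2)]
  linear_diff[OF ip_linear(1)] linear_diff[OF ip_linear(2)] linear_0[OF ip_linear(1)] linear_0[OF ip_linear(2)]

lemma ip_commute: "transpose g = g \<Longrightarrow> ip g X Y = ip g Y X"
  unfolding ip_def by (metis dot_lmul_matrix inner_commute transpose_matrix_vector)

lemma ip_nonneg: "inner_product g \<Longrightarrow> 0 \<le> ip g X X"
  by (cases "X = 0") (auto simp: ip_simps less_imp_le)

text \<open>Vectors are identified below by their products with all vectors, which avoids inverting the Gram matrix.\<close>

lemma ip_cancel:
  assumes "inner_product g" "\<And>Z. ip g A Z = ip g B Z"
  shows "A = B"
proof (rule ccontr)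
  assume "A \<noteq> B"
  then have "0 < ip g (A - B) (A - B)" using assms(1) by simp
  then show False using assms(2)[of "A - B"] by (simp add: ip_simps)
qed

lemma sum_axis: "(\<Sum>i\<in>UNIV. (X $ i) *\<^sub>R axis i (1::real)) = X"
  using basis_expansion[of X] by (simp add: scalar_mult_eq_scaleR)

lemma matrix_inv_inner_product:
  assumes "inner_product g"
  shows "g *v (matrix_inv g *v X) = X" "matrix_inv g *v (g *v X) = X"
proof -
  have "\<forall>x. g *v x = 0 \<longrightarrow> x = 0"
    using assms unfolding ip_def by (metis inner_zero_right less_irrefl)
  then obtain h where h: "h ** g = mat 1" using matrix_left_invertible_ker[of g] by blast
  then have "g ** h = mat 1" using matrix_left_right_inverse by blast
  then have "g ** matrix_inv g = mat 1 \<and> matrix_inv g ** g = mat 1"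
    unfolding matrix_inv_def using h by (metis (mono_tags, lifting) someI_ex)
  then show "g *v (matrix_inv g *v X) = X" "matrix_inv g *v (g *v X) = X"
    by (simp_all add: matrix_vector_mul_assoc)
qed

text \<open>Christoffel symbols and shape operators are defined by raising an index; taking the product with a
  vector undoes this.\<close>

lemma ip_raise_index:
  assumes "inner_product g"
  shows "ip g (matrix_inv g *v L) Z = L \<bullet> Z"
  using ip_commute[of g "matrix_inv g *v L" Z] assms matrix_inv_inner_product(1)[OF assms]
  by (simp add: ip_def inner_commute)

lemma inner_vec_lambda_linear:
  assumes "linear f"
  shows "(\<chi> l. f (axis l 1)) \<bullet> (Z :: real^'k) = f Z"
proof -
  have "f Z = f (\<Sum>i\<in>UNIV. (Z $ i) *\<^sub>R axis i 1)" by (simp add: sum_axis)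
  also have "\<dots> = (\<Sum>i\<in>UNIV. Z $ i * f (axis i 1))" using assms by (simp add: linear_sum linear_cmul)
  finally show ?thesis by (simp add: inner_vec_def mult.commute)
qed

text \<open>The contraction \<open>g\<^sup>i\<^sup>j g\<^sub>i\<^sub>j\<close> counts the dimension.\<close>

lemma metric_trace_ip:
  fixes g :: "real^'k^'k"
  assumes "inner_product g"
  shows "metric_trace g (\<lambda>X Y. ip g X Y *\<^sub>R v) = real CARD('k) *\<^sub>R v"
proof -
  have "(\<Sum>i\<in>UNIV. \<Sum>j\<in>UNIV. matrix_inv g $ i $ j * ip g (axis i 1) (axis j 1)) = (\<Sum>i\<in>(UNIV::'k set). 1)"
  proof (rule sum.cong[OF refl])
    fix i :: 'k
    have "ip g (axis i 1) (axis j 1) = (g *v axis i 1) $ j" for j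
      using ip_commute[of g "axis i 1" "axis j 1"] assms by (simp add: ip_def inner_axis')
    then have "(\<Sum>j\<in>UNIV. matrix_inv g $ i $ j * ip g (axis i 1) (axis j 1))
        = (matrix_inv g *v (g *v axis i 1)) $ i"
      by (simp add: matrix_vector_mult_def)
    then show "(\<Sum>j\<in>UNIV. matrix_inv g $ i $ j * ip g (axis i 1) (axis j 1)) = 1"
      using matrix_inv_inner_product(2)[OF assms] by (simp add: axis_def)
  qed
  then show ?thesis
    by (simp add: metric_trace_def scaleR_sum_left[symmetric])
qed

text \<open>Strict Cauchy-Schwarz: the multiple \<open>Z\<close> of the component of \<open>X\<close> orthogonal to \<open>Y\<close> does not vanish.\<close>

lemma ip_gram_positive:
  assumes g: "inner_product g" and "X \<noteq> Y" "independent {X, Y}"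
  shows "0 < ip g X X * ip g Y Y - (ip g X Y)\<^sup>2"
proof -
  define Z where "Z = ip g Y Y *\<^sub>R X - ip g X Y *\<^sub>R Y"
  have "Y \<noteq> 0" using assms(3) by (metis dependent_zero insertI1 insert_commute)
  then have Y: "0 < ip g Y Y" using g by simp
  have "Z \<noteq> 0"
  proof
    assume "Z = 0"
    then have "(1 / ip g Y Y) *\<^sub>R (ip g Y Y *\<^sub>R X) = (ip g X Y / ip g Y Y) *\<^sub>R Y"
      by (simp add: Z_def)
    then have "X = (ip g X Y / ip g Y Y) *\<^sub>R Y" using Y by simp
    then have "X \<in> span {Y}" by (metis span_base singletonI span_mul)
    moreover have "X \<notin> span {Y}"
      using assms(2,3) by (simp add: independent_insert split: if_splits)
    ultimately show False by simp
  qed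
  then have "0 < ip g Z Z" using g by simp
  also have "ip g Z Z = ip g Y Y * (ip g X X * ip g Y Y - (ip g X Y)\<^sup>2)"
    using ip_commute[of g Y X] g by (simp add: Z_def ip_simps algebra_simps power2_eq_square)
  finally show ?thesis using Y by (simp add: zero_less_mult_iff)
qed

lemma has_derivative_ip:
  assumes "(G has_derivative DG) (at u)"
  shows "((\<lambda>w. ip (G w) X Y) has_derivative (\<lambda>v. ip (DG v) X Y)) (at u)"
  using bounded_linear.has_derivative[OF _ assms] ip_linear(3) linear_conv_bounded_linear by blast

lemma christoffel_eq:
  assumes "(G has_derivative DG) (at u)"
  shows "christoffel G u X Y = matrix_inv (G u) *v (\<chi> l. (1/2) *
    (ip (DG X) Y (axis l 1) + ip (DG Y) X (axis l 1) - ip (DG (axis l 1)) X Y))"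
  unfolding christoffel_def frechet_derivative_eqI[OF has_derivative_ip[OF assms]] ..

text \<open>The Koszul formula for constant coefficient fields, in which the metric cancels its inverse.\<close>

lemma ip_christoffel:
  assumes DG: "(G has_derivative DG) (at u)" and "inner_product (G u)"
  shows "ip (G u) (christoffel G u X Y) Z
    = (1/2) * (ip (DG X) Y Z + ip (DG Y) X Z - ip (DG Z) X Y)"
proof -
  have "linear DG" using DG has_derivative_linear by blast
  then have "linear (\<lambda>Z. (1/2) * (ip (DG X) Y Z + ip (DG Y) X Z - ip (DG Z) X Y))"
    using linear_compose[OF \<open>linear DG\<close> ip_linear(3)[of X Y]]
    by (auto intro!: linearI simp: ip_simps linear_add linear_cmul o_def algebra_simps add_divide_distrib
        linear_add[OF ip_linear(3)] linear_cmul[OF ip_linear(3)])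
  from inner_vec_lambda_linear[OF this] show ?thesis
    unfolding christoffel_eq[OF DG] ip_raise_index[OF assms(2)] .
qed

lemma christoffel_linear:
  assumes DG: "(G has_derivative DG) (at u)" and "inner_product (G u)"
  shows "linear (\<lambda>X. christoffel G u X Y)" "linear (\<lambda>Y. christoffel G u X Y)"
proof -
  have "linear DG" using DG has_derivative_linear by blast
  note s = ip_christoffel[OF assms] ip_simps linear_add[OF \<open>linear DG\<close>] linear_cmul[OF \<open>linear DG\<close>]
    linear_add[OF ip_linear(3)] linear_cmul[OF ip_linear(3)] algebra_simps
  show "linear (\<lambda>X. christoffel G u X Y)"
    by (intro linearI ip_cancel[OF assms(2)]) (simp_all add: s)
  show "linear (\<lambda>Y. christoffel G u X Y)"
    by (intro linearI ip_cancel[OF assms(2)]) (simp_all add: s)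
qed

lemma metric_derivative_commute:
  assumes "open S" "u \<in> S" "\<And>w. w \<in> S \<Longrightarrow> transpose (G w) = G w"
    and DG: "(G has_derivative DG) (at u)"
  shows "ip (DG V) X Y = ip (DG V) Y X"
proof -
  have "frechet_derivative (\<lambda>w. ip (G w) X Y) (at u) = frechet_derivative (\<lambda>w. ip (G w) Y X) (at u)"
    by (rule frechet_derivative_cong_open[OF assms(1,2)]) (simp add: ip_commute assms(3))
  then show ?thesis
    unfolding frechet_derivative_eqI[OF has_derivative_ip[OF DG]] by metis
qed

lemma christoffel_commute:
  assumes "open S" "u \<in> S" "\<And>w. w \<in> S \<Longrightarrow> inner_product (G w)"
    and DG: "(G has_derivative DG) (at u)"
  shows "christoffel G u X Y = christoffel G u Y X"
proof (rule ip_cancel[OF assms(3)[OF assms(2)]])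
  fix Z
  have "ip (DG Z) X Y = ip (DG Z) Y X"
    by (rule metric_derivative_commute[OF assms(1,2) _ DG]) (simp add: assms(3))
  then show "ip (G u) (christoffel G u X Y) Z = ip (G u) (christoffel G u Y X) Z"
    by (simp add: ip_christoffel[OF DG assms(3)[OF assms(2)]])
qed

text \<open>The derivative of \<open>g(A,B) = \<langle>DF A, DF B\<rangle>\<close> in direction \<open>V\<close> is
  \<open>\<langle>D\<^sup>2F(V,A), DF B\<rangle> + \<langle>DF A, D\<^sup>2F(V,B)\<rangle>\<close>, and in the Koszul combination the symmetry of \<open>D\<^sup>2F\<close> cancels
  everything but \<open>2 \<langle>D\<^sup>2F(X,Y), DF Z\<rangle>\<close>. So \<open>D\<^sup>2F(X,Y) - DF(\<Gamma>(X,Y))\<close>, the second fundamental form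
  of \<open>F\<close>, is orthogonal to the image of \<open>DF\<close>.\<close>

lemma euclidean_isometry_tangential:
  fixes F :: "real^'k \<Rightarrow> real^'d"
  assumes S: "open S" "u \<in> S" and F: "smooth_on F S" and G: "inner_product (G u)"
    and DG: "(G has_derivative DG) (at u)"
    and iso: "\<And>w X Y. w \<in> S \<Longrightarrow>
      ip (G w) X Y = frechet_derivative F (at w) X \<bullet> frechet_derivative F (at w) Y"
  shows "frechet_derivative (\<lambda>w. frechet_derivative F (at w) Y) (at u) X \<bullet> frechet_derivative F (at u) Z
       = frechet_derivative F (at u) (christoffel G u X Y) \<bullet> frechet_derivative F (at u) Z"
proof -
  let ?D = "\<lambda>X w. frechet_derivative F (at w) X"
  let ?DD = "\<lambda>X Y. frechet_derivative (?D Y) (at u) X"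
  have D: "(?D X has_derivative (\<lambda>V. ?DD V X)) (at u)" for X
    by (rule smooth_on_has_derivative[OF smooth_on_derivative[OF F] S])
  have sym: "?DD X Y = ?DD Y X" for X Y
    by (rule second_derivative_symmetric[OF S(1) F S(2)])
  have "ip (DG V) A B = ?DD V A \<bullet> ?D B u + ?D A u \<bullet> ?DD V B" for V A B
  proof -
    have "frechet_derivative (\<lambda>w. ip (G w) A B) (at u) = frechet_derivative (\<lambda>w. ?D A w \<bullet> ?D B w) (at u)"
      by (rule frechet_derivative_cong_open[OF S]) (simp add: iso)
    also have "\<dots> = (\<lambda>V. ?D A u \<bullet> ?DD V B + ?DD V A \<bullet> ?D B u)"
      by (rule frechet_derivative_eqI[OF has_derivative_inner[OF D D]])
    finally show ?thesis
      unfolding frechet_derivative_eqI[OF has_derivative_ip[OF DG]] by (simp add: fun_eq_iff)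
  qed
  then have "ip (G u) (christoffel G u X Y) Z = ?DD X Y \<bullet> ?D Z u"
    unfolding ip_christoffel[OF DG G] using sym[of Z X] sym[of Z Y] sym[of X Y] by (simp add: inner_commute)
  then show ?thesis using iso[OF S(2)] by simp
qed


section \<open>Hyperbolic space in horospherical coordinates\<close>

text \<open>The metric \<open>exp(-2kz) (dx\<^sup>2 + dy\<^sup>2) + dz\<^sup>2\<close> on \<open>\<real>\<^sup>3\<close>. For \<open>k > 0\<close> the substitution \<open>w = exp(kz) / k\<close> turns it
  into \<open>(dx\<^sup>2 + dy\<^sup>2 + dw\<^sup>2) / (kw)\<^sup>2\<close> on the upper half space, hyperbolic space of curvature \<open>-k\<^sup>2\<close>, and the
  slices of constant \<open>z\<close> are horospheres; for \<open>k = 0\<close> it is the Euclidean metric. One family with a global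
  chart thus covers the hyperbolic and the flat case.\<close>

definition horo_metric :: "real \<Rightarrow> real^3 \<Rightarrow> real^3^3" where
  "horo_metric k x = (\<chi> i j. if i \<noteq> j then 0 else if i = 3 then 1 else exp (- 2 * k * x $ 3))"

lemma ip_3: "ip g X Y = X$1 * (g$1$1 * Y$1 + g$1$2 * Y$2 + g$1$3 * Y$3)
    + X$2 * (g$2$1 * Y$1 + g$2$2 * Y$2 + g$2$3 * Y$3) + X$3 * (g$3$1 * Y$1 + g$3$2 * Y$2 + g$3$3 * Y$3)"
  for g :: "real^3^3"
  by (simp add: ip_def inner_vec_def matrix_vector_mult_def sum_3)

lemma ip_horo_metric:
  "ip (horo_metric k x) X Y = exp (- 2 * k * x$3) * (X$1 * Y$1 + X$2 * Y$2) + X$3 * Y$3"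
  by (simp add: ip_3 horo_metric_def algebra_simps)

lemma inner_product_horo_metric: "inner_product (horo_metric k x)"
proof (intro conjI allI impI)
  show "transpose (horo_metric k x) = horo_metric k x"
    by (simp add: horo_metric_def transpose_def vec_eq_iff)
  fix X :: "real^3" assume "X \<noteq> 0"
  then have "0 < (X$1)\<^sup>2 + (X$2)\<^sup>2 \<or> 0 < (X$3)\<^sup>2"
    by (auto simp: vec_eq_iff forall_3 sum_power2_gt_zero_iff)
  then show "0 < ip (horo_metric k x) X X"
    unfolding ip_horo_metric power2_eq_square
    by (smt (verit) exp_gt_zero mult_nonneg_nonneg mult_pos_pos not_sum_squares_lt_zero zero_le_square)
qed

lemma horo_metric_derivative:
  "(horo_metric k has_derivative
     (\<lambda>v. \<chi> i j. if i \<noteq> j \<or> i = 3 then 0 else - 2 * k * v$3 * exp (- 2 * k * x$3))) (at x)"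
proof -
  have c: "((\<lambda>x. horo_metric k x $ i $ j) has_derivative
     (\<lambda>v. if i \<noteq> j \<or> i = 3 then 0 else - 2 * k * v$3 * exp (- 2 * k * x$3))) (at x)" for i j
    by (cases "i = j"; cases "i = 3")
      (auto simp: horo_metric_def intro!: derivative_eq_intros has_derivative_vec_nth)
  show ?thesis
    unfolding has_derivative_componentwise_within[of "horo_metric k" _ x UNIV]
    using c by (auto simp: Basis_vec_def inner_axis)
qed

lemma smooth_horo_metric: "smooth_on (horo_metric k) UNIV"
proof (intro smooth_on_vec_lambda)
  fix i j :: 3
  have "smooth_on (\<lambda>x::real^3. exp (- 2 * k * x$3)) UNIV"
    by (intro smooth_intros smooth_on_linear bounded_linear_vec_nth open_UNIV)
  then show "smooth_on (\<lambda>x. horo_metric k x $ i $ j) UNIV"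
    by (cases "i = j"; cases "i = 3") (simp_all add: horo_metric_def smooth_on_const)
qed auto

lemma christoffel_horo_metric:
  "christoffel (horo_metric k) x X Y = vector [- k * (X$3 * Y$1 + X$1 * Y$3),
     - k * (X$3 * Y$2 + X$2 * Y$3), k * exp (- 2 * k * x$3) * (X$1 * Y$1 + X$2 * Y$2)]"
  by (rule ip_cancel[OF inner_product_horo_metric[of k x]],
      subst ip_christoffel[OF horo_metric_derivative inner_product_horo_metric])
    (simp add: ip_horo_metric, simp add: ip_3 algebra_simps)

lemma sectional_curvature_horo_metric:
  assumes "X \<noteq> Y" "independent {X, Y}"
  shows "sectional_curvature (horo_metric k) x X Y = - k\<^sup>2"
proof -
  let ?e = "exp (- 2 * k * x$3)"
  have cov: "cov_deriv (horo_metric k) (\<lambda>_. Z) w Y = christoffel (horo_metric k) w Y Z" for Z w Y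
    by (simp add: cov_deriv_def)
  have D: "((\<lambda>w. christoffel (horo_metric k) w Y Z) has_derivative
      (\<lambda>v. vector [0, 0, - 2 * k * k * v$3 * ?e * (Y$1 * Z$1 + Y$2 * Z$2)])) (at x)" for Y Z
  proof (rule has_derivative_vec_nthI)
    fix i :: 3
    have "((\<lambda>w::real^3. k * exp (- 2 * k * w$3) * c) has_derivative
        (\<lambda>v. - 2 * k * k * v$3 * ?e * c)) (at x)" for c
      by (auto intro!: derivative_eq_intros has_derivative_vec_nth)
    then show "((\<lambda>w. christoffel (horo_metric k) w Y Z $ i) has_derivative
      (\<lambda>v. vector [0, 0, - 2 * k * k * v$3 * ?e * (Y$1 * Z$1 + Y$2 * Z$2)] $ i)) (at x)"
      using exhaust_3[of i] unfolding christoffel_horo_metric by auto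
  qed
  have "ip (horo_metric k x) (curvature (horo_metric k) x X Y Y) X
    = - k\<^sup>2 * (ip (horo_metric k x) X X * ip (horo_metric k x) Y Y - (ip (horo_metric k x) X Y)\<^sup>2)"
    unfolding curvature_def cov unfolding cov_deriv_def frechet_derivative_eqI[OF D]
    unfolding christoffel_horo_metric ip_horo_metric
    by (simp add: power2_eq_square algebra_simps)
  then show ?thesis
    using ip_gram_positive[OF inner_product_horo_metric assms, of k x] by (simp add: sectional_curvature_def)
qed

section \<open>Hyperbolic space as a space form\<close>

definition horo_space :: "real \<Rightarrow> (real^3, 3) riemannian" where
  "horo_space k = \<lparr>points = UNIV, atlas = {(UNIV, id)}, metric = (\<lambda>_. horo_metric k)\<rparr>"

lemma horo_space_simps [simp]:
  "points (horo_space k) = UNIV" "atlas (horo_space k) = {(UNIV, id)}"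
  "charts_at (horo_space k) p = {(UNIV, id)}"
  "metric (horo_space k) x = horo_metric k"
  "gram (horo_space k) (UNIV, id) = horo_metric k"
  by (auto simp: horo_space_def charts_at_def gram_def)

lemma riemannian_manifold_horo_space: "riemannian_manifold (horo_space k)"
proof -
  have c: "coord_map (UNIV, id) (UNIV, id) id = (id :: real^3 \<Rightarrow> real^3)"
    by (auto simp: coord_map_def)
  have f: "frechet_derivative (id :: real^3 \<Rightarrow> real^3) (at u) = id" for u
    by (rule frechet_derivative_eqI) (auto intro: bounded_linear_imp_has_derivative simp: id_def)
  have h: "homeomorphism UNIV UNIV id (id :: real^3 \<Rightarrow> real^3)"
    by (simp add: homeomorphism_def id_def)
  have "smooth_on (id :: real^3 \<Rightarrow> real^3) UNIV"
    by (intro smooth_on_linear) (auto simp: id_def)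
  then have "oriented_atlas (horo_space k)"
    using h by (simp add: oriented_atlas_def c f matrix_id_mat_1)
  moreover have "riemannian_metric (horo_space k)"
    using inner_product_horo_metric[of k] smooth_horo_metric[of k] by (simp add: riemannian_metric_def c f)
  ultimately show ?thesis by (simp add: riemannian_manifold_def connected_UNIV)
qed

lemma has_vector_derivative_vector_3:
  fixes f g h :: "real \<Rightarrow> real"
  assumes "(f has_real_derivative f') (at t)" "(g has_real_derivative g') (at t)" "(h has_real_derivative h') (at t)"
  shows "((\<lambda>t. vector [f t, g t, h t] :: real^3) has_vector_derivative vector [f', g', h']) (at t)"
  unfolding has_vector_derivative_def
proof (rule has_derivative_vec_nthI)
  fix i :: 3
  show "((\<lambda>t. (vector [f t, g t, h t] :: real^3) $ i) has_derivative (\<lambda>s. (s *\<^sub>R vector [f', g', h'] :: real^3) $ i)) (at t)"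
    using exhaust_3[of i] assms by (auto simp: has_field_derivative_def mult.commute[of _ f'] mult.commute[of _ g'] mult.commute[of _ h'])
qed

lemma smooth_on_vector_3:
  assumes "open S" "smooth_on f S" "smooth_on g S" "smooth_on h S"
  shows "smooth_on (\<lambda>t. vector [f t, g t, h t] :: real^3) S"
proof (rule smooth_on_vec_lambda[OF assms(1)])
  fix i :: 3
  show "smooth_on (\<lambda>t. (vector [f t, g t, h t] :: real^3) $ i) S"
    using exhaust_3[of i] assms by auto
qed

lemma geodesic_horo_spaceI:
  assumes "smooth_on \<gamma> UNIV"
    and 1: "\<And>t. (\<gamma> has_vector_derivative \<gamma>' t) (at t)"
    and 2: "\<And>t. (\<gamma>' has_vector_derivative \<gamma>'' t) (at t)"
    and "\<And>t. \<gamma>'' t + christoffel (horo_metric k) (\<gamma> t) (\<gamma>' t) (\<gamma>' t) = 0"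
  shows "geodesic (horo_space k) \<gamma>"
proof -
  have "vector_derivative \<gamma> (at t) = \<gamma>' t" "vector_derivative \<gamma>' (at t) = \<gamma>'' t" for t
    using 1 2 by (auto intro: vector_derivative_at)
  then show ?thesis
    using assms(1,4) smooth_on_continuous[OF assms(1)] by (simp add: geodesic_def)
qed

lemma horo_space_line_geodesic:
  assumes "k = 0 \<or> X = 0"
  shows "geodesic (horo_space k) (\<lambda>t. p + t *\<^sub>R X)"
proof (rule geodesic_horo_spaceI)
  show "smooth_on (\<lambda>t. p + t *\<^sub>R X) UNIV"
    by (intro smooth_intros smooth_on_linear open_UNIV bounded_linear_ident)
  show "((\<lambda>t. p + t *\<^sub>R X) has_vector_derivative X) (at t)" for t
    by (auto intro!: derivative_eq_intros)
  show "((\<lambda>_. X) has_vector_derivative 0) (at t)" for t by simp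
  show "0 + christoffel (horo_metric k) (p + t *\<^sub>R X) X X = 0" for t
    using assms by (auto simp: christoffel_horo_metric vec_eq_iff forall_3)
qed

text \<open>Along a geodesic the momenta \<open>exp(-2kz) x'\<close> and \<open>exp(-2kz) y'\<close> are constants \<open>q\<^sub>1\<close>, \<open>q\<^sub>2\<close>, and so is the
  speed \<open>n\<close>. The function \<open>f = exp(-kz)\<close> therefore satisfies the linear equation \<open>f'' = \<omega>\<^sup>2 f\<close> with \<open>\<omega> = k n\<close>,
  so it is a combination of \<open>exp(\<omega>t)\<close> and \<open>exp(-\<omega>t)\<close>. As \<open>z\<close> cannot change faster than the speed, the
  coefficients are nonnegative and \<open>f\<close> stays positive for all times. The remaining coordinates integrate
  \<open>x' = q\<^sub>1 / f\<^sup>2\<close>, and a primitive of \<open>1 / f\<^sup>2\<close> is \<open>g / f\<close> for the second solution \<open>g\<close> with Wronskian \<open>1\<close>.\<close>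

lemma horo_space_curved_geodesic:
  fixes p X :: "real^3"
  assumes "k \<noteq> 0" "X \<noteq> 0"
  obtains \<gamma> where "geodesic (horo_space k) \<gamma>" "\<gamma> 0 = p" "(\<gamma> has_vector_derivative X) (at 0)"
proof -
  \<comment> \<open>Initial data: \<open>f 0 = f0\<close> gives the height and \<open>f' 0 = - k X\<^sub>3 f0\<close> the vertical velocity.\<close>
  define f0 where "f0 = exp (- k * p$3)"
  define n where "n = sqrt (ip (horo_metric k p) X X)"
  define \<omega> where "\<omega> = k * n"
  define \<alpha> where "\<alpha> = f0 / 2 * (1 - X$3 / n)"
  define \<beta> where "\<beta> = f0 / 2 * (1 + X$3 / n)"
  define q1 where "q1 = f0\<^sup>2 * X$1"
  define q2 where "q2 = f0\<^sup>2 * X$2"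
  define f where "f t = \<alpha> * exp (\<omega> * t) + \<beta> * exp (- \<omega> * t)" for t
  define f' where "f' t = \<omega> * (\<alpha> * exp (\<omega> * t) - \<beta> * exp (- \<omega> * t))" for t
  define g where "g t = (exp (\<omega> * t) - exp (- \<omega> * t)) / (2 * \<omega> * f0)" for t
  have f0: "f0 > 0" by (simp add: f0_def)
  have f0e: "exp (- 2 * k * p$3) = f0\<^sup>2" by (simp add: f0_def exp_double[symmetric])
  have pos: "0 < ip (horo_metric k p) X X" using inner_product_horo_metric assms(2) by blast
  then have n: "n > 0" by (simp add: n_def)
  have n2: "n\<^sup>2 = f0\<^sup>2 * ((X$1)\<^sup>2 + (X$2)\<^sup>2) + (X$3)\<^sup>2"
    using pos by (simp add: n_def ip_horo_metric f0e[simplified] power2_eq_square)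
  then have "(X$3)\<^sup>2 \<le> n\<^sup>2" by simp
  then have "\<bar>X$3\<bar> \<le> n" using n abs_le_square_iff[of "X$3" n] by simp
  then have "X$3 / n \<le> 1" "- 1 \<le> X$3 / n" using n by (auto simp: field_simps)
  then have ab: "\<alpha> \<ge> 0" "\<beta> \<ge> 0" using f0 by (auto simp: \<alpha>_def \<beta>_def)
  have sum: "\<alpha> + \<beta> = f0" by (simp add: \<alpha>_def \<beta>_def algebra_simps)
  have \<omega>: "\<omega> \<noteq> 0" using assms n by (simp add: \<omega>_def)
  have f: "f t > 0" for t
  proof (cases "\<alpha> > 0")
    case True then show ?thesis using ab by (simp add: f_def add_pos_nonneg)
  next
    case False then show ?thesis using ab sum f0 by (simp add: f_def)
  qed
  have ee: "exp (\<omega> * t) * exp (- \<omega> * t) = 1" for t by (simp add: exp_minus)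
  have "\<omega>\<^sup>2 * (4 * \<alpha> * \<beta>) = k\<^sup>2 * f0\<^sup>2 * (n\<^sup>2 - (X$3)\<^sup>2)"
    using n by (simp add: \<omega>_def \<alpha>_def \<beta>_def field_simps power2_eq_square)
  also have "\<dots> = k\<^sup>2 * f0\<^sup>2 * (f0\<^sup>2 * ((X$1)\<^sup>2 + (X$2)\<^sup>2))" by (simp only: n2 add_diff_cancel_right')
  also have "\<dots> = k\<^sup>2 * (q1\<^sup>2 + q2\<^sup>2)" by (simp add: q1_def q2_def power2_eq_square algebra_simps)
  finally have ab4: "\<omega>\<^sup>2 * (4 * \<alpha> * \<beta>) = k\<^sup>2 * (q1\<^sup>2 + q2\<^sup>2)" .
  have energy: "\<omega>\<^sup>2 * (f t)\<^sup>2 - (f' t)\<^sup>2 = k\<^sup>2 * (q1\<^sup>2 + q2\<^sup>2)" for t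
  proof -
    have "\<omega>\<^sup>2 * (f t)\<^sup>2 - (f' t)\<^sup>2 = \<omega>\<^sup>2 * (4 * \<alpha> * \<beta>) * (exp (\<omega> * t) * exp (- \<omega> * t))"
      by (simp add: f_def f'_def power2_eq_square algebra_simps)
    then show ?thesis by (simp only: ee ab4 mult_1_right)
  qed
  have wronskian: "(exp (\<omega> * t) + exp (- \<omega> * t)) / (2 * f0) * f t - g t * f' t = 1" for t
  proof -
    have "(exp (\<omega> * t) + exp (- \<omega> * t)) / (2 * f0) * f t - g t * f' t
      = (\<alpha> + \<beta>) / f0 * (exp (\<omega> * t) * exp (- \<omega> * t))"
      using \<omega> f0 by (simp add: f_def f'_def g_def field_simps)
    then show ?thesis using f0 by (simp only: ee sum) simp
  qed
  have Df: "(f has_real_derivative f' t) (at t)" for t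
    unfolding f_def f'_def by (auto intro!: derivative_eq_intros simp: algebra_simps)
  have Df': "(f' has_real_derivative \<omega>\<^sup>2 * f t) (at t)" for t
    unfolding f_def f'_def by (auto intro!: derivative_eq_intros simp: algebra_simps power2_eq_square)
  have Dg: "(g has_real_derivative (exp (\<omega> * t) + exp (- \<omega> * t)) / (2 * f0)) (at t)" for t
    unfolding g_def using \<omega> f0 by (auto intro!: derivative_eq_intros simp: field_simps)
  have Dgf: "((\<lambda>t. p0 + q * (g t / f t)) has_real_derivative q / (f t)\<^sup>2) (at t)" for p0 q t
    by (rule derivative_eq_intros Dg Df refl | use f[of t] wronskian[of t] in \<open>simp add: power2_eq_square\<close>)+
  have Dz: "((\<lambda>t. - ln (f t) / k) has_real_derivative - f' t / (k * f t)) (at t)" for t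
    using f[of t] assms(1) by (auto intro!: derivative_eq_intros Df simp: field_simps)
  have Dq: "((\<lambda>t. q / (f t)\<^sup>2) has_real_derivative - 2 * q * f' t / (f t)^3) (at t)" for q t
    using f[of t] by (auto intro!: derivative_eq_intros Df simp: field_simps power2_eq_square power3_eq_cube)
  have Dz': "((\<lambda>t. - f' t / (k * f t)) has_real_derivative - k * (q1\<^sup>2 + q2\<^sup>2) / (f t)\<^sup>2) (at t)" for t
  proof -
    have "((\<lambda>t. - f' t / (k * f t)) has_real_derivative - (\<omega>\<^sup>2 * (f t)\<^sup>2 - (f' t)\<^sup>2) / (k * (f t)\<^sup>2)) (at t)"
      using f[of t] assms(1) by (auto intro!: derivative_eq_intros Df Df' simp: field_simps power2_eq_square)
    then show ?thesis unfolding energy using assms(1) by (simp add: power2_eq_square)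
  qed
  define \<gamma> where "\<gamma> t = (vector [p$1 + q1 * (g t / f t), p$2 + q2 * (g t / f t), - ln (f t) / k] :: real^3)" for t
  define \<gamma>' where "\<gamma>' t = (vector [q1 / (f t)\<^sup>2, q2 / (f t)\<^sup>2, - f' t / (k * f t)] :: real^3)" for t
  have D\<gamma>: "(\<gamma> has_vector_derivative \<gamma>' t) (at t)" for t
    unfolding \<gamma>_def[abs_def] \<gamma>'_def by (intro has_vector_derivative_vector_3 Dgf Dz)
  have "geodesic (horo_space k) \<gamma>"
  proof (rule geodesic_horo_spaceI[OF _ D\<gamma>])
    have id: "smooth_on (\<lambda>t::real. t) UNIV" by (intro smooth_on_linear) auto
    have sf: "smooth_on f UNIV" unfolding f_def[abs_def] by (intro smooth_intros id) auto
    have sg: "smooth_on g UNIV" unfolding g_def[abs_def] divide_inverse by (intro smooth_intros id) auto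
    have sx: "smooth_on (\<lambda>t. q + q' * (g t / f t)) UNIV" for q q'
      by (intro smooth_intros open_UNIV f sf sg)
    have sz: "smooth_on (\<lambda>t. - ln (f t) / k) UNIV"
      using smooth_on_mult[OF _ smooth_on_minus[OF _ smooth_on_ln[OF _ sf]] smooth_on_const[of "1 / k"]] f by simp
    show "smooth_on \<gamma> UNIV"
      unfolding \<gamma>_def[abs_def] by (intro smooth_on_vector_3 open_UNIV sx sz)
    show "(\<gamma>' has_vector_derivative vector [- 2 * q1 * f' t / (f t)^3, - 2 * q2 * f' t / (f t)^3,
        - k * (q1\<^sup>2 + q2\<^sup>2) / (f t)\<^sup>2]) (at t)" for t
      unfolding \<gamma>'_def[abs_def] by (intro has_vector_derivative_vector_3 Dq Dz')
    have "exp (- 2 * k * (- ln (f t) / k)) = (f t)\<^sup>2" for t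
      using f[of t] assms(1) by (simp add: exp_double)
    then show "vector [- 2 * q1 * f' t / (f t)^3, - 2 * q2 * f' t / (f t)^3, - k * (q1\<^sup>2 + q2\<^sup>2) / (f t)\<^sup>2]
        + christoffel (horo_metric k) (\<gamma> t) (\<gamma>' t) (\<gamma>' t) = 0" for t
      using f[of t] assms(1)
      by (simp add: christoffel_horo_metric vec_eq_iff forall_3 \<gamma>_def \<gamma>'_def field_simps power2_eq_square power3_eq_cube)
  qed
  moreover have f_0: "f 0 = f0" "g 0 = 0" "f' 0 = - k * f0 * X$3"
    using n by (simp_all add: f_def g_def f'_def sum) (simp add: \<omega>_def \<alpha>_def \<beta>_def field_simps)
  then have "\<gamma> 0 = p" "\<gamma>' 0 = X"
    using f0 assms(1) by (simp_all add: \<gamma>_def \<gamma>'_def vec_eq_iff forall_3 q1_def q2_def)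
      (simp add: f0_def)
  ultimately show thesis using that D\<gamma>[of 0] by simp
qed

lemma space_form_horo_space: "space_form (- k\<^sup>2) (horo_space k)"
proof -
  have "\<exists>\<gamma>. geodesic (horo_space k) \<gamma> \<and> \<gamma> 0 = p \<and> vector_derivative \<gamma> (at 0) = X" for p X
  proof (cases "k = 0 \<or> X = 0")
    case True
    have "((\<lambda>t. p + t *\<^sub>R X) has_vector_derivative X) (at 0)" by (auto intro!: derivative_eq_intros)
    then show ?thesis
      using horo_space_line_geodesic[OF True, of p]
      by (intro exI[of _ "\<lambda>t. p + t *\<^sub>R X"]) (simp add: vector_derivative_at)
  next
    case False
    then show ?thesis using horo_space_curved_geodesic[of k X p] vector_derivative_at by metis
  qed
  then have "geodesically_complete (horo_space k)" by (simp add: geodesically_complete_def)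
  moreover have "simply_connected (UNIV :: (real^3) set)"
    by (intro convex_imp_simply_connected convex_UNIV)
  ultimately show ?thesis
    by (simp add: space_form_def riemannian_manifold_horo_space constant_sectional_curvature_def
        sectional_curvature_horo_metric)
qed

section \<open>The Poincare lemma\<close>

text \<open>The potential is the integral of the form along segments from a base point. By closedness the derivative
  of the integrand in \<open>x\<close> is the inner product with \<open>d/dt (t A(x\<^sub>0 + t (x - x\<^sub>0)))\<close>, so that the integral of the derivative
  is given by the boundary value \<open>A x\<close>.\<close>

lemma poincare_lemma:
  fixes A :: "'a::euclidean_space \<Rightarrow> 'a"
  assumes S: "open S" "convex S" and A: "smooth_on A S"
    and closed: "\<And>u v w. u \<in> S \<Longrightarrow> frechet_derivative A (at u) v \<bullet> w = frechet_derivative A (at u) w \<bullet> v"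
  obtains F :: "'a \<Rightarrow> real" where "\<And>u. u \<in> S \<Longrightarrow> (F has_derivative (\<lambda>v. A u \<bullet> v)) (at u)"
proof (cases "S = {}")
  case False
  then obtain x0 where x0: "x0 \<in> S" by blast
  let ?g = "\<lambda>x t. x0 + t *\<^sub>R (x - x0)"
  let ?D = "\<lambda>u v. frechet_derivative A (at u) v"
  define w where "w x t = A (?g x t) + t *\<^sub>R ?D (?g x t) (x - x0)" for x t
  define F where "F x = integral (cbox 0 1) (\<lambda>t. A (?g x t) \<bullet> (x - x0))" for x
  have g: "?g x t \<in> S" if "x \<in> S" "t \<in> cbox 0 (1::real)" for x t
  proof -
    have "(1 - t) *\<^sub>R x0 + t *\<^sub>R x \<in> S"
      using S(2) x0 that by (auto simp: convex_alt)
    then show ?thesis by (simp add: algebra_simps)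
  qed
  have DA: "(A has_derivative ?D u) (at u)" if "u \<in> S" for u
    by (rule smooth_on_has_derivative[OF A S(1) that])
  have D_sum: "?D u v = (\<Sum>b\<in>Basis. (v \<bullet> b) *\<^sub>R ?D u b)" if "u \<in> S" for u v
  proof -
    have "linear (?D u)" using DA[OF that] has_derivative_linear by blast
    then show ?thesis
      by (subst euclidean_representation[of v, symmetric]) (simp only: linear_sum linear_cmul)
  qed
  have cont_comp: "continuous_on (S \<times> cbox 0 1) (\<lambda>(x, t). h (?g x t))" if "continuous_on S h" for h :: "'a \<Rightarrow> 'a"
    unfolding split_beta
    by (rule continuous_on_compose2[OF that]) (use g in \<open>force intro!: continuous_intros\<close>)+
  have cont_w: "continuous_on (S \<times> cbox 0 1) (\<lambda>(x, t). w x t)"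
  proof -
    have "continuous_on (S \<times> cbox 0 1) (\<lambda>(x, t). A (?g x t) + t *\<^sub>R (\<Sum>b\<in>Basis. ((x - x0) \<bullet> b) *\<^sub>R ?D (?g x t) b))"
      unfolding split_beta
      by (intro continuous_intros cont_comp[unfolded split_beta] smooth_on_continuous[OF A]
          smooth_on_continuous[OF smooth_on_derivative[OF A]])
    then show ?thesis
    proof (rule continuous_on_eq)
      have "w x t = A (?g x t) + t *\<^sub>R (\<Sum>b\<in>Basis. ((x - x0) \<bullet> b) *\<^sub>R ?D (?g x t) b)"
        if "x \<in> S" "t \<in> cbox 0 1" for x t
        using D_sum[OF g[OF that], of "x - x0"] unfolding w_def by simp
      then show "(case p of (x, t) \<Rightarrow> A (?g x t) + t *\<^sub>R (\<Sum>b\<in>Basis. ((x - x0) \<bullet> b) *\<^sub>R ?D (?g x t) b))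
          = (case p of (x, t) \<Rightarrow> w x t)" if "p \<in> S \<times> cbox 0 1" for p
        using that by auto
    qed
  qed
  have deriv: "((\<lambda>x. A (?g x t) \<bullet> (x - x0)) has_derivative blinfun_apply (blinfun_inner_right (w x t))) (at x within S)"
    if "x \<in> S" "t \<in> cbox 0 1" for x t
  proof -
    have 1: "((\<lambda>x. ?g x t) has_derivative (\<lambda>v. t *\<^sub>R v)) (at x)"
      by (auto intro!: derivative_eq_intros)
    have 2: "((\<lambda>x. A (?g x t)) has_derivative (\<lambda>v. ?D (?g x t) (t *\<^sub>R v))) (at x)"
      using diff_chain_at[OF 1 DA[OF g[OF that]]] by (simp add: o_def)
    have 3: "((\<lambda>x. x - x0) has_derivative (\<lambda>v. v)) (at x)"
      by (auto intro!: derivative_eq_intros)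
    have l: "linear (?D (?g x t))" using DA[OF g[OF that]] has_derivative_linear by blast
    have "A (?g x t) \<bullet> v + ?D (?g x t) (t *\<^sub>R v) \<bullet> (x - x0) = w x t \<bullet> v" for v
      using closed[OF g[OF that], of v "x - x0"] l by (simp add: w_def inner_add_left linear_cmul)
    then show ?thesis
      using has_derivative_at_withinI[OF has_derivative_inner[OF 2 3]] by (simp add: fun_eq_iff)
  qed
  have "(F has_derivative (\<lambda>v. A x \<bullet> v)) (at x)" if "x \<in> S" for x
  proof -
    have "(F has_derivative integral (cbox 0 1) (\<lambda>t. blinfun_inner_right (w x t))) (at x within S)"
      unfolding F_def[abs_def]
    proof (rule leibniz_rule[OF deriv _ _ that S(2)])
      fix x assume x: "x \<in> S"
      have "continuous_on (cbox 0 1) (\<lambda>t. A (?g x t))"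
        by (rule continuous_on_compose2[OF smooth_on_continuous[OF A]]) (use g[OF x] in \<open>auto intro!: continuous_intros\<close>)
      then show "(\<lambda>t. A (?g x t) \<bullet> (x - x0)) integrable_on cbox 0 1"
        by (intro integrable_continuous continuous_intros)
    next
      show "continuous_on (S \<times> cbox 0 1) (\<lambda>(x, t). blinfun_inner_right (w x t))"
        using bounded_linear.continuous_on[OF bounded_linear_blinfun_inner_right cont_w]
        by (simp add: split_beta)
    qed
    moreover have "((\<lambda>t. w x t) has_integral A x) (cbox 0 1)"
    proof -
      have "((\<lambda>t. t *\<^sub>R A (?g x t)) has_vector_derivative w x t) (at t within {0..1})" if t: "t \<in> {0..1}" for t
      proof -
        have 1: "((\<lambda>t. ?g x t) has_derivative (\<lambda>h. h *\<^sub>R (x - x0))) (at t)"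
          by (auto intro!: derivative_eq_intros)
        have gS: "?g x t \<in> S" using g[OF \<open>x \<in> S\<close>] t by simp
        have 2: "((\<lambda>t. A (?g x t)) has_derivative (\<lambda>h. ?D (?g x t) (h *\<^sub>R (x - x0)))) (at t)"
          using diff_chain_at[OF 1 DA[OF gS]] by (simp add: o_def)
        have l: "linear (?D (?g x t))" using DA[OF gS] has_derivative_linear by blast
        have "((\<lambda>t. t *\<^sub>R A (?g x t)) has_derivative (\<lambda>h. t *\<^sub>R ?D (?g x t) (h *\<^sub>R (x - x0)) + h *\<^sub>R A (?g x t))) (at t)"
          by (rule has_derivative_scaleR[OF has_derivative_ident 2])
        moreover have "(\<lambda>h. t *\<^sub>R ?D (?g x t) (h *\<^sub>R (x - x0)) + h *\<^sub>R A (?g x t)) = (\<lambda>h. h *\<^sub>R w x t)"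
          by (simp add: w_def linear_cmul[OF l] scaleR_add_right mult.commute add.commute)
        ultimately show ?thesis
          unfolding has_vector_derivative_def by (metis has_derivative_at_withinI)
      qed
      from fundamental_theorem_of_calculus[OF _ this] show ?thesis by simp
    qed
    then have "((\<lambda>t. blinfun_inner_right (w x t)) has_integral blinfun_inner_right (A x)) (cbox 0 1)"
      using has_integral_linear[OF _ bounded_linear_blinfun_inner_right, of "w x" "A x"] by (simp add: o_def)
    then have "integral (cbox 0 1) (\<lambda>t. blinfun_inner_right (w x t)) = blinfun_inner_right (A x)"
      by (rule integral_unique)
    ultimately show ?thesis
      using at_within_open[OF that S(1)] by simp
  qed
  then show thesis using that by blast
qed (use that in auto)

lemma vec_2_sum: "(v :: real^2) = v$1 *\<^sub>R axis 1 1 + v$2 *\<^sub>R axis 2 1"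
  by (simp add: vec_eq_iff forall_2 axis_def)

lemma has_derivative_plane:
  fixes f :: "real^2 \<Rightarrow> real"
  assumes "smooth_on f S" "open S" "u \<in> S"
  shows "(f has_derivative (\<lambda>v. frechet_derivative f (at u) (axis 1 1) * v$1
      + frechet_derivative f (at u) (axis 2 1) * v$2)) (at u)"
proof -
  note D = smooth_on_has_derivative[OF assms]
  then have "linear (frechet_derivative f (at u))" using has_derivative_linear by blast
  then have "frechet_derivative f (at u) v = frechet_derivative f (at u) (axis 1 1) * v$1
      + frechet_derivative f (at u) (axis 2 1) * v$2" for v
    by (subst vec_2_sum[of v]) (simp only: linear_add linear_cmul real_scaleR_def mult.commute)
  then show ?thesis using D by (metis (no_types, lifting) ext)
qed

lemma closed_form_potential:
  fixes P Q :: "real^2 \<Rightarrow> real"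
  assumes S: "open S" "convex S" and P: "smooth_on P S" and Q: "smooth_on Q S"
    and closed: "\<And>u. u \<in> S \<Longrightarrow>
      frechet_derivative P (at u) (axis 2 1) = frechet_derivative Q (at u) (axis 1 1)"
  obtains F where "\<And>u. u \<in> S \<Longrightarrow> (F has_derivative (\<lambda>v. P u * v$1 + Q u * v$2)) (at u)"
    "smooth_on F S"
proof -
  define A where "A u = (vector [P u, Q u] :: real^2)" for u
  have A: "smooth_on A S"
  proof (rule smooth_on_vec_lambda[OF S(1)])
    fix i :: 2
    show "smooth_on (\<lambda>u. A u $ i) S" using exhaust_2[of i] P Q by (auto simp: A_def)
  qed
  have D: "frechet_derivative A (at u) v = vector
      [frechet_derivative P (at u) (axis 1 1) * v$1 + frechet_derivative P (at u) (axis 2 1) * v$2,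
       frechet_derivative Q (at u) (axis 1 1) * v$1 + frechet_derivative Q (at u) (axis 2 1) * v$2]"
    if "u \<in> S" for u v
  proof -
    have "(A has_derivative (\<lambda>v. vector
      [frechet_derivative P (at u) (axis 1 1) * v$1 + frechet_derivative P (at u) (axis 2 1) * v$2,
       frechet_derivative Q (at u) (axis 1 1) * v$1 + frechet_derivative Q (at u) (axis 2 1) * v$2])) (at u)"
    proof (rule has_derivative_vec_nthI)
      fix i :: 2
      show "((\<lambda>u. A u $ i) has_derivative (\<lambda>v. vector
        [frechet_derivative P (at u) (axis 1 1) * v$1 + frechet_derivative P (at u) (axis 2 1) * v$2,
         frechet_derivative Q (at u) (axis 1 1) * v$1 + frechet_derivative Q (at u) (axis 2 1) * v$2] $ i)) (at u)"
        using exhaust_2[of i] has_derivative_plane[OF P S(1) that] has_derivative_plane[OF Q S(1) that]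
        by (auto simp: A_def)
    qed
    from fun_cong[OF frechet_derivative_eqI[OF this]] show ?thesis .
  qed
  have "frechet_derivative A (at u) v \<bullet> w = frechet_derivative A (at u) w \<bullet> v" if "u \<in> S" for u v w
    using that by (simp add: D closed inner_vec_def sum_2 algebra_simps)
  then obtain F where F: "\<And>u. u \<in> S \<Longrightarrow> (F has_derivative (\<lambda>v. A u \<bullet> v)) (at u)"
    using poincare_lemma[OF S A] by blast
  then have F': "(F has_derivative (\<lambda>v. P u * v$1 + Q u * v$2)) (at u)" if "u \<in> S" for u
    using that by (simp add: A_def inner_vec_def sum_2)
  have "smooth_on F S"
    by (rule smooth_on_derivativeI[OF S(1) F']) (assumption, intro smooth_intros P Q S(1))
  then show thesis using that F' by blast
qed


section \<open>Flat metrics on a planar domain\<close>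

text \<open>Gram-Schmidt applied to the coordinate frame writes a metric in the plane as \<open>s1\<^sup>2 + s2\<^sup>2\<close> with the orthonormal
  coframe \<open>s1 = a dx + b dy\<close>, \<open>s2 = d dy\<close>. With the functions \<open>a\<close>, \<open>b\<close>, \<open>d\<close> as data all of the curvature computation is
  rational.\<close>

locale plane_coframe =
  fixes S :: "(real^2) set" and G :: "real^2 \<Rightarrow> real^2^2" and a b d :: "real^2 \<Rightarrow> real"
  assumes open_S: "open S" and smooth_G: "smooth_on G S"
    and G_pos: "\<And>w. w \<in> S \<Longrightarrow> inner_product (G w)"
    and smooth_a: "smooth_on a S" and smooth_b: "smooth_on b S" and smooth_d: "smooth_on d S"
    and a_pos: "\<And>w. w \<in> S \<Longrightarrow> 0 < a w" and d_pos: "\<And>w. w \<in> S \<Longrightarrow> 0 < d w"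
    and G_eq: "\<And>w X Y. w \<in> S \<Longrightarrow> ip (G w) X Y =
      (a w * X$1 + b w * X$2) * (a w * Y$1 + b w * Y$2) + (d w * X$2) * (d w * Y$2)"
begin

definition s1 :: "real^2 \<Rightarrow> real^2 \<Rightarrow> real" where "s1 w X = a w * X$1 + b w * X$2"
definition s2 :: "real^2 \<Rightarrow> real^2 \<Rightarrow> real" where "s2 w X = d w * X$2"

text \<open>The connection form \<open>\<omega> = p dx + q dy\<close> is the solution of the structure equations
  \<open>d s1 = - \<omega> \<and> s2\<close> and \<open>d s2 = \<omega> \<and> s1\<close>; the first determines \<open>p\<close>, the second \<open>q\<close>.\<close>

definition p :: "real^2 \<Rightarrow> real" where
  "p w = (frechet_derivative a (at w) (axis 2 1) - frechet_derivative b (at w) (axis 1 1)) / d w"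
definition q :: "real^2 \<Rightarrow> real" where
  "q w = (p w * b w - frechet_derivative d (at w) (axis 1 1)) / a w"
definition \<omega> :: "real^2 \<Rightarrow> real^2 \<Rightarrow> real" where "\<omega> w X = p w * X$1 + q w * X$2"

lemma smooth_p: "smooth_on p S" and smooth_q: "smooth_on q S"
proof -
  show p: "smooth_on p S" unfolding p_def[abs_def]
    by (intro smooth_intros smooth_a smooth_b smooth_d d_pos open_S)
  show "smooth_on q S" unfolding q_def[abs_def]
    by (intro smooth_intros p smooth_a smooth_b smooth_d a_pos open_S)
qed

text \<open>In the coframe, covariant differentiation is componentwise differentiation followed by the infinitesimal
  rotation \<open>\<omega>\<close>. This is stated for constant coefficient fields, where it follows from the Koszul formula:
  eliminating the derivatives of \<open>b\<close> and \<open>d\<close> in the first coordinate in favour of \<open>p\<close> and \<open>q\<close> makes both sides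
  polynomial.\<close>

lemma christoffel_coframe:
  assumes "w \<in> S"
  shows "s1 w (christoffel G w X Y) = frechet_derivative a (at w) X * Y$1 + frechet_derivative b (at w) X * Y$2
      + \<omega> w X * s2 w Y" (is "_ = ?c1")
    and "s2 w (christoffel G w X Y) = frechet_derivative d (at w) X * Y$2 - \<omega> w X * s1 w Y" (is "_ = ?c2")
proof -
  note Dg = smooth_on_has_derivative[OF smooth_G open_S assms]
  let ?Da = "frechet_derivative a (at w)" and ?Db = "frechet_derivative b (at w)" and ?Dd = "frechet_derivative d (at w)"
  have ad: "a w \<noteq> 0" "d w \<noteq> 0" using a_pos d_pos assms by force+
  have lin: "frechet_derivative f (at w) V = frechet_derivative f (at w) (axis 1 1) * V$1
      + frechet_derivative f (at w) (axis 2 1) * V$2" if "smooth_on f S" for f :: "real^2 \<Rightarrow> real" and V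
    by (rule fun_cong[OF frechet_derivative_eqI[OF has_derivative_plane[OF that open_S assms]]])
  have DG: "ip (frechet_derivative G (at w) V) A B =
      (?Da V * A$1 + ?Db V * A$2) * (a w * B$1 + b w * B$2) + (a w * A$1 + b w * A$2) * (?Da V * B$1 + ?Db V * B$2)
      + 2 * d w * ?Dd V * A$2 * B$2" for V A B
  proof -
    have "frechet_derivative (\<lambda>w. ip (G w) A B) (at w) = frechet_derivative (\<lambda>w.
       (a w * A$1 + b w * A$2) * (a w * B$1 + b w * B$2) + (d w * A$2) * (d w * B$2)) (at w)"
      by (rule frechet_derivative_cong_open[OF open_S assms]) (simp add: G_eq)
    also have "\<dots> = (\<lambda>V. (?Da V * A$1 + ?Db V * A$2) * (a w * B$1 + b w * B$2)
        + (a w * A$1 + b w * A$2) * (?Da V * B$1 + ?Db V * B$2) + 2 * d w * ?Dd V * A$2 * B$2)"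
      by (rule frechet_derivative_eqI, (rule derivative_eq_intros refl
            smooth_on_has_derivative[OF smooth_a open_S assms] smooth_on_has_derivative[OF smooth_b open_S assms]
            smooth_on_has_derivative[OF smooth_d open_S assms])+)
        (simp add: fun_eq_iff algebra_simps)
    finally show ?thesis
      unfolding frechet_derivative_eqI[OF has_derivative_ip[OF Dg]] by (simp add: fun_eq_iff)
  qed
  have b1: "?Db (axis 1 1) = ?Da (axis 2 1) - p w * d w" using ad by (simp add: p_def)
  have d1: "?Dd (axis 1 1) = p w * b w - q w * a w" using ad by (simp add: q_def)
  define A :: "real^2" where "A = vector [(?c1 - b w * (?c2 / d w)) / a w, ?c2 / d w]"
  have A: "s1 w A = ?c1" "s2 w A = ?c2" using ad by (simp_all add: A_def s1_def s2_def)
  have "christoffel G w X Y = A"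
  proof (rule ip_cancel[OF G_pos[OF assms]])
    fix Z
    have "ip (G w) A Z = ?c1 * s1 w Z + ?c2 * s2 w Z"
      using G_eq[OF assms, of A Z] A by (simp add: s1_def s2_def)
    then show "ip (G w) (christoffel G w X Y) Z = ip (G w) A Z"
      unfolding ip_christoffel[OF Dg G_pos[OF assms]] DG
        lin[OF smooth_a, of X] lin[OF smooth_b, of X] lin[OF smooth_d, of X]
        lin[OF smooth_a, of Y] lin[OF smooth_b, of Y] lin[OF smooth_d, of Y]
        lin[OF smooth_a, of Z] lin[OF smooth_b, of Z] lin[OF smooth_d, of Z]
        b1 d1 s1_def s2_def \<omega>_def
      by (simp add: field_simps)
  qed
  then show "s1 w (christoffel G w X Y) = ?c1" "s2 w (christoffel G w X Y) = ?c2" using A by auto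
qed

lemma cov_deriv_coframe:
  assumes "w \<in> S" and Z: "smooth_on Z S"
  shows "s1 w (cov_deriv G Z w X) = frechet_derivative (\<lambda>w. s1 w (Z w)) (at w) X + \<omega> w X * s2 w (Z w)"
    and "s2 w (cov_deriv G Z w X) = frechet_derivative (\<lambda>w. s2 w (Z w)) (at w) X - \<omega> w X * s1 w (Z w)"
proof -
  note D = smooth_on_has_derivative[OF _ open_S assms(1)]
  have Zi: "((\<lambda>w. Z w $ i) has_derivative (\<lambda>v. frechet_derivative Z (at w) v $ i)) (at w)" for i
    using bounded_linear.has_derivative[OF bounded_linear_vec_nth D[OF Z]] .
  have "frechet_derivative (\<lambda>w. s1 w (Z w)) (at w) = (\<lambda>X. s1 w (frechet_derivative Z (at w) X)
      + (frechet_derivative a (at w) X * Z w$1 + frechet_derivative b (at w) X * Z w$2))"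
    unfolding s1_def
    by (rule frechet_derivative_eqI, (rule derivative_eq_intros refl D[OF smooth_a] D[OF smooth_b] Zi)+)
      (simp add: fun_eq_iff algebra_simps)
  then show "s1 w (cov_deriv G Z w X) = frechet_derivative (\<lambda>w. s1 w (Z w)) (at w) X + \<omega> w X * s2 w (Z w)"
    using christoffel_coframe(1)[OF assms(1), of X "Z w"]
    by (simp add: cov_deriv_def) (simp add: s1_def algebra_simps)
  have "frechet_derivative (\<lambda>w. s2 w (Z w)) (at w) = (\<lambda>X. s2 w (frechet_derivative Z (at w) X)
      + frechet_derivative d (at w) X * Z w$2)"
    unfolding s2_def
    by (rule frechet_derivative_eqI) (rule derivative_eq_intros refl D[OF smooth_d] Zi)+
  then show "s2 w (cov_deriv G Z w X) = frechet_derivative (\<lambda>w. s2 w (Z w)) (at w) X - \<omega> w X * s1 w (Z w)"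
    using christoffel_coframe(2)[OF assms(1), of X "Z w"]
    by (simp add: cov_deriv_def) (simp add: s2_def algebra_simps)
qed

end

context plane_coframe
begin

text \<open>Rotations of the plane commute, so in the commutator of two covariant derivatives only the exterior
  derivative \<open>d\<omega>\<close> survives.\<close>

lemma curvature_coframe:
  assumes u: "u \<in> S"
  shows "ip (G u) (curvature G u (axis 1 1) (axis 2 1) (axis 2 1)) (axis 1 1)
    = a u * d u * (frechet_derivative q (at u) (axis 1 1) - frechet_derivative p (at u) (axis 2 1))"
proof -
  let ?e1 = "axis 1 1 :: real^2" and ?e2 = "axis 2 1 :: real^2"
  let ?D = "\<lambda>f X w. frechet_derivative f (at w) X"
  define W where "W Y w = cov_deriv G (\<lambda>_. ?e2) w Y" for Y w
  have e: "?e1 $ 1 = 1" "?e1 $ 2 = 0" "?e2 $ 1 = 0" "?e2 $ 2 = 1" by (simp_all add: axis_def)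
  have s1W: "s1 w (W Y w) = ?D b Y w + \<omega> w Y * d w"
    and s2W: "s2 w (W Y w) = ?D d Y w - \<omega> w Y * b w" if "w \<in> S" for w Y
    using christoffel_coframe[OF that, of Y ?e2] by (simp_all add: W_def cov_deriv_def e s1_def s2_def)
  have sW: "smooth_on (W Y) S" for Y
  proof -
    have 0: "smooth_on (\<lambda>w. \<omega> w Y) S" unfolding \<omega>_def
      by (intro smooth_intros smooth_p smooth_q open_S)
    have 2: "smooth_on (\<lambda>w. (?D d Y w - \<omega> w Y * b w) / d w) S"
      by (intro smooth_intros smooth_b smooth_d 0 d_pos open_S)
    have 1: "smooth_on (\<lambda>w. (?D b Y w + \<omega> w Y * d w - b w * ((?D d Y w - \<omega> w Y * b w) / d w)) / a w) S"
      by (rule smooth_on_divide[OF open_S _ smooth_a a_pos])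
        (intro smooth_intros smooth_b smooth_d 0 2 open_S)
    have W2: "W Y w $ 2 = (?D d Y w - \<omega> w Y * b w) / d w" if "w \<in> S" for w
      using s2W[OF that, of Y] d_pos[OF that] by (simp add: s2_def field_simps)
    have "W Y w $ 1 = (?D b Y w + \<omega> w Y * d w - b w * W Y w $ 2) / a w" if "w \<in> S" for w
      using s1W[OF that, of Y] a_pos[OF that] by (simp add: s1_def field_simps)
    with W2 have "W Y w $ 2 = (?D d Y w - \<omega> w Y * b w) / d w"
      "W Y w $ 1 = (?D b Y w + \<omega> w Y * d w - b w * ((?D d Y w - \<omega> w Y * b w) / d w)) / a w" if "w \<in> S" for w
      using that by simp_all
    then have "smooth_on (\<lambda>w. W Y w $ i) S" for i
      using smooth_on_cong[OF open_S _ 1, of "\<lambda>w. W Y w $ 1"] smooth_on_cong[OF open_S _ 2, of "\<lambda>w. W Y w $ 2"]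
        exhaust_2[of i] by force
    then show ?thesis by (rule smooth_on_vec_lambda[OF open_S])
  qed
  note D = smooth_on_has_derivative[OF _ open_S u]
  have DW: "frechet_derivative (\<lambda>w. s1 w (W Y w)) (at u) X
      = ?D (?D b Y) X u + (?D p X u * Y$1 + ?D q X u * Y$2) * d u + \<omega> u Y * ?D d X u" for X Y
  proof -
    have "frechet_derivative (\<lambda>w. s1 w (W Y w)) (at u)
        = frechet_derivative (\<lambda>w. ?D b Y w + (p w * Y$1 + q w * Y$2) * d w) (at u)"
      by (rule frechet_derivative_cong_open[OF open_S u]) (simp add: s1W \<omega>_def)
    also have "\<dots> = (\<lambda>X. ?D (?D b Y) X u + (?D p X u * Y$1 + ?D q X u * Y$2) * d u + \<omega> u Y * ?D d X u)"
      by (rule frechet_derivative_eqI, (rule derivative_eq_intros refl D[OF smooth_on_derivative[OF smooth_b]]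
            D[OF smooth_p] D[OF smooth_q] D[OF smooth_d])+) (simp add: fun_eq_iff \<omega>_def algebra_simps)
    finally show ?thesis by simp
  qed
  have R: "curvature G u ?e1 ?e2 ?e2 = cov_deriv G (W ?e2) u ?e1 - cov_deriv G (W ?e1) u ?e2"
    by (simp add: curvature_def W_def[abs_def])
  have "ip (G u) (curvature G u ?e1 ?e2 ?e2) ?e1
      = a u * (s1 u (cov_deriv G (W ?e2) u ?e1) - s1 u (cov_deriv G (W ?e1) u ?e2))"
    unfolding R by (simp add: G_eq[OF u] e s1_def algebra_simps)
  also have "\<dots> = a u * d u * (?D q ?e1 u - ?D p ?e2 u)"
    unfolding cov_deriv_coframe(1)[OF u sW] DW s2W[OF u] \<omega>_def e
    using second_derivative_symmetric[OF open_S smooth_b u, of ?e1 ?e2]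
    by (simp add: algebra_simps)
  finally show ?thesis .
qed

text \<open>Vanishing curvature makes \<open>\<omega>\<close> closed, say \<open>\<omega> = d\<theta>\<close>. The coframe turned by the angle \<open>\<theta>\<close> consists of closed forms,
  and their potentials are the two coordinates: their differentials are an orthonormal coframe, so the map is
  isometric, and a rotation preserves the orientation.\<close>

lemma flat_coordinates:
  assumes "convex S" and flat: "\<And>u. u \<in> S \<Longrightarrow> sectional_curvature G u (axis 1 1) (axis 2 1) = 0"
  obtains f where "smooth_on f S"
    "\<And>u X Y. u \<in> S \<Longrightarrow> frechet_derivative f (at u) X \<bullet> frechet_derivative f (at u) Y = ip (G u) X Y"
    "\<And>u. u \<in> S \<Longrightarrow> 0 < det (matrix (frechet_derivative f (at u)))"
proof -
  let ?e1 = "axis 1 1 :: real^2" and ?e2 = "axis 2 1 :: real^2"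
  let ?D = "\<lambda>f X w. frechet_derivative f (at w) X"
  have "?D p ?e2 u = ?D q ?e1 u" if u: "u \<in> S" for u
  proof -
    have "0 < a u * d u" using a_pos d_pos u by simp
    moreover have "ip (G u) ?e1 ?e1 * ip (G u) ?e2 ?e2 - (ip (G u) ?e1 ?e2)\<^sup>2 = (a u * d u)\<^sup>2"
      by (simp add: G_eq[OF u] axis_def power2_eq_square algebra_simps)
    ultimately have "ip (G u) (curvature G u ?e1 ?e2 ?e2) ?e1 = 0"
      using flat[OF u] by (auto simp: sectional_curvature_def)
    then show ?thesis using curvature_coframe[OF u] \<open>0 < a u * d u\<close> by auto
  qed
  then obtain \<theta> where \<theta>: "\<And>u. u \<in> S \<Longrightarrow> (\<theta> has_derivative (\<lambda>v. p u * v$1 + q u * v$2)) (at u)"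
    and s\<theta>: "smooth_on \<theta> S"
    using closed_form_potential[OF open_S assms(1) smooth_p smooth_q] by blast
  \<comment> \<open>The rotated coframe is \<open>P1 dx + Q1 dy\<close>, \<open>P2 dx + Q2 dy\<close>.\<close>
  define P1 where "P1 w = cos (\<theta> w) * a w" for w
  define Q1 where "Q1 w = cos (\<theta> w) * b w + sin (\<theta> w) * d w" for w
  define P2 where "P2 w = - sin (\<theta> w) * a w" for w
  define Q2 where "Q2 w = - sin (\<theta> w) * b w + cos (\<theta> w) * d w" for w
  note s = smooth_intros smooth_a smooth_b smooth_d s\<theta> open_S
  have sm: "smooth_on P1 S" "smooth_on Q1 S" "smooth_on P2 S" "smooth_on Q2 S"
    unfolding P1_def[abs_def] Q1_def[abs_def] P2_def[abs_def] Q2_def[abs_def] by (intro s)+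
  have cl: "?D P1 ?e2 u = ?D Q1 ?e1 u" "?D P2 ?e2 u = ?D Q2 ?e1 u" if u: "u \<in> S" for u
  proof -
    note D = smooth_on_has_derivative[OF _ open_S u]
    have ad: "a u \<noteq> 0" "d u \<noteq> 0" using a_pos d_pos u by force+
    have b1: "?D b ?e1 u = ?D a ?e2 u - p u * d u" using ad by (simp add: p_def)
    have d1: "?D d ?e1 u = p u * b u - q u * a u" using ad by (simp add: q_def)
    have e: "?e1 $ 1 = 1" "?e1 $ 2 = 0" "?e2 $ 1 = 0" "?e2 $ 2 = 1" by (simp_all add: axis_def)
    have DP1: "?D P1 V u = - sin (\<theta> u) * (p u * V$1 + q u * V$2) * a u + cos (\<theta> u) * ?D a V u" for V
      unfolding P1_def[abs_def]
      by (rule fun_cong[OF frechet_derivative_eqI], (rule derivative_eq_intros refl D[OF smooth_a] \<theta>[OF u])+)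
        (simp add: fun_eq_iff algebra_simps)
    have DP2: "?D P2 V u = - cos (\<theta> u) * (p u * V$1 + q u * V$2) * a u - sin (\<theta> u) * ?D a V u" for V
      unfolding P2_def[abs_def]
      by (rule fun_cong[OF frechet_derivative_eqI], (rule derivative_eq_intros refl D[OF smooth_a] \<theta>[OF u])+)
        (simp add: fun_eq_iff algebra_simps)
    have DQ1: "?D Q1 V u = (p u * V$1 + q u * V$2) * (- sin (\<theta> u) * b u + cos (\<theta> u) * d u)
        + cos (\<theta> u) * ?D b V u + sin (\<theta> u) * ?D d V u" for V
      unfolding Q1_def[abs_def]
      by (rule fun_cong[OF frechet_derivative_eqI], (rule derivative_eq_intros refl D[OF smooth_b] D[OF smooth_d] \<theta>[OF u])+)
        (simp add: fun_eq_iff algebra_simps)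
    have DQ2: "?D Q2 V u = (p u * V$1 + q u * V$2) * (- cos (\<theta> u) * b u - sin (\<theta> u) * d u)
        - sin (\<theta> u) * ?D b V u + cos (\<theta> u) * ?D d V u" for V
      unfolding Q2_def[abs_def]
      by (rule fun_cong[OF frechet_derivative_eqI], (rule derivative_eq_intros refl D[OF smooth_b] D[OF smooth_d] \<theta>[OF u])+)
        (simp add: fun_eq_iff algebra_simps)
    show "?D P1 ?e2 u = ?D Q1 ?e1 u" "?D P2 ?e2 u = ?D Q2 ?e1 u"
      unfolding DP1 DQ1 DP2 DQ2 by (simp_all add: e b1 d1 algebra_simps)
  qed
  obtain f1 where f1: "\<And>u. u \<in> S \<Longrightarrow> (f1 has_derivative (\<lambda>v. P1 u * v$1 + Q1 u * v$2)) (at u)" "smooth_on f1 S"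
    using closed_form_potential[OF open_S assms(1) sm(1,2) cl(1)] by blast
  obtain f2 where f2: "\<And>u. u \<in> S \<Longrightarrow> (f2 has_derivative (\<lambda>v. P2 u * v$1 + Q2 u * v$2)) (at u)" "smooth_on f2 S"
    using closed_form_potential[OF open_S assms(1) sm(3,4) cl(2)] by blast
  define f where "f u = (vector [f1 u, f2 u] :: real^2)" for u
  have sf: "smooth_on f S"
  proof (rule smooth_on_vec_lambda[OF open_S])
    fix i :: 2
    show "smooth_on (\<lambda>u. f u $ i) S" using exhaust_2[of i] f1(2) f2(2) by (auto simp: f_def)
  qed
  have Df: "?D f v u = vector [P1 u * v$1 + Q1 u * v$2, P2 u * v$1 + Q2 u * v$2]" if u: "u \<in> S" for u v
  proof (rule fun_cong[OF frechet_derivative_eqI], rule has_derivative_vec_nthI)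
    fix i :: 2
    show "((\<lambda>u. f u $ i) has_derivative
        (\<lambda>v. vector [P1 u * v$1 + Q1 u * v$2, P2 u * v$1 + Q2 u * v$2] $ i)) (at u)"
      using exhaust_2[of i] f1(1)[OF u] f2(1)[OF u] by (auto simp: f_def)
  qed
  have cs: "cos t * cos t + sin t * sin t = 1" for t :: real
    by (simp flip: power2_eq_square)
  show thesis
  proof (rule that[OF sf])
    fix u X Y assume u: "u \<in> S"
    have "?D f X u \<bullet> ?D f Y u = (cos (\<theta> u) * cos (\<theta> u) + sin (\<theta> u) * sin (\<theta> u)) * ip (G u) X Y"
      unfolding G_eq[OF u] Df[OF u] P1_def P2_def Q1_def Q2_def inner_vec_def sum_2 vector_2 inner_real_def
      by algebra
    then show "?D f X u \<bullet> ?D f Y u = ip (G u) X Y" by (simp add: cs)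
  next
    fix u assume u: "u \<in> S"
    have "det (matrix (frechet_derivative f (at u))) = P1 u * Q2 u - Q1 u * P2 u"
      by (simp add: det_2 matrix_def Df[OF u] axis_def)
    also have "\<dots> = (cos (\<theta> u) * cos (\<theta> u) + sin (\<theta> u) * sin (\<theta> u)) * (a u * d u)"
      unfolding P1_def P2_def Q1_def Q2_def by algebra
    also have "\<dots> > 0" using a_pos[OF u] d_pos[OF u] by (simp add: cs)
    finally show "0 < det (matrix (frechet_derivative f (at u)))" .
  qed
qed

end

lemma ip_2: "ip g X Y = X$1 * (g$1$1 * Y$1 + g$1$2 * Y$2) + X$2 * (g$2$1 * Y$1 + g$2$2 * Y$2)"
  for g :: "real^2^2"
  by (simp add: ip_def inner_vec_def matrix_vector_mult_def sum_2)

text \<open>Orthogonalising the coordinate frame yields the coframe that the computation above starts from. The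
  vector \<open>Z\<close> below is, up to scaling, the second vector of the orthogonalised frame; its squared length is
  \<open>a\<^sup>2\<close> times the radicand of \<open>d\<close>, which is therefore positive.\<close>

theorem flat_metric_coordinates:
  fixes G :: "real^2 \<Rightarrow> real^2^2"
  assumes S: "open S" "convex S" and G: "smooth_on G S" "\<And>w. w \<in> S \<Longrightarrow> inner_product (G w)"
    and flat: "\<And>u. u \<in> S \<Longrightarrow> sectional_curvature G u (axis 1 1) (axis 2 1) = 0"
  obtains f where "smooth_on f S"
    "\<And>u X Y. u \<in> S \<Longrightarrow> frechet_derivative f (at u) X \<bullet> frechet_derivative f (at u) Y = ip (G u) X Y"
    "\<And>u. u \<in> S \<Longrightarrow> 0 < det (matrix (frechet_derivative f (at u)))"
proof -
  define a where "a w = sqrt (G w $ 1 $ 1)" for w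
  define b where "b w = G w $ 1 $ 2 / a w" for w
  define d where "d w = sqrt (G w $ 2 $ 2 - b w * b w)" for w
  have G11: "0 < G w $ 1 $ 1" if "w \<in> S" for w
  proof -
    have "(axis 1 1 :: real^2) \<noteq> 0" by simp
    then have "0 < ip (G w) (axis 1 1) (axis 1 1)" using G(2)[OF that] by blast
    then show ?thesis by (simp add: ip_2 axis_def)
  qed
  have a: "0 < a w" "a w * a w = G w $ 1 $ 1" if "w \<in> S" for w using G11[OF that] by (simp_all add: a_def)
  have ab: "a w * b w = G w $ 1 $ 2" if "w \<in> S" for w using a(1)[OF that] by (simp add: b_def)
  have G21: "G w $ 2 $ 1 = G w $ 1 $ 2" if "w \<in> S" for w
  proof -
    have "transpose (G w) $ 2 $ 1 = G w $ 1 $ 2" by (simp add: transpose_def)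
    then show ?thesis using G(2)[OF that] by simp
  qed
  have d2: "0 < G w $ 2 $ 2 - b w * b w" if w: "w \<in> S" for w
  proof -
    define Z :: "real^2" where "Z = vector [- b w, a w]"
    have "Z \<noteq> 0" using a(1)[OF w] by (auto simp: Z_def vec_eq_iff forall_2)
    then have "0 < ip (G w) Z Z" using G(2)[OF w] by blast
    also have "ip (G w) Z Z = a w * a w * (G w $ 2 $ 2 - b w * b w)"
      by (simp add: ip_2 Z_def G21[OF w] flip: ab[OF w] a(2)[OF w]) (simp add: algebra_simps)
    finally show ?thesis using a(1)[OF w] by (simp add: zero_less_mult_iff)
  qed
  have d: "0 < d w" "d w * d w = G w $ 2 $ 2 - b w * b w" if "w \<in> S" for w
    using d2[OF that] by (simp_all add: d_def)
  have sg: "smooth_on (\<lambda>w. G w $ i $ j) S" for i j by (intro smooth_intros S G(1))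
  have sa: "smooth_on a S" unfolding a_def[abs_def] by (intro smooth_intros sg S G11)
  have sb: "smooth_on b S" unfolding b_def[abs_def] by (intro smooth_intros sg S sa a)
  have sd: "smooth_on d S" unfolding d_def[abs_def] by (intro smooth_on_sqrt smooth_on_diff smooth_on_mult sg S sb d2)
  interpret plane_coframe S G a b d
  proof
    fix w X Y :: "real^2" assume w: "w \<in> S"
    have "(a w * X$1 + b w * X$2) * (a w * Y$1 + b w * Y$2) + (d w * X$2) * (d w * Y$2)
      = (a w * a w) * X$1 * Y$1 + (a w * b w) * (X$1 * Y$2 + X$2 * Y$1) + (b w * b w + d w * d w) * X$2 * Y$2"
      by (simp add: algebra_simps)
    then show "ip (G w) X Y = (a w * X$1 + b w * X$2) * (a w * Y$1 + b w * Y$2) + (d w * X$2) * (d w * Y$2)"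
      by (simp add: ip_2 a(2)[OF w] ab[OF w] d(2)[OF w] G21[OF w] algebra_simps)
  qed (use S G sa sb sd a d in auto)
  show thesis using flat_coordinates[OF S(2) flat] that by blast
qed

section \<open>Horospheres\<close>

text \<open>On the slice \<open>z = 0\<close> the ambient metric is Euclidean, so the tangential part of the second fundamental form
  vanishes as for isometric maps between planes. Of the Christoffel symbols of the ambient space only the
  \<open>z\<close>-component \<open>k (X\<^sub>1 Y\<^sub>1 + X\<^sub>2 Y\<^sub>2)\<close> is seen by vectors tangent to the slice; it is \<open>k\<close> times the
  induced metric. The minor of \<open>DF\<close> being positive selects the upward normal, and thereby the sign of
  the shape operator.\<close>

lemma second_ff_horosphere:
  fixes G :: "real^2 \<Rightarrow> real^2^2" and F :: "real^2 \<Rightarrow> real^3"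
  assumes S: "open S" "u \<in> S" and F: "smooth_on F S" and G: "smooth_on G S" "inner_product (G u)"
    and height: "\<And>w. w \<in> S \<Longrightarrow> F w $ 3 = 0"
    and iso: "\<And>w X Y. w \<in> S \<Longrightarrow>
      ip (G w) X Y = frechet_derivative F (at w) X \<bullet> frechet_derivative F (at w) Y"
    and orientation: "0 < frechet_derivative F (at u) (axis 1 1) $ 1 * frechet_derivative F (at u) (axis 2 1) $ 2
      - frechet_derivative F (at u) (axis 1 1) $ 2 * frechet_derivative F (at u) (axis 2 1) $ 1"
  shows "second_ff G (horo_metric k) F u X Y = ip (G u) X Y *\<^sub>R k *\<^sub>R axis 3 1"
    and "unit_normal (horo_metric k) F u = axis 3 1"
proof -
  let ?D = "\<lambda>X w. frechet_derivative F (at w) X"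
  have D3: "?D X w $ 3 = 0" if "w \<in> S" for X w
    by (rule derivative_vanishing_component[OF S(1) F height that])
  have DD3: "frechet_derivative (?D Y) (at u) X $ 3 = 0" for X Y
    by (rule derivative_vanishing_component[OF S(1) smooth_on_derivative[OF F] D3 S(2)])
  have perp: "v $ 1 = 0 \<and> v $ 2 = 0"
    if "\<And>Z. ?D Z u $ 1 * v $ 1 + ?D Z u $ 2 * v $ 2 = 0" for v :: "real^3"
  proof -
    let ?m = "?D (axis 1 1) u $ 1 * ?D (axis 2 1) u $ 2 - ?D (axis 1 1) u $ 2 * ?D (axis 2 1) u $ 1"
    have "?m * v $ 1 = 0" "?m * v $ 2 = 0"
      using that[of "axis 1 1"] that[of "axis 2 1"] by algebra+
    then show ?thesis using orientation by auto
  qed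
  note DG = smooth_on_has_derivative[OF G(1) S]
  define T where "T = frechet_derivative (?D Y) (at u) X - ?D (christoffel G u X Y) u"
  have "T $ 3 = 0" using DD3 D3[OF S(2)] by (simp add: T_def)
  moreover have "T $ 1 = 0 \<and> T $ 2 = 0"
  proof (rule perp)
    fix Z
    have "T \<bullet> ?D Z u = 0"
      using euclidean_isometry_tangential[OF S F G(2) DG iso] by (simp add: T_def inner_diff_left)
    then show "?D Z u $ 1 * T $ 1 + ?D Z u $ 2 * T $ 2 = 0"
      using D3[OF S(2)] by (simp add: inner_vec_def sum_3 mult.commute)
  qed
  ultimately have "T = 0" by (simp add: vec_eq_iff forall_3)
  have "second_ff G (horo_metric k) F u X Y = T + christoffel (horo_metric k) (F u) (?D X u) (?D Y u)"
    by (simp add: second_ff_def T_def)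
  also have "\<dots> = (?D X u \<bullet> ?D Y u) *\<^sub>R k *\<^sub>R axis 3 1"
    using D3[OF S(2)] height[OF S(2)]
    by (simp add: \<open>T = 0\<close> christoffel_horo_metric vec_eq_iff forall_3 inner_vec_def sum_3 axis_def)
  finally show "second_ff G (horo_metric k) F u X Y = ip (G u) X Y *\<^sub>R k *\<^sub>R axis 3 1"
    by (simp add: iso[OF S(2)])
  have h: "ip (horo_metric k (F u)) A B = A$1 * B$1 + A$2 * B$2 + A$3 * B$3" for A B
    using height[OF S(2)] by (simp add: ip_horo_metric)
  have det: "det (vector [?D (axis 1 1) u, ?D (axis 2 1) u, \<nu>] :: real^3^3)
      = (?D (axis 1 1) u $ 1 * ?D (axis 2 1) u $ 2 - ?D (axis 1 1) u $ 2 * ?D (axis 2 1) u $ 1) * \<nu> $ 3" for \<nu>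
    using D3[OF S(2)] by (simp add: det_3 algebra_simps)
  show "unit_normal (horo_metric k) F u = axis 3 1"
    unfolding unit_normal_def h det
  proof (rule the_equality)
    fix \<nu> :: "real^3"
    assume \<nu>: "\<nu>$1 * \<nu>$1 + \<nu>$2 * \<nu>$2 + \<nu>$3 * \<nu>$3 = 1
      \<and> (\<forall>X. ?D X u $ 1 * \<nu>$1 + ?D X u $ 2 * \<nu>$2 + ?D X u $ 3 * \<nu>$3 = 0)
      \<and> 0 < (?D (axis 1 1) u $ 1 * ?D (axis 2 1) u $ 2 - ?D (axis 1 1) u $ 2 * ?D (axis 2 1) u $ 1) * \<nu>$3"
    then have 12: "\<nu> $ 1 = 0 \<and> \<nu> $ 2 = 0" using D3[OF S(2)] by (intro perp) simp
    have "\<nu> $ 3 > 0" using \<nu> orientation by (simp add: zero_less_mult_iff)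
    moreover have "(\<nu> $ 3)\<^sup>2 = 1" using \<nu> 12 by (simp add: power2_eq_square)
    ultimately have "\<nu> $ 3 = 1" by (simp add: power2_eq_1_iff)
    then show "\<nu> = axis 3 1" using 12 by (simp add: vec_eq_iff forall_3 axis_def)
  qed (use D3[OF S(2)] orientation in \<open>simp add: axis_def\<close>)
qed

lemma vec_lambda_ip:
  assumes "transpose g = g"
  shows "(\<chi> j. ip g X (axis j 1)) = g *v X"
proof -
  have "ip g X (axis j 1) = (g *v X) $ j" for j
    using ip_commute[OF assms, of X "axis j 1"] by (simp add: ip_def inner_axis')
  then show ?thesis by (simp add: vec_eq_iff)
qed

lemma umbilic_shape:
  fixes G :: "real^2 \<Rightarrow> real^2^2"
  assumes "inner_product (G u)"
    and "\<And>X Y. second_ff G (horo_metric k) F u X Y = ip (G u) X Y *\<^sub>R k *\<^sub>R axis 3 1"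
    and "unit_normal (horo_metric k) F u = axis 3 1"
  shows "shape_normal G (horo_metric k) F u X = k *\<^sub>R X"
    and "0 \<le> k \<Longrightarrow> mean_curvature_norm G (horo_metric k) F u = k"
proof -
  have "(\<chi> j. ip (horo_metric k (F u)) (ip (G u) X (axis j 1) *\<^sub>R k *\<^sub>R axis 3 1) (axis 3 1))
      = k *\<^sub>R (\<chi> j. ip (G u) X (axis j 1))"
    by (simp add: vec_eq_iff ip_horo_metric axis_def)
  then show "shape_normal G (horo_metric k) F u X = k *\<^sub>R X"
    using vec_lambda_ip[of "G u" X] assms(1)
    by (simp add: shape_normal_def shape_operator_def assms(2,3) matrix_vector_mult_scaleR matrix_inv_inner_product)
  have "second_ff G (horo_metric k) F u = (\<lambda>X Y. ip (G u) X Y *\<^sub>R k *\<^sub>R axis 3 1)"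
    by (intro ext assms(2))
  then have "mean_curvature G (horo_metric k) F u = k *\<^sub>R axis 3 1"
    using metric_trace_ip[OF assms(1), of "k *\<^sub>R axis 3 1 :: real^3"] by (simp add: mean_curvature_def)
  then show "mean_curvature_norm G (horo_metric k) F u = k" if "0 \<le> k"
    using that by (simp add: mean_curvature_norm_def ip_horo_metric axis_def)
qed


section \<open>A double principal curvature\<close>

lemma second_ff_bilinear:
  fixes G :: "real^'k \<Rightarrow> real^'k^'k" and F :: "real^'k \<Rightarrow> real^'d"
  assumes S: "open S" "u \<in> S" and T: "open T" "F u \<in> T" and F: "smooth_on F S"
    and G: "smooth_on G S" "\<And>w. w \<in> S \<Longrightarrow> inner_product (G w)"
    and Gt: "smooth_on Gt T" "\<And>y. y \<in> T \<Longrightarrow> inner_product (Gt y)"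
  shows "linear (\<lambda>X. second_ff G Gt F u X Y)" "second_ff G Gt F u X Y = second_ff G Gt F u Y X"
proof -
  note DG = smooth_on_has_derivative[OF G(1) S] and DGt = smooth_on_has_derivative[OF Gt(1) T]
  have DF: "linear (frechet_derivative F (at u))"
    using smooth_on_has_derivative[OF F S] has_derivative_linear by blast
  have DDF: "linear (frechet_derivative (\<lambda>w. frechet_derivative F (at w) Y) (at u))"
    using smooth_on_has_derivative[OF smooth_on_derivative[OF F] S] has_derivative_linear by blast
  have 1: "linear (\<lambda>X. christoffel Gt (F u) (frechet_derivative F (at u) X) (frechet_derivative F (at u) Y))"
    using linear_compose[OF DF christoffel_linear(1)[OF DGt Gt(2)[OF T(2)]]] by (simp add: o_def)
  have 2: "linear (\<lambda>X. frechet_derivative F (at u) (christoffel G u X Y))"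
    using linear_compose[OF christoffel_linear(1)[OF DG G(2)[OF S(2)]] DF] by (simp add: o_def)
  show "linear (\<lambda>X. second_ff G Gt F u X Y)"
    unfolding second_ff_def by (intro linear_compose_add linear_compose_sub DDF 1 2)
  show "second_ff G Gt F u X Y = second_ff G Gt F u Y X"
    unfolding second_ff_def
    using second_derivative_symmetric[OF S(1) F S(2), of Y X]
      christoffel_commute[OF S G(2) DG, of X Y]
      christoffel_commute[OF T Gt(2) DGt, of "frechet_derivative F (at u) X" "frechet_derivative F (at u) Y"]
    by simp
qed

lemma plane_perp:
  fixes V Z :: "real^2"
  assumes "V \<noteq> 0" "Z \<bullet> V = 0"
  obtains \<mu> where "Z = \<mu> *\<^sub>R vector [- V$2, V$1]"
proof -
  let ?n = "V$1 * V$1 + V$2 * V$2"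
  have n: "?n > 0" using assms(1) by (simp add: vec_eq_iff forall_2 sum_squares_gt_zero_iff)
  have z: "Z$1 * V$1 + Z$2 * V$2 = 0" using assms(2) by (simp add: inner_vec_def sum_2)
  define \<mu> where "\<mu> = (Z$2 * V$1 - Z$1 * V$2) / ?n"
  have \<mu>: "?n * \<mu> = Z$2 * V$1 - Z$1 * V$2" using n by (simp add: \<mu>_def)
  have "?n * Z$1 = ?n * (\<mu> * (- V$2))" "?n * Z$2 = ?n * (\<mu> * V$1)"
    using z \<mu> by algebra+
  then have "Z$1 = \<mu> * (- V$2) \<and> Z$2 = \<mu> * V$1"
    unfolding mult_left_cancel[OF n[THEN less_imp_neq, symmetric]] by simp
  then have "Z = \<mu> *\<^sub>R vector [- V$2, V$1]"
    by (simp add: vec_eq_iff forall_2)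
  then show thesis using that by blast
qed

text \<open>The orthogonal complement of an eigenvector is invariant and, in dimension two, spanned by a second
  eigenvector; its eigenvalue is \<open>l\<close> again.\<close>

lemma self_adjoint_double_eigenvalue:
  fixes A :: "real^2 \<Rightarrow> real^2"
  assumes g: "inner_product g" and A: "linear A" and sa: "\<And>X Y. ip g (A X) Y = ip g X (A Y)"
    and eig: "{t. \<exists>X. X \<noteq> 0 \<and> A X = t *\<^sub>R X} = {l}"
  shows "A X = l *\<^sub>R X"
proof -
  obtain X0 where X0: "X0 \<noteq> 0" "A X0 = l *\<^sub>R X0" using eig by blast
  define V where "V = g *v X0"
  \<comment> \<open>The quarter turn of \<open>g X0\<close> is \<open>g\<close>-orthogonal to \<open>X0\<close>.\<close>
  define Y0 :: "real^2" where "Y0 = vector [- V$2, V$1]"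
  have ipV: "ip g Z X0 = Z \<bullet> V" for Z by (simp add: ip_def V_def)
  have pos: "0 < ip g X0 X0" using g X0(1) by blast
  then have V: "V \<noteq> 0" using ipV[of X0] by auto
  have Y0: "Y0 \<noteq> 0" "Y0 \<bullet> V = 0"
    using V by (auto simp: Y0_def vec_eq_iff forall_2 inner_vec_def sum_2)
  have "A Y0 \<bullet> V = 0"
    using sa[of Y0 X0] Y0(2) by (simp add: X0(2) ip_simps flip: ipV)
  then obtain \<mu> where \<mu>: "A Y0 = \<mu> *\<^sub>R Y0" using plane_perp[OF V] unfolding Y0_def by metis
  have "\<mu> \<in> {l}" unfolding eig[symmetric] using Y0(1) \<mu> by blast
  then have AY0: "A Y0 = l *\<^sub>R Y0" using \<mu> by simp
  define c where "c = ip g X X0 / ip g X0 X0"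
  have "(X - c *\<^sub>R X0) \<bullet> V = 0" using pos by (simp add: c_def ip_simps flip: ipV)
  then obtain r where "X - c *\<^sub>R X0 = r *\<^sub>R Y0" using plane_perp[OF V] unfolding Y0_def by metis
  then have X: "X = c *\<^sub>R X0 + r *\<^sub>R Y0" by (simp add: algebra_simps)
  have "A (c *\<^sub>R X0 + r *\<^sub>R Y0) = l *\<^sub>R (c *\<^sub>R X0 + r *\<^sub>R Y0)"
    by (simp add: linear_add[OF A] linear_cmul[OF A] X0(2) AY0 scaleR_add_right mult.commute)
  then show ?thesis unfolding X[symmetric] .
qed

text \<open>The trace of \<open>A\<^sub>H\<close> is \<open>\<langle>trace B, H\<rangle> = 2 \<bar>H\<bar>\<^sup>2\<close>, while \<open>A\<^sub>H = l I\<close> has trace \<open>2 l\<close>. Hence \<open>l = \<bar>H\<bar>\<^sup>2\<close>, and the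
  stress-bienergy tensor \<open>-2 \<bar>H\<bar>\<^sup>2 I + 4 A\<^sub>H\<close> is \<open>2 l I\<close>.\<close>

lemma double_principal_curvature:
  fixes G :: "real^2 \<Rightarrow> real^2^2" and F :: "real^2 \<Rightarrow> real^'d"
  assumes S: "open S" "u \<in> S" and T: "open T" "F u \<in> T" and F: "smooth_on F S"
    and G: "smooth_on G S" "\<And>w. w \<in> S \<Longrightarrow> inner_product (G w)"
    and Gt: "smooth_on Gt T" "\<And>y. y \<in> T \<Longrightarrow> inner_product (Gt y)"
    and eig: "{t. \<exists>X. X \<noteq> 0 \<and> shape_H G Gt F u X = t *\<^sub>R X} = {l}"
  shows "shape_H G Gt F u X = l *\<^sub>R X" "0 \<le> l" "mean_curvature_norm G Gt F u = sqrt l"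
    "stress_bienergy G Gt F u X = (2 * l) *\<^sub>R X"
proof -
  have B: "linear (\<lambda>X. second_ff G Gt F u X Y)" "second_ff G Gt F u X Y = second_ff G Gt F u Y X" for X Y
    by (rule second_ff_bilinear[OF S T F G Gt]; assumption)+
  note g = G(2)[OF S(2)] and gt = Gt(2)[OF T(2)]
  let ?B = "second_ff G Gt F u" and ?H = "mean_curvature G Gt F u" and ?A = "shape_H G Gt F u"
  have ipA: "ip (G u) (?A X) Y = ip (Gt (F u)) (?B X Y) ?H" for X Y
  proof -
    have "linear (\<lambda>Y. ?B X Y)" using B(1)[of X] unfolding B(2)[of X] .
    then have "linear (\<lambda>Y. ip (Gt (F u)) (?B X Y) ?H)"
      using linear_compose[OF _ ip_linear(1)] by (fastforce simp: o_def)
    from inner_vec_lambda_linear[OF this] show ?thesis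
      by (simp add: shape_H_def shape_operator_def ip_raise_index[OF g])
  qed
  have "linear ?A"
    by (intro linearI ip_cancel[OF g]) (simp_all add: ipA ip_simps linear_add[OF B(1)] linear_cmul[OF B(1)])
  moreover have "ip (G u) (?A X) Y = ip (G u) X (?A Y)" for X Y
    using ipA[of X Y] ipA[of Y X] B(2)[of X Y] ip_commute[of "G u" X "?A Y"] g by simp
  ultimately show A: "?A X = l *\<^sub>R X" for X
    using self_adjoint_double_eigenvalue[OF g _ _ eig] by blast
  have "ip (Gt (F u)) (metric_trace (G u) ?B) ?H = metric_trace (G u) (\<lambda>X Y. ip (Gt (F u)) (?B X Y) ?H)"
    by (simp add: metric_trace_def linear_sum[OF ip_linear(1)] ip_simps)
  also have "\<dots> = metric_trace (G u) (\<lambda>X Y. ip (G u) X Y *\<^sub>R l)"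
    by (simp add: ipA[symmetric] A ip_simps mult.commute)
  also have "\<dots> = 2 * l" using metric_trace_ip[OF g, of l] by simp
  finally have HH: "ip (Gt (F u)) ?H ?H = l"
    by (subst (1) mean_curvature_def) (simp add: ip_simps)
  show "0 \<le> l" using ip_nonneg[OF gt, of ?H] HH by simp
  show m: "mean_curvature_norm G Gt F u = sqrt l" by (simp add: mean_curvature_norm_def HH)
  show "stress_bienergy G Gt F u X = (2 * l) *\<^sub>R X"
  proof -
    have "stress_bienergy G Gt F u X = (- 2 * (sqrt l)\<^sup>2 + 4 * l) *\<^sub>R X"
      by (simp only: stress_bienergy_def m A scaleR_scaleR scaleR_add_left)
    then show ?thesis using \<open>0 \<le> l\<close> by simp
  qed
qed

section \<open>Charts and restriction to open subsets\<close>

lemma chart_facts: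
  assumes "oriented_atlas M" "a \<in> atlas M"
  shows "open (snd a ` fst a)" "openin (top_of_set (points M)) (fst a)"
    "homeomorphism (fst a) (snd a ` fst a) (snd a) (coord_inv a)"
    "fst a \<subseteq> points M" "inj_on (snd a) (fst a)"
    "q \<in> fst a \<Longrightarrow> coord_inv a (snd a q) = q"
proof -
  show "open (snd a ` fst a)" and 1: "openin (top_of_set (points M)) (fst a)"
    and 2: "homeomorphism (fst a) (snd a ` fst a) (snd a) (coord_inv a)"
    using assms unfolding oriented_atlas_def by blast+
  show "fst a \<subseteq> points M" using openin_imp_subset[OF 1] .
  show 3: "inj_on (snd a) (fst a)" using 2 unfolding homeomorphism_def by (metis inj_on_inverseI)
  show "q \<in> fst a \<Longrightarrow> coord_inv a (snd a q) = q" using 3 by simp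
qed

lemma chart_exists:
  assumes "oriented_atlas M" "q \<in> points M"
  obtains a where "a \<in> charts_at M q"
proof -
  have "\<Union> (fst ` atlas M) = points M" using assms(1) unfolding oriented_atlas_def by blast
  then show thesis using that assms(2) unfolding charts_at_def by blast
qed

lemma chart_image_open:
  assumes "oriented_atlas M" "a \<in> atlas M" "openin (top_of_set (points M)) W"
  shows "open (snd a ` (fst a \<inter> W))"
proof -
  note c = chart_facts[OF assms(1,2)]
  have "openin (top_of_set (fst a)) (fst a \<inter> W)"
  proof -
    obtain V where V: "open V" "W = points M \<inter> V" using assms(3) by (auto simp: openin_open)
    then have "fst a \<inter> W = fst a \<inter> V" using c(4) by blast
    then show ?thesis using V(1) by (auto simp: openin_open)
  qed
  then have "openin (top_of_set (snd a ` fst a)) (snd a ` (fst a \<inter> W))"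
    by (rule homeomorphism_imp_open_map[OF c(3)])
  then show ?thesis using c(1) openin_open_trans by blast
qed

lemma gram_chart:
  assumes "oriented_atlas M" "a \<in> atlas M" "q \<in> fst a"
  shows "gram M a (snd a q) = metric M (snd a) q"
  using chart_facts(6)[OF assms] by (simp add: gram_def)

lemma riemannian_metric_inner_product:
  assumes "riemannian_metric M" "a \<in> atlas M" "q \<in> fst a"
  shows "inner_product (metric M (snd a) q)"
  using assms(1)[unfolded riemannian_metric_def, THEN conjunct1] assms(2,3) by simp

lemma smooth_gram: "riemannian_metric M \<Longrightarrow> a \<in> atlas M \<Longrightarrow> smooth_on (gram M a) (snd a ` fst a)"
  unfolding riemannian_metric_def by simp

lemma riemannian_metric_transition:
  assumes "riemannian_metric M" "a \<in> atlas M" "b \<in> atlas M" "q \<in> fst a" "q \<in> fst b"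
  shows "ip (metric M (snd a) q) X Y = ip (metric M (snd b) q)
    (frechet_derivative (coord_map a b id) (at (snd a q)) X)
    (frechet_derivative (coord_map a b id) (at (snd a q)) Y)"
  by (rule assms(1)[unfolded riemannian_metric_def, THEN conjunct2, rule_format, OF assms(2,3) IntI[OF assms(4,5)]])

lemma gram_inner_product:
  assumes "oriented_atlas M" "riemannian_metric M" "a \<in> atlas M" "w \<in> snd a ` fst a"
  shows "inner_product (gram M a w)"
proof -
  obtain q where q: "q \<in> fst a" "w = snd a q" using assms(4) by blast
  show ?thesis
    unfolding q(2) gram_chart[OF assms(1,3) q(1)] by (rule riemannian_metric_inner_product[OF assms(2,3) q(1)])
qed

lemma restrict_simps:
  "fst (restrict_chart U a) = fst a \<inter> U" "snd (restrict_chart U a) = snd a"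
  "points (restrict_manifold M U) = points M \<inter> U"
  "atlas (restrict_manifold M U) = restrict_chart U ` atlas M"
  "metric (restrict_manifold M U) = metric M"
  "q \<in> U \<Longrightarrow> charts_at (restrict_manifold M U) q = restrict_chart U ` charts_at M q"
  by (auto simp: restrict_chart_def restrict_manifold_def charts_at_def)

text \<open>A restricted chart has another inverse function off its image, since \<^const>\<open>inv_into\<close> is arbitrary
  there. Derivatives at a point see only the open image, so nothing geometric changes.\<close>

lemma coord_inv_restrict:
  assumes "inj_on (snd a) (fst a)" "w \<in> snd a ` (fst a \<inter> U)"
  shows "coord_inv (restrict_chart U a) w = coord_inv a w"
proof -
  obtain q where q: "q \<in> fst a" "q \<in> U" "w = snd a q" using assms(2) by blast
  have "inj_on (snd a) (fst a \<inter> U)" using assms(1) inj_on_subset by blast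
  then have "inv_into (fst a \<inter> U) (snd a) w = q" using q by simp
  then show ?thesis using q assms(1) by (simp add: restrict_simps)
qed

lemma coord_map_restrict:
  assumes "inj_on (snd a) (fst a)" "w \<in> snd a ` (fst a \<inter> U)"
  shows "coord_map (restrict_chart U a) b f w = coord_map a b f w"
    "gram (restrict_manifold M U) (restrict_chart U a) w = gram M a w"
  using coord_inv_restrict[OF assms] by (simp_all add: coord_map_def gram_def restrict_simps)

lemma riemannian_manifold_restrict:
  fixes M :: "('m::{t2_space,second_countable_topology}, 'k::finite) riemannian"
  assumes M: "riemannian_manifold M" and U: "openin (top_of_set (points M)) U" "connected U" "U \<noteq> {}"
  shows "riemannian_manifold (restrict_manifold M U)"
proof -
  let ?M = "restrict_manifold M U"
  have at: "oriented_atlas M" and me: "riemannian_metric M" using M unfolding riemannian_manifold_def by blast+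
  have UM: "U \<subseteq> points M" using U(1) openin_imp_subset by blast
  then have pts: "points ?M = U" by (auto simp: restrict_simps)
  note c = chart_facts[OF at]
  have cm: "coord_map (restrict_chart U a) (restrict_chart U b) id w = coord_map a b id w"
    if "a \<in> atlas M" "w \<in> snd a ` (fst a \<inter> fst b \<inter> U)" for a b w
    using coord_map_restrict(1)[OF c(5)[OF that(1)], of w U b id] that(2)
    by (auto simp: coord_map_def restrict_simps)
  have op: "open (snd a ` (fst a \<inter> fst b \<inter> U))" if "a \<in> atlas M" "b \<in> atlas M" for a b
    using chart_image_open[OF at that(1) openin_Int[OF c(2)[OF that(2)] U(1)]] by (simp add: Int_assoc)
  have ball: "(\<forall>a\<in>restrict_chart U ` atlas M. P a) \<longleftrightarrow> (\<forall>a\<in>atlas M. P (restrict_chart U a))" for P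
    by blast
  have Int: "fst a \<inter> U \<inter> (fst b \<inter> U) = fst a \<inter> fst b \<inter> U" for a b :: "('m, 'k) chart" by blast
  have fd: "frechet_derivative (coord_map (restrict_chart U a) (restrict_chart U b) id) (at w)
      = frechet_derivative (coord_map a b id) (at w)"
    if "a \<in> atlas M" "b \<in> atlas M" "w \<in> snd a ` (fst a \<inter> fst b \<inter> U)" for a b w
    by (rule frechet_derivative_cong_open[OF op[OF that(1,2)] that(3)]) (rule cm[OF that(1)])
  have tr: "smooth_on (coord_map a b id) (snd a ` (fst a \<inter> fst b))"
    "\<forall>u\<in>snd a ` (fst a \<inter> fst b). 0 < det (matrix (frechet_derivative (coord_map a b id) (at u)))"
    if "a \<in> atlas M" "b \<in> atlas M" for a b
    using at that unfolding oriented_atlas_def by blast+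
  have "oriented_atlas ?M"
    unfolding oriented_atlas_def
  proof (intro conjI)
    have "\<Union> (fst ` atlas M) = points M" using at unfolding oriented_atlas_def by blast
    then show "\<Union> (fst ` atlas ?M) = points ?M" by (force simp: restrict_simps)
    show "\<forall>a\<in>atlas ?M. openin (top_of_set (points ?M)) (fst a) \<and> open (snd a ` fst a)
      \<and> homeomorphism (fst a) (snd a ` fst a) (snd a) (coord_inv a)"
      unfolding restrict_simps(4) ball
    proof (intro ballI conjI)
      fix a assume a: "a \<in> atlas M"
      show "openin (top_of_set (points ?M)) (fst (restrict_chart U a))"
        using c(2)[OF a] UM unfolding pts restrict_simps openin_open by blast
      show op: "open (snd (restrict_chart U a) ` fst (restrict_chart U a))"
        using chart_image_open[OF at a U(1)] by (simp add: restrict_simps)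
      have "homeomorphism (fst a \<inter> U) (snd a ` (fst a \<inter> U)) (snd a) (coord_inv a)"
        by (rule homeomorphism_of_subsets[OF c(3)[OF a]]) auto
      then show "homeomorphism (fst (restrict_chart U a)) (snd (restrict_chart U a) ` fst (restrict_chart U a))
          (snd (restrict_chart U a)) (coord_inv (restrict_chart U a))"
        unfolding restrict_simps
        by (rule homeomorphism_cong) (use coord_inv_restrict[OF c(5)[OF a], of _ U] in \<open>simp_all add: restrict_simps\<close>)
    qed
    show "\<forall>a\<in>atlas ?M. \<forall>b\<in>atlas ?M. smooth_on (coord_map a b id) (snd a ` (fst a \<inter> fst b))
      \<and> (\<forall>u\<in>snd a ` (fst a \<inter> fst b). 0 < det (matrix (frechet_derivative (coord_map a b id) (at u))))"
      unfolding restrict_simps(4) ball restrict_simps(1,2) Int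
    proof (intro ballI conjI)
      fix a b assume ab: "a \<in> atlas M" "b \<in> atlas M"
      show "smooth_on (coord_map (restrict_chart U a) (restrict_chart U b) id) (snd a ` (fst a \<inter> fst b \<inter> U))"
        by (rule smooth_on_cong[OF op[OF ab] cm[OF ab(1), symmetric]])
          (assumption, rule smooth_on_subset[OF tr(1)[OF ab]], blast)
      fix u assume u: "u \<in> snd a ` (fst a \<inter> fst b \<inter> U)"
      then show "0 < det (matrix (frechet_derivative (coord_map (restrict_chart U a) (restrict_chart U b) id) (at u)))"
        unfolding fd[OF ab u] using tr(2)[OF ab] by blast
    qed
  qed
  moreover have "riemannian_metric ?M"
    unfolding riemannian_metric_def restrict_simps(4,5) ball restrict_simps(1,2) Int
  proof (intro conjI ballI allI)
    fix a assume a: "a \<in> atlas M"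
    show "smooth_on (gram ?M (restrict_chart U a)) (snd a ` (fst a \<inter> U))"
      by (rule smooth_on_cong[OF chart_image_open[OF at a U(1)] coord_map_restrict(2)[OF c(5)[OF a], symmetric]])
        (assumption, rule smooth_on_subset[OF smooth_gram[OF me a]], blast)
    fix q assume "q \<in> fst a \<inter> U"
    then show "transpose (metric M (snd a) q) = metric M (snd a) q"
      "\<And>X. X \<noteq> 0 \<longrightarrow> 0 < ip (metric M (snd a) q) X X"
      using riemannian_metric_inner_product[OF me a] by simp_all
  next
    fix a b q X Y assume ab: "a \<in> atlas M" "b \<in> atlas M" and q: "q \<in> fst a \<inter> fst b \<inter> U"
    have "snd a q \<in> snd a ` (fst a \<inter> fst b \<inter> U)" using q by blast
    from fd[OF ab this] show "ip (metric M (snd a) q) X Y = ip (metric M (snd b) q)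
       (frechet_derivative (coord_map (restrict_chart U a) (restrict_chart U b) id) (at (snd a q)) X)
       (frechet_derivative (coord_map (restrict_chart U a) (restrict_chart U b) id) (at (snd a q)) Y)"
      using riemannian_metric_transition[OF me ab, of q X Y] q by simp
  qed
  ultimately show ?thesis using U(2,3) pts by (simp add: riemannian_manifold_def)
qed


section \<open>Local horospherical immersions of flat surfaces\<close>

definition plane_slice :: "real^2 \<Rightarrow> real^3" where
  "plane_slice v = vector [v$1, v$2, 0]"

lemma plane_slice_simps [simp]:
  "plane_slice v $ 1 = v $ 1" "plane_slice v $ 2 = v $ 2" "plane_slice v $ 3 = 0"
  "plane_slice v \<bullet> plane_slice w = v \<bullet> w"
  by (simp_all add: plane_slice_def inner_vec_def sum_2 sum_3)

lemma bounded_linear_plane_slice: "bounded_linear plane_slice"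
  by (intro linear_conv_bounded_linear[THEN iffD1] linearI) (simp_all add: vec_eq_iff forall_3)

text \<open>Flat coordinates \<open>f\<close> in one chart around \<open>p\<close>, followed by the inclusion of the plane as the slice \<open>z = 0\<close>, are
  an isometric immersion \<open>\<psi>\<close> of a neighbourhood \<open>U\<close> onto a piece of a horosphere (a plane if \<open>k = 0\<close>). The
  quantities attached to \<open>\<psi>\<close> have to be found in every chart of the surface: there the coordinate expression
  of \<open>\<psi>\<close> differs from \<open>f\<close> by a transition map, which is isometric for the Gram matrices and preserves the
  orientation, so that the local computation applies to each chart directly.\<close>

theorem flat_surface_local_horosphere:
  fixes M :: "('m::{t2_space,second_countable_topology}, 2) riemannian"
  assumes M: "riemannian_manifold M" and K: "has_gaussian_curvature M K" "\<forall>p\<in>points M. K p = 0"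
    and p: "p \<in> points M" and k: "0 \<le> k"
  shows "\<exists>U \<psi>. openin (top_of_set (points M)) U \<and> p \<in> U
    \<and> surface (restrict_manifold M U) (horo_space k) \<psi>
    \<and> umbilical (restrict_manifold M U) (horo_space k) \<psi>
    \<and> (\<forall>q\<in>U. \<forall>a\<in>charts_at M q. \<forall>b\<in>charts_at (horo_space k) (\<psi> q). \<forall>X.
        shape_normal (gram (restrict_manifold M U) (restrict_chart U a)) (gram (horo_space k) b)
          (coord_map (restrict_chart U a) b \<psi>) (snd a q) X = k *\<^sub>R X)
    \<and> (\<forall>q\<in>U. H_norm (restrict_manifold M U) (horo_space k) \<psi> q = k)"
proof -
  have at: "oriented_atlas M" and me: "riemannian_metric M" using M unfolding riemannian_manifold_def by blast+
  note c = chart_facts[OF at]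
  obtain a0 where a0: "a0 \<in> atlas M" "p \<in> fst a0"
    using chart_exists[OF at p] unfolding charts_at_def by blast
  obtain r where r: "r > 0" "ball (snd a0 p) r \<subseteq> snd a0 ` fst a0"
    using c(1)[OF a0(1)] a0(2) open_contains_ball by blast
  let ?B = "ball (snd a0 p) r"
  have flat: "sectional_curvature (gram M a0) u (axis 1 1) (axis 2 1) = 0" if u: "u \<in> ?B" for u
  proof -
    obtain q where q: "q \<in> fst a0" "u = snd a0 q" using r(2) u by blast
    then have qM: "q \<in> points M" using c(4)[OF a0(1)] by blast
    have "a0 \<in> charts_at M q" using a0(1) q(1) by (simp add: charts_at_def)
    from K(1)[unfolded has_gaussian_curvature_def, rule_format, OF qM this] show ?thesis
      using K(2) qM q(2) by simp
  qed
  obtain f where f: "smooth_on f ?B"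
    "\<And>u X Y. u \<in> ?B \<Longrightarrow> frechet_derivative f (at u) X \<bullet> frechet_derivative f (at u) Y = ip (gram M a0 u) X Y"
    "\<And>u. u \<in> ?B \<Longrightarrow> 0 < det (matrix (frechet_derivative f (at u)))"
  proof (rule flat_metric_coordinates[OF open_ball convex_ball _ _ flat])
    show "smooth_on (gram M a0) ?B" by (rule smooth_on_subset[OF smooth_gram[OF me a0(1)] r(2)])
    show "inner_product (gram M a0 w)" if "w \<in> ?B" for w
      by (rule gram_inner_product[OF at me a0(1)]) (use r(2) that in blast)
    fix f assume 1: "smooth_on f ?B"
      and 2: "\<And>u X Y. u \<in> ?B \<Longrightarrow> frechet_derivative f (at u) X \<bullet> frechet_derivative f (at u) Y = ip (gram M a0 u) X Y"
      and 3: "\<And>u. u \<in> ?B \<Longrightarrow> 0 < det (matrix (frechet_derivative f (at u)))"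
    show thesis by (rule that[OF 1]) (rule 2, assumption, rule 3, assumption)
  qed assumption
  define U where "U = coord_inv a0 ` ?B"
  define \<psi> where "\<psi> q = plane_slice (f (snd a0 q))" for q
  let ?M = "restrict_manifold M U" and ?Q = "horo_space k" and ?id = "(UNIV, id) :: (real^3, 3) chart"
  have hom: "homeomorphism (snd a0 ` fst a0) (fst a0) (coord_inv a0) (snd a0)"
    by (rule homeomorphism_symD[OF c(3)[OF a0(1)]])
  have "coord_inv a0 ` (snd a0 ` fst a0) = fst a0" using hom by (simp add: homeomorphism_def)
  then have U_fst: "U \<subseteq> fst a0" using image_mono[OF r(2), of "coord_inv a0"] by (simp add: U_def)
  have U_ball: "snd a0 q \<in> ?B" if "q \<in> U" for q
  proof -
    from that obtain v where v: "v \<in> ?B" "q = coord_inv a0 v" unfolding U_def by (rule imageE)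
    then have "v \<in> snd a0 ` fst a0" using r(2) by blast
    then show ?thesis using v by (simp add: f_inv_into_f)
  qed
  have "openin (top_of_set (snd a0 ` fst a0)) ?B"
    using r(2) by (metis inf.absorb_iff2 open_ball openin_open_Int)
  then have "openin (top_of_set (fst a0)) U"
    unfolding U_def by (rule homeomorphism_imp_open_map[OF hom])
  then have Uo: "openin (top_of_set (points M)) U" using c(2)[OF a0(1)] openin_trans by blast
  have pU: "p \<in> U" unfolding U_def
    using c(6)[OF a0] r(1) by (intro image_eqI[of _ _ "snd a0 p"]) auto
  have "continuous_on ?B (coord_inv a0)"
    by (rule continuous_on_subset[OF homeomorphism_cont1[OF hom] r(2)])
  then have Uc: "connected U" unfolding U_def by (intro connected_continuous_image convex_connected convex_ball)
  have M': "riemannian_manifold ?M" by (rule riemannian_manifold_restrict[OF M Uo Uc]) (use pU in blast)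
  have UM: "U \<subseteq> points M" using Uo openin_imp_subset by blast
  have pts: "points ?M = U" using UM by (auto simp: restrict_simps)
  have local: "smooth_on (coord_map (restrict_chart U a) ?id \<psi>) T"
    "\<And>w. w \<in> T \<Longrightarrow> coord_map (restrict_chart U a) ?id \<psi> w $ 3 = 0"
    "\<And>w X Y. w \<in> T \<Longrightarrow> ip (gram M a w) X Y = frechet_derivative (coord_map (restrict_chart U a) ?id \<psi>) (at w) X
        \<bullet> frechet_derivative (coord_map (restrict_chart U a) ?id \<psi>) (at w) Y"
    "\<And>w. w \<in> T \<Longrightarrow> 0 < frechet_derivative (coord_map (restrict_chart U a) ?id \<psi>) (at w) (axis 1 1) $ 1
        * frechet_derivative (coord_map (restrict_chart U a) ?id \<psi>) (at w) (axis 2 1) $ 2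
      - frechet_derivative (coord_map (restrict_chart U a) ?id \<psi>) (at w) (axis 1 1) $ 2
        * frechet_derivative (coord_map (restrict_chart U a) ?id \<psi>) (at w) (axis 2 1) $ 1"
    if a: "a \<in> atlas M" and T: "T = snd a ` (fst a \<inter> U)" for a T
  proof -
    let ?F = "coord_map (restrict_chart U a) ?id \<psi>" and ?t = "coord_map a a0 id"
    have T_open: "open T" unfolding T by (rule chart_image_open[OF at a Uo])
    have F: "plane_slice (f (?t w)) = ?F w" and t_ball: "?t w \<in> ?B"
      and t_gram: "gram M a w = metric M (snd a) (coord_inv a w)"
        "gram M a0 (?t w) = metric M (snd a0) (coord_inv a w)"
      and w_chart: "coord_inv a w \<in> fst a \<inter> fst a0" "snd a (coord_inv a w) = w" if w: "w \<in> T" for w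
    proof -
      obtain q where q: "q \<in> fst a" "q \<in> U" "w = snd a q" using w T by blast
      have inv: "coord_inv a w = q" using c(6)[OF a q(1)] q(3) by simp
      have "coord_inv (restrict_chart U a) w = q"
        using coord_inv_restrict[OF c(5)[OF a]] w T inv by simp
      then show "plane_slice (f (?t w)) = ?F w"
        by (simp add: coord_map_def inv \<psi>_def)
      show "?t w \<in> ?B" using U_ball[OF q(2)] by (simp add: coord_map_def inv)
      show "gram M a w = metric M (snd a) (coord_inv a w)" by (simp add: gram_def)
      show "gram M a0 (?t w) = metric M (snd a0) (coord_inv a w)"
        using gram_chart[OF at a0(1), of q] q(2) U_fst by (auto simp: coord_map_def inv)
      show "coord_inv a w \<in> fst a \<inter> fst a0" "snd a (coord_inv a w) = w" using inv q U_fst by auto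
    qed
    have t_smooth: "smooth_on ?t T"
    proof -
      have "smooth_on ?t (snd a ` (fst a \<inter> fst a0))" using at a a0(1) unfolding oriented_atlas_def by blast
      then show ?thesis by (rule smooth_on_subset) (use U_fst T in blast)
    qed
    have "smooth_on (\<lambda>w. f (?t w)) T"
      by (rule smooth_on_compose[OF T_open open_ball _ f(1) t_smooth]) (use t_ball in blast)
    from smooth_on_cong[OF T_open F smooth_on_bounded_linear[OF bounded_linear_plane_slice T_open this]]
    show "smooth_on ?F T" by blast
    show "?F w $ 3 = 0" if "w \<in> T" for w using F[OF that, symmetric] by simp
    have DF: "frechet_derivative ?F (at w)
        = (\<lambda>X. plane_slice (frechet_derivative f (at (?t w)) (frechet_derivative ?t (at w) X)))" if w: "w \<in> T" for w
    proof -
      have e: "frechet_derivative ?F (at w) = frechet_derivative (\<lambda>w. plane_slice (f (?t w))) (at w)"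
        by (rule frechet_derivative_cong_open[OF T_open w F[symmetric]])
      have "((\<lambda>w. plane_slice (f (?t w))) has_derivative
        (\<lambda>X. plane_slice (frechet_derivative f (at (?t w)) (frechet_derivative ?t (at w) X)))) (at w)"
        by (rule bounded_linear.has_derivative[OF bounded_linear_plane_slice
            diff_chain_at[OF smooth_on_has_derivative[OF t_smooth T_open w]
              smooth_on_has_derivative[OF f(1) open_ball t_ball[OF w]], unfolded o_def]])
      from frechet_derivative_eqI[OF this] show ?thesis unfolding e .
    qed
    show "ip (gram M a w) X Y = frechet_derivative ?F (at w) X \<bullet> frechet_derivative ?F (at w) Y" if w: "w \<in> T" for w X Y
    proof -
      let ?q = "coord_inv a w"
      have "ip (metric M (snd a) ?q) X Y = ip (metric M (snd a0) ?q)
          (frechet_derivative ?t (at (snd a ?q)) X) (frechet_derivative ?t (at (snd a ?q)) Y)"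
        using riemannian_metric_transition[OF me a a0(1)] w_chart(1)[OF w] by blast
      then show ?thesis
        by (simp add: DF[OF w] f(2)[OF t_ball[OF w]] t_gram[OF w] w_chart(2)[OF w])
    qed
    show "0 < frechet_derivative ?F (at w) (axis 1 1) $ 1 * frechet_derivative ?F (at w) (axis 2 1) $ 2
      - frechet_derivative ?F (at w) (axis 1 1) $ 2 * frechet_derivative ?F (at w) (axis 2 1) $ 1" if w: "w \<in> T" for w
    proof -
      let ?Df = "frechet_derivative f (at (?t w))" and ?Dt = "frechet_derivative ?t (at w)"
      \<comment> \<open>The minor is the determinant of \<open>D(f \<circ> \<tau>)\<close> for the transition map \<open>\<tau>\<close>, a product of positive factors.\<close>
      have "w \<in> snd a ` (fst a \<inter> fst a0)" using w T U_fst by blast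
      then have "0 < det (matrix ?Dt)" using at a a0(1) unfolding oriented_atlas_def by blast
      then have "0 < det (matrix ?Df ** matrix ?Dt)" using f(3)[OF t_ball[OF w]] by (simp add: det_mul)
      also have "matrix ?Df ** matrix ?Dt = matrix (?Df \<circ> ?Dt)"
        using smooth_on_has_derivative[OF t_smooth T_open w] smooth_on_has_derivative[OF f(1) open_ball t_ball[OF w]]
        by (intro matrix_compose[symmetric]) (blast intro: has_derivative_linear)+
      finally show ?thesis by (simp add: det_2 matrix_def DF[OF w] mult.commute)
    qed
  qed
  have Tq: "open (snd a ` (fst a \<inter> U))" "snd a q \<in> snd a ` (fst a \<inter> U)"
    if "a \<in> charts_at M q" "q \<in> U" for a q
    using that chart_image_open[OF at _ Uo] by (auto simp: charts_at_def)
  have umbilic: "shape_normal (gram ?M (restrict_chart U a)) (horo_metric k) (coord_map (restrict_chart U a) ?id \<psi>) (snd a q) X = k *\<^sub>R X"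
    "mean_curvature_norm (gram ?M (restrict_chart U a)) (horo_metric k) (coord_map (restrict_chart U a) ?id \<psi>) (snd a q) = k"
    if aq: "a \<in> charts_at M q" and q: "q \<in> U" for a q X
  proof -
    let ?T = "snd a ` (fst a \<inter> U)" and ?G = "gram ?M (restrict_chart U a)" and ?F = "coord_map (restrict_chart U a) ?id \<psi>"
    have a: "a \<in> atlas M" using aq by (simp add: charts_at_def)
    note T = Tq[OF aq q] and L = local[OF a refl]
    have G: "?G w = gram M a w" if "w \<in> ?T" for w by (rule coord_map_restrict(2)[OF c(5)[OF a] that])
    have sG: "smooth_on ?G ?T"
      by (rule smooth_on_cong[OF T(1) G[symmetric]], assumption)
        (rule smooth_on_subset[OF smooth_gram[OF me a]], blast)
    have iG: "inner_product (?G (snd a q))"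
      unfolding G[OF T(2)] by (rule gram_inner_product[OF at me a]) (use T(2) in blast)
    have iso: "ip (?G w) X Y = frechet_derivative ?F (at w) X \<bullet> frechet_derivative ?F (at w) Y" if "w \<in> ?T" for w X Y
      unfolding G[OF that] by (rule L(3)[OF that])
    note H = second_ff_horosphere[OF T L(1) sG iG L(2) iso L(4)[OF T(2)]]
    show "shape_normal ?G (horo_metric k) ?F (snd a q) X = k *\<^sub>R X"
      by (rule umbilic_shape(1)[where G = ?G and u = "snd a q", OF iG]; rule H; assumption)
    show "mean_curvature_norm ?G (horo_metric k) ?F (snd a q) = k"
      by (rule umbilic_shape(2)[where G = ?G and u = "snd a q", OF iG _ _ k]; rule H; assumption)
  qed
  have "smooth_map ?M ?Q \<psi>"
    unfolding smooth_map_def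
  proof (intro conjI)
    have "continuous_on U (snd a0)" by (rule continuous_on_subset[OF homeomorphism_cont2[OF hom] U_fst])
    then have "continuous_on U (\<lambda>q. f (snd a0 q))"
      by (rule continuous_on_compose2[OF smooth_on_continuous[OF f(1)]]) (use U_ball in blast)
    then show "continuous_on (points ?M) \<psi>"
      unfolding pts \<psi>_def[abs_def] by (rule bounded_linear.continuous_on[OF bounded_linear_plane_slice])
    show "\<forall>a\<in>atlas ?M. \<forall>b\<in>atlas ?Q. smooth_on (coord_map a b \<psi>) (snd a ` (fst a \<inter> \<psi> -` fst b))"
      using local(1)[OF _ refl] by (auto simp: restrict_simps)
  qed simp
  moreover have "ip (horo_metric k (\<psi> q)) (frechet_derivative (coord_map (restrict_chart U a) ?id \<psi>) (at (snd a q)) X)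
      (frechet_derivative (coord_map (restrict_chart U a) ?id \<psi>) (at (snd a q)) Y) = ip (metric M (snd a) q) X Y"
    if aq: "a \<in> charts_at M q" and q: "q \<in> U" for a q X Y
  proof -
    let ?F = "coord_map (restrict_chart U a) ?id \<psi>"
    have a: "a \<in> atlas M" "q \<in> fst a" using aq by (auto simp: charts_at_def)
    note T = Tq[OF aq q] and L = local[OF a(1) refl]
    have D3: "frechet_derivative ?F (at (snd a q)) X $ 3 = 0" for X
      by (rule derivative_vanishing_component[OF T(1) L(1,2) T(2)])
    have "ip (metric M (snd a) q) X Y = frechet_derivative ?F (at (snd a q)) X \<bullet> frechet_derivative ?F (at (snd a q)) Y"
      using L(3)[OF T(2)] gram_chart[OF at a] by simp
    then show ?thesis
      by (simp add: ip_horo_metric D3 inner_vec_def sum_3 \<psi>_def)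
  qed
  ultimately have "isometric_immersion ?M ?Q \<psi>"
    unfolding isometric_immersion_def pts by (auto simp: restrict_simps)
  then have surf: "surface ?M ?Q \<psi>"
    using M' riemannian_manifold_horo_space by (simp add: surface_def)
  have umb: "umbilical ?M ?Q \<psi>"
    unfolding umbilical_def pts using umbilic(1) by (auto simp: restrict_simps)
  have H: "H_norm ?M ?Q \<psi> q = k" if q: "q \<in> U" for q
    unfolding H_norm_def
  proof (rule the_equality)
    show "\<forall>a\<in>charts_at ?M q. \<forall>b\<in>charts_at ?Q (\<psi> q).
        mean_curvature_norm (gram ?M a) (gram ?Q b) (coord_map a b \<psi>) (snd a q) = k"
      using umbilic(2) q by (auto simp: restrict_simps)
    fix h assume h: "\<forall>a\<in>charts_at ?M q. \<forall>b\<in>charts_at ?Q (\<psi> q).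
        mean_curvature_norm (gram ?M a) (gram ?Q b) (coord_map a b \<psi>) (snd a q) = h"
    obtain a where "a \<in> charts_at M q" using chart_exists[OF at] q UM by blast
    then show "h = k" using h umbilic(2)[of a q] q by (simp add: restrict_simps)
  qed
  have shape: "shape_normal (gram ?M (restrict_chart U a)) (gram ?Q b) (coord_map (restrict_chart U a) b \<psi>) (snd a q) X = k *\<^sub>R X"
    if "q \<in> U" "a \<in> charts_at M q" "b \<in> charts_at ?Q (\<psi> q)" for q a b X
    using umbilic(1) that by simp
  show ?thesis
    by (intro exI[of _ U] exI[of _ \<psi>] conjI ballI allI Uo pU surf umb shape H)
qed

section \<open>Surfaces with equal constant principal curvatures\<close>

text \<open>The value \<open>sqrt l\<close> of the mean curvature norm depends on no chart, which gives the definite description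
  in \<^const>\<open>H_norm\<close> its value.\<close>

lemma double_principal_curvature_surface:
  fixes M :: "('m::{t2_space,second_countable_topology}, 2) riemannian"
    and N :: "('n::{t2_space,second_countable_topology}, 'd::finite) riemannian"
  assumes sf: "surface M N \<phi>"
    and pc: "principal_curvatures M N \<phi> l\<^sub>1 l\<^sub>2" "l\<^sub>1 q = l" "l\<^sub>2 q = l"
    and q: "q \<in> points M"
  shows "\<And>a b X. a \<in> charts_at M q \<Longrightarrow> b \<in> charts_at N (\<phi> q) \<Longrightarrow>
      shape_H (gram M a) (gram N b) (coord_map a b \<phi>) (snd a q) X = l *\<^sub>R X"
    and "\<And>a b X. a \<in> charts_at M q \<Longrightarrow> b \<in> charts_at N (\<phi> q) \<Longrightarrow>
      stress_bienergy (gram M a) (gram N b) (coord_map a b \<phi>) (snd a q) X = (2 * l) *\<^sub>R X"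
    and "0 \<le> l" "H_norm M N \<phi> q = sqrt l"
proof -
  have M: "oriented_atlas M" "riemannian_metric M" and N: "oriented_atlas N" "riemannian_metric N"
    and sm: "smooth_map M N \<phi>"
    using sf unfolding surface_def riemannian_manifold_def isometric_immersion_def by blast+
  have pN: "\<phi> q \<in> points N" using sm q unfolding smooth_map_def by blast
  have local: "shape_H (gram M a) (gram N b) (coord_map a b \<phi>) (snd a q) X = l *\<^sub>R X" "0 \<le> l"
    "mean_curvature_norm (gram M a) (gram N b) (coord_map a b \<phi>) (snd a q) = sqrt l"
    "stress_bienergy (gram M a) (gram N b) (coord_map a b \<phi>) (snd a q) X = (2 * l) *\<^sub>R X"
    if ab: "a \<in> charts_at M q" "b \<in> charts_at N (\<phi> q)" for a b X
  proof -
    have a: "a \<in> atlas M" "q \<in> fst a" and b: "b \<in> atlas N" "\<phi> q \<in> fst b"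
      using ab by (auto simp: charts_at_def)
    let ?S = "snd a ` (fst a \<inter> \<phi> -` fst b)" and ?F = "coord_map a b \<phi>"
    have "openin (top_of_set (points M)) (points M \<inter> \<phi> -` fst b)"
      using sm chart_facts(2)[OF N(1) b(1)] unfolding smooth_map_def
      by (meson continuous_openin_preimage image_subset_iff_funcset)
    from chart_image_open[OF M(1) a(1) this] have S: "open ?S"
      using chart_facts(4)[OF M(1) a(1)] by (simp add: Int_assoc[symmetric] Int_absorb2)
    have u: "snd a q \<in> ?S" using a b by blast
    have T: "?F (snd a q) \<in> snd b ` fst b"
      using b(2) by (simp add: coord_map_def chart_facts(6)[OF M(1) a])
    have F: "smooth_on ?F ?S" using sm a(1) b(1) unfolding smooth_map_def by blast
    have G: "smooth_on (gram M a) ?S" by (rule smooth_on_subset[OF smooth_gram[OF M(2) a(1)]]) blast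
    have iG: "inner_product (gram M a w)" if "w \<in> ?S" for w
      by (rule gram_inner_product[OF M a(1)]) (use that in blast)
    have eig: "{t. \<exists>X. X \<noteq> 0 \<and> shape_H (gram M a) (gram N b) ?F (snd a q) X = t *\<^sub>R X} = {l}"
      using pc q ab unfolding principal_curvatures_def by simp
    note * = double_principal_curvature[OF S u chart_facts(1)[OF N(1) b(1)] T F G iG
        smooth_gram[OF N(2) b(1)] gram_inner_product[OF N b(1)] eig]
    show "shape_H (gram M a) (gram N b) ?F (snd a q) X = l *\<^sub>R X" by (rule *(1))
    show "0 \<le> l" by (rule *(2))
    show "mean_curvature_norm (gram M a) (gram N b) ?F (snd a q) = sqrt l" by (rule *(3))
    show "stress_bienergy (gram M a) (gram N b) ?F (snd a q) X = (2 * l) *\<^sub>R X" by (rule *(4))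
  qed
  show "shape_H (gram M a) (gram N b) (coord_map a b \<phi>) (snd a q) X = l *\<^sub>R X"
    if "a \<in> charts_at M q" "b \<in> charts_at N (\<phi> q)" for a b X
    by (rule local(1)[OF that])
  show "stress_bienergy (gram M a) (gram N b) (coord_map a b \<phi>) (snd a q) X = (2 * l) *\<^sub>R X"
    if "a \<in> charts_at M q" "b \<in> charts_at N (\<phi> q)" for a b X
    by (rule local(4)[OF that])
  obtain a where a: "a \<in> charts_at M q" by (rule chart_exists[OF M(1) q])
  obtain b where b: "b \<in> charts_at N (\<phi> q)" by (rule chart_exists[OF N(1) pN])
  show "0 \<le> l" by (rule local(2)[OF a b])
  show "H_norm M N \<phi> q = sqrt l"
    unfolding H_norm_def
  proof (rule the_equality)
    fix h assume "\<forall>a\<in>charts_at M q. \<forall>b\<in>charts_at N (\<phi> q).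
      mean_curvature_norm (gram M a) (gram N b) (coord_map a b \<phi>) (snd a q) = h"
    then show "h = sqrt l" using local(3)[OF a b] a b by simp
  qed (simp add: local(3))
qed

theorem theorem4p20:
  fixes M :: "('m::{t2_space,second_countable_topology}, 2) riemannian"
    and N :: "('n::{t2_space,second_countable_topology}, 'd::finite) riemannian"
    and \<phi> :: "'m \<Rightarrow> 'n"
    and l\<^sub>1 l\<^sub>2 K :: "'m \<Rightarrow> real"
  assumes "biconservative_surface M N \<phi>"
    and "principal_curvatures M N \<phi> l\<^sub>1 l\<^sub>2"
    and "l\<^sub>1 constant_on points M" and "l\<^sub>2 constant_on points M"
    and "\<forall>p\<in>points M. l\<^sub>1 p = l\<^sub>2 p"
    and "has_gaussian_curvature M K"
    and "\<forall>p\<in>points M. K p = 0"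
  shows "(\<exists>c (Q :: (real^3, 3) riemannian).
        (\<forall>p\<in>points M. c = - ((H_norm M N \<phi> p) ^ 4))
      \<and> space_form c Q
      \<and> (\<forall>p\<in>points M. \<exists>U \<psi>.
           openin (top_of_set (points M)) U \<and> p \<in> U
         \<and> surface (restrict_manifold M U) Q \<psi>
         \<and> umbilical (restrict_manifold M U) Q \<psi>
         \<and> (\<forall>q\<in>U. \<forall>a\<in>charts_at M q. \<forall>b\<in>charts_at N (\<phi> q). \<forall>b'\<in>charts_at Q (\<psi> q). \<forall>X.
              shape_H (gram M a) (gram N b) (coord_map a b \<phi>) (snd a q) X
            = shape_normal (gram (restrict_manifold M U) (restrict_chart U a)) (gram Q b')
                (coord_map (restrict_chart U a) b' \<psi>) (snd a q) X)
         \<and> (\<forall>q\<in>U. H_norm (restrict_manifold M U) Q \<psi> q = (H_norm M N \<phi> q)\<^sup>2)))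
    \<and> (\<exists>c (Q :: (real^3, 3) riemannian).
        (\<forall>p\<in>points M. c = - 4 * (H_norm M N \<phi> p) ^ 4)
      \<and> space_form c Q
      \<and> (\<forall>p\<in>points M. \<exists>U \<psi>.
           openin (top_of_set (points M)) U \<and> p \<in> U
         \<and> surface (restrict_manifold M U) Q \<psi>
         \<and> umbilical (restrict_manifold M U) Q \<psi>
         \<and> (\<forall>q\<in>U. \<forall>a\<in>charts_at M q. \<forall>b\<in>charts_at N (\<phi> q). \<forall>b'\<in>charts_at Q (\<psi> q). \<forall>X.
              stress_bienergy (gram M a) (gram N b) (coord_map a b \<phi>) (snd a q) X
            = shape_normal (gram (restrict_manifold M U) (restrict_chart U a)) (gram Q b')
                (coord_map (restrict_chart U a) b' \<psi>) (snd a q) X)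
         \<and> (\<forall>q\<in>U. H_norm (restrict_manifold M U) Q \<psi> q = 2 * (H_norm M N \<phi> q)\<^sup>2)))"
proof -
  have sf: "surface M N \<phi>" using assms(1) by (simp add: biconservative_surface_def)
  then have M: "riemannian_manifold M" by (simp add: surface_def)
  then obtain p0 where p0: "p0 \<in> points M" unfolding riemannian_manifold_def by blast
  define l where "l = l\<^sub>1 p0"
  have l12: "l\<^sub>1 q = l" "l\<^sub>2 q = l" if "q \<in> points M" for q
    using assms(3,5) that p0 unfolding constant_on_def l_def by metis+
  note phi = double_principal_curvature_surface[OF sf assms(2) l12 _]
  have l: "0 \<le> l" using phi(3)[OF p0 p0 p0] .
  have H: "H_norm M N \<phi> q = sqrt l" if "q \<in> points M" for q
    using phi(4)[OF that that that] .
  \<comment> \<open>Both parts are instances, with \<open>T = A\<^sub>H\<close>, \<open>k = l\<close> and with \<open>T = S\<^sub>2\<close>, \<open>k = 2 l\<close>.\<close>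
  have main: "\<exists>U \<psi>. openin (top_of_set (points M)) U \<and> p \<in> U
      \<and> surface (restrict_manifold M U) (horo_space k) \<psi>
      \<and> umbilical (restrict_manifold M U) (horo_space k) \<psi>
      \<and> (\<forall>q\<in>U. \<forall>a\<in>charts_at M q. \<forall>b\<in>charts_at N (\<phi> q). \<forall>b'\<in>charts_at (horo_space k) (\<psi> q). \<forall>X.
          T a b q X = shape_normal (gram (restrict_manifold M U) (restrict_chart U a)) (gram (horo_space k) b')
            (coord_map (restrict_chart U a) b' \<psi>) (snd a q) X)
      \<and> (\<forall>q\<in>U. H_norm (restrict_manifold M U) (horo_space k) \<psi> q = h q)"
    if pM: "p \<in> points M" and k: "0 \<le> k" and hk: "\<And>q. q \<in> points M \<Longrightarrow> h q = k"
      and T: "\<And>q a b X. q \<in> points M \<Longrightarrow> a \<in> charts_at M q \<Longrightarrow> b \<in> charts_at N (\<phi> q) \<Longrightarrow> T a b q X = k *\<^sub>R X"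
    for p k h T
  proof -
    obtain U \<psi> where U: "openin (top_of_set (points M)) U" "p \<in> U"
      "surface (restrict_manifold M U) (horo_space k) \<psi>"
      "umbilical (restrict_manifold M U) (horo_space k) \<psi>"
      and shape: "\<forall>q\<in>U. \<forall>a\<in>charts_at M q. \<forall>b\<in>charts_at (horo_space k) (\<psi> q). \<forall>X.
        shape_normal (gram (restrict_manifold M U) (restrict_chart U a)) (gram (horo_space k) b)
          (coord_map (restrict_chart U a) b \<psi>) (snd a q) X = k *\<^sub>R X"
      and H\<psi>: "\<forall>q\<in>U. H_norm (restrict_manifold M U) (horo_space k) \<psi> q = k"
      using flat_surface_local_horosphere[OF M assms(6,7) pM k] by (elim exE conjE)
    have UM: "q \<in> points M" if "q \<in> U" for q using openin_imp_subset[OF U(1)] that by blast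
    show ?thesis
      by (intro exI[of _ U] exI[of _ \<psi>] conjI ballI allI U(1-4))
        (simp_all only: T[OF UM] shape[rule_format] H\<psi>[rule_format] hk[OF UM])
  qed
  have H2: "(H_norm M N \<phi> q)\<^sup>2 = l" if "q \<in> points M" for q
    using l by (simp add: H[OF that])
  have H4: "H_norm M N \<phi> q ^ 4 = l\<^sup>2" if "q \<in> points M" for q
    using power_mult[of "H_norm M N \<phi> q" 2 2] by (simp add: H2[OF that])
  show ?thesis
  proof (rule conjI, goal_cases)
    case 1
    show ?case
      by (intro exI[of _ "- l\<^sup>2"] exI[of _ "horo_space l"] conjI ballI space_form_horo_space main l phi(1))
        (simp_all add: H2 H4 l)
  next
    case 2
    show ?case
      by (intro exI[of _ "- (2 * l)\<^sup>2"] exI[of _ "horo_space (2 * l)"] conjI ballI space_form_horo_space main phi(2))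
        (simp_all add: H2 H4 l power_mult_distrib)
  qed
qed

end
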